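(* Let $V$ be a simple vertex operator algebra of the moonshine type with central charge $c\neq 0$ such that $V$ is generated by $V_2$ and $V_2$ is 2-dimensional. Then: - if the algebra $V_2$ is semisimple, $V$ is isomorphic to $L(c_1,0)\otimes L(c_2,0)$ for some nonzero complex numbers $c_1,c_2$ such that $c_1+c_2=c$; - if the algebra $V_2$ is not semisimple, $V$ is isomorphic to $L(c,0,0)$.
   Context: Vertex operator algebras are over $\mathbb{C}$, with $Y(u,z)=\sum_{m\in\mathbb{Z}}u_mz^{-m-1}$, vacuum $\mathbf 1$ and Virasoro element $\omega$. A simple vertex operator algebra $V$ is of the moonshine type if $V=\bigoplus_{n\ge 0}V_n$, $V_0=\mathbb{C}\mathbf 1$ and $V_1=0$. In this case $V_2$ is a commutative algebra under the product $ab=a_1b$ ($a,b\in V_2$), with identity $\omega/2$; when $\dim V_2=2$ it is therefore also associative. $L(c,0)$ denotes the simple Virasoro vertex operator algebra of central charge $c$, i.e. the irreducible highest weight module for the Virasoro algebra with central charge $c$ and highest weight $0$, with its standard vertex operator algebra structure. $W(2,2)$ is the complex Lie algebra with basis $L_m, W_m$ ($m\in\mathbb{Z}$), $C$, and bracket $[L_m,L_n]=(m-n)L_{m+n}+\frac{m^3-m}{12}\delta_{m+n,0}C$, $[L_m,W_n]=(m-n)W_{m+n}+\frac{m^3-m}{12}\delta_{m+n,0}C$, $[W_m,W_n]=0$, with $C$ central. $L(c,0,0)$ is the irreducible quotient of $V(c,0,0)=U(W(2,2))/I$, where $I$ is the left ideal generated by $L_m,W_m$ ($m\ge 0$) and $C-c$.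 For $c\neq0$, $L(c,0,0)$ carries the vertex operator algebra structure with vacuum $\mathbf 1$ the image of $1$, Virasoro element $\omega=L_{-2}\mathbf 1$, generated by $\omega$ and $x=W_{-2}\mathbf 1$, with $Y(\omega,z)=\sum_nL_nz^{-n-2}$ and $Y(x,z)=\sum_nW_nz^{-n-2}$. *)

theory Defs
  imports "HOL-Algebra.Algebraic_Closure_Type" "HOL-Algebra.Free_Abelian_Groups" "HOL-Library.Poly_Mapping"
begin

section \<open>Vector spaces over the complex numbers\<close>

abbreviation complex_field :: "complex ring" where
  "complex_field \<equiv> ring_of_type_algebra"

abbreviation vsubspace :: "(complex, 'a, 'm) module_scheme \<Rightarrow> 'a set \<Rightarrow> bool" where
  "vsubspace V S \<equiv> submodule S complex_field V"

definition is_basis :: "(complex, 'a, 'm) module_scheme \<Rightarrow> 'a set \<Rightarrow> 'a set \<Rightarrow> bool" where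
  "is_basis V S B \<longleftrightarrow> B \<subseteq> S \<and> finite B \<and>
     (\<forall>v\<in>S. \<exists>!f. f \<in> B \<rightarrow>\<^sub>E UNIV \<and> v = (\<Oplus>\<^bsub>V\<^esub>b\<in>B. f b \<odot>\<^bsub>V\<^esub> b))"

definition has_dim :: "(complex, 'a, 'm) module_scheme \<Rightarrow> 'a set \<Rightarrow> nat \<Rightarrow> bool" where
  "has_dim V S n \<longleftrightarrow> vsubspace V S \<and> (\<exists>B. is_basis V S B \<and> card B = n)"

text \<open>Sums with finitely many nonzero terms.\<close>

abbreviation fsum :: "(complex, 'a, 'm) module_scheme \<Rightarrow> (nat \<Rightarrow> 'a) \<Rightarrow> 'a" where
  "fsum V f \<equiv> gfinprod (add_monoid V) f UNIV"

section \<open>Vertex operator algebras\<close>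

text \<open>
  The fields \<open>mult\<close> and \<open>one\<close> inherited from the record of modules play no role
  (as for every HOL-Algebra module that is not an algebra).
  \<open>mode V u n v\<close> is $u_n v$.
\<close>

record 'a voa = "(complex, 'a) module" +
  mode :: "'a \<Rightarrow> int \<Rightarrow> 'a \<Rightarrow> 'a"
  vacuum :: 'a
  conformal :: 'a

text \<open>$L(n) = \omega_{n+1}$, since $Y(\omega,z) = \sum_n L(n) z^{-n-2}$.\<close>

definition vir_op :: "('a, 'm) voa_scheme \<Rightarrow> int \<Rightarrow> 'a \<Rightarrow> 'a" where
  "vir_op V n v = mode V (conformal V) (n + 1) v"

text \<open>The homogeneous subspace $V_n$ is the eigenspace of $L(0)$ for the eigenvalue $n$.\<close>

definition weight_space :: "('a, 'm) voa_scheme \<Rightarrow> int \<Rightarrow> 'a set" where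
  "weight_space V n = {v \<in> carrier V. vir_op V 0 v = of_int n \<odot>\<^bsub>V\<^esub> v}"

text \<open>
  The Jacobi identity is stated in its component form, the Borcherds identity;
  \<open>m gchoose i\<close> is the binomial coefficient for an arbitrary integer \<open>m\<close>.
  In \<open>grading\<close> only the existence of a decomposition into homogeneous components is required:
  the sum of the eigenspaces of $L(0)$ is automatically direct.
\<close>

locale vertex_operator_algebra = module complex_field V
  for V :: "('a, 'm) voa_scheme" +
  fixes c :: complex
  assumes mode_closed:
      "\<lbrakk>u \<in> carrier V; v \<in> carrier V\<rbrakk> \<Longrightarrow> mode V u n v \<in> carrier V"
    and mode_add_left:
      "\<lbrakk>u \<in> carrier V; u' \<in> carrier V; v \<in> carrier V\<rbrakk> \<Longrightarrow>
        mode V (u \<oplus>\<^bsub>V\<^esub> u') n v = mode V u n v \<oplus>\<^bsub>V\<^esub> mode V u' n v"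
    and mode_smult_left:
      "\<lbrakk>u \<in> carrier V; v \<in> carrier V\<rbrakk> \<Longrightarrow>
        mode V (s \<odot>\<^bsub>V\<^esub> u) n v = s \<odot>\<^bsub>V\<^esub> mode V u n v"
    and mode_add_right:
      "\<lbrakk>u \<in> carrier V; v \<in> carrier V; v' \<in> carrier V\<rbrakk> \<Longrightarrow>
        mode V u n (v \<oplus>\<^bsub>V\<^esub> v') = mode V u n v \<oplus>\<^bsub>V\<^esub> mode V u n v'"
    and mode_smult_right:
      "\<lbrakk>u \<in> carrier V; v \<in> carrier V\<rbrakk> \<Longrightarrow>
        mode V u n (s \<odot>\<^bsub>V\<^esub> v) = s \<odot>\<^bsub>V\<^esub> mode V u n v"
    and truncation:
      "\<lbrakk>u \<in> carrier V; v \<in> carrier V\<rbrakk> \<Longrightarrow> \<exists>N. \<forall>n\<ge>N. mode V u n v = \<zero>\<^bsub>V\<^esub>"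
    and vacuum_closed: "vacuum V \<in> carrier V"
    and vacuum_mode:
      "v \<in> carrier V \<Longrightarrow> mode V (vacuum V) n v = (if n = -1 then v else \<zero>\<^bsub>V\<^esub>)"
    and creation:
      "v \<in> carrier V \<Longrightarrow> mode V v (-1) (vacuum V) = v"
      "\<lbrakk>v \<in> carrier V; n \<ge> 0\<rbrakk> \<Longrightarrow> mode V v n (vacuum V) = \<zero>\<^bsub>V\<^esub>"
    and borcherds:
      "\<lbrakk>u \<in> carrier V; v \<in> carrier V; w \<in> carrier V\<rbrakk> \<Longrightarrow>
        fsum V (\<lambda>i. (of_int m gchoose i) \<odot>\<^bsub>V\<^esub> mode V (mode V u (l + int i) v) (m + n - int i) w)
        = fsum V (\<lambda>i. ((-1) ^ i * (of_int l gchoose i)) \<odot>\<^bsub>V\<^esub>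
            (mode V u (m + l - int i) (mode V v (n + int i) w)
             \<ominus>\<^bsub>V\<^esub> ((-1) powi l) \<odot>\<^bsub>V\<^esub> mode V v (n + l - int i) (mode V u (m + int i) w)))"
    and conformal_closed: "conformal V \<in> carrier V"
    and virasoro:
      "v \<in> carrier V \<Longrightarrow>
        vir_op V m (vir_op V n v) \<ominus>\<^bsub>V\<^esub> vir_op V n (vir_op V m v)
        = of_int (m - n) \<odot>\<^bsub>V\<^esub> vir_op V (m + n) v
          \<oplus>\<^bsub>V\<^esub> (if m + n = 0 then of_int (m ^ 3 - m) / 12 * c else 0) \<odot>\<^bsub>V\<^esub> v"
    and translation:
      "\<lbrakk>u \<in> carrier V; v \<in> carrier V\<rbrakk> \<Longrightarrow>
        mode V (vir_op V (-1) u) n v = (- of_int n) \<odot>\<^bsub>V\<^esub> mode V u (n - 1) v"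
    and grading:
      "v \<in> carrier V \<Longrightarrow>
        \<exists>S f. finite S \<and> (\<forall>n\<in>S. f n \<in> weight_space V n) \<and> v = (\<Oplus>\<^bsub>V\<^esub>n\<in>S. f n)"
    and weight_space_finite_dim: "\<exists>d. has_dim V (weight_space V n) d"
    and weights_bounded_below: "\<exists>N. \<forall>n<N. weight_space V n = {\<zero>\<^bsub>V\<^esub>}"

definition simple_voa :: "('a, 'm) voa_scheme \<Rightarrow> complex \<Rightarrow> bool" where
  "simple_voa V c \<longleftrightarrow> vertex_operator_algebra V c \<and> carrier V \<noteq> {\<zero>\<^bsub>V\<^esub>} \<and>
     (\<forall>I. vsubspace V I \<and> (\<forall>u\<in>carrier V. \<forall>n. \<forall>v\<in>I. mode V u n v \<in> I)
        \<longrightarrow> I = {\<zero>\<^bsub>V\<^esub>} \<or> I = carrier V)"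

definition moonshine_type :: "('a, 'm) voa_scheme \<Rightarrow> complex \<Rightarrow> bool" where
  "moonshine_type V c \<longleftrightarrow> simple_voa V c \<and>
     (\<forall>n<0. weight_space V n = {\<zero>\<^bsub>V\<^esub>}) \<and>
     weight_space V 0 = {s \<odot>\<^bsub>V\<^esub> vacuum V | s. True} \<and>
     weight_space V 1 = {\<zero>\<^bsub>V\<^esub>}"

definition vertex_subalgebra :: "('a, 'm) voa_scheme \<Rightarrow> 'a set \<Rightarrow> bool" where
  "vertex_subalgebra V A \<longleftrightarrow> vsubspace V A \<and> vacuum V \<in> A \<and>
     (\<forall>u\<in>A. \<forall>v\<in>A. \<forall>n. mode V u n v \<in> A)"

definition generated_by :: "('a, 'm) voa_scheme \<Rightarrow> 'a set \<Rightarrow> bool" where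
  "generated_by V S \<longleftrightarrow> S \<subseteq> carrier V \<and> (\<forall>A. vertex_subalgebra V A \<and> S \<subseteq> A \<longrightarrow> A = carrier V)"

definition voa_isomorphic :: "('a, 'm) voa_scheme \<Rightarrow> ('b, 'n) voa_scheme \<Rightarrow> bool" where
  "voa_isomorphic V U \<longleftrightarrow> (\<exists>\<phi>. bij_betw \<phi> (carrier V) (carrier U) \<and>
     (\<forall>v\<in>carrier V. \<forall>w\<in>carrier V. \<phi> (v \<oplus>\<^bsub>V\<^esub> w) = \<phi> v \<oplus>\<^bsub>U\<^esub> \<phi> w) \<and>
     (\<forall>s. \<forall>v\<in>carrier V. \<phi> (s \<odot>\<^bsub>V\<^esub> v) = s \<odot>\<^bsub>U\<^esub> \<phi> v) \<and>
     (\<forall>u\<in>carrier V. \<forall>v\<in>carrier V. \<forall>n. \<phi> (mode V u n v) = mode U (\<phi> u) n (\<phi> v)) \<and>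
     \<phi> (vacuum V) = vacuum U \<and> \<phi> (conformal V) = conformal U)"

section \<open>Semisimplicity of an algebra\<close>

text \<open>
  An algebra is semisimple if it is so as a module over itself: every ideal is a direct summand.
  The algebra is a subspace \<open>A\<close> of \<open>V\<close> with product \<open>p\<close>; for $V_2$, which is commutative,
  left ideals are ideals.
\<close>

definition algebra_left_ideal ::
    "(complex, 'a, 'm) module_scheme \<Rightarrow> 'a set \<Rightarrow> ('a \<Rightarrow> 'a \<Rightarrow> 'a) \<Rightarrow> 'a set \<Rightarrow> bool" where
  "algebra_left_ideal V A p I \<longleftrightarrow> vsubspace V I \<and> I \<subseteq> A \<and> (\<forall>a\<in>A. \<forall>x\<in>I. p a x \<in> I)"

definition semisimple_algebra ::
    "(complex, 'a, 'm) module_scheme \<Rightarrow> 'a set \<Rightarrow> ('a \<Rightarrow> 'a \<Rightarrow> 'a) \<Rightarrow> bool" where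
  "semisimple_algebra V A p \<longleftrightarrow>
     (\<forall>I. algebra_left_ideal V A p I \<longrightarrow>
        (\<exists>J. algebra_left_ideal V A p J \<and> I \<inter> J = {\<zero>\<^bsub>V\<^esub>} \<and> I <+>\<^bsub>V\<^esub> J = A))"

definition griess_product :: "('a, 'm) voa_scheme \<Rightarrow> 'a \<Rightarrow> 'a \<Rightarrow> 'a" where
  "griess_product V a b = mode V a 1 b"

section \<open>Quotients of free vector spaces\<close>

definition pscale :: "complex \<Rightarrow> ('x \<Rightarrow>\<^sub>0 complex) \<Rightarrow> ('x \<Rightarrow>\<^sub>0 complex)" where
  "pscale s p = Poly_Mapping.map ((*) s) p"

lemma lookup_pscale: "Poly_Mapping.lookup (pscale s p) k = s * Poly_Mapping.lookup p k"
  by (simp add: pscale_def Poly_Mapping.map.rep_eq when_def)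

lemma vector_space_pscale: "vector_space pscale"
  by unfold_locales (auto simp: lookup_pscale lookup_add algebra_simps intro!: poly_mapping_eqI)

definition coset :: "('x \<Rightarrow>\<^sub>0 complex) set \<Rightarrow> ('x \<Rightarrow>\<^sub>0 complex) \<Rightarrow> ('x \<Rightarrow>\<^sub>0 complex) set" where
  "coset K p = {p + k | k. k \<in> K}"

text \<open>
  The quotient \<open>E / K\<close> of subspaces \<open>K \<subseteq> E\<close>. Every union below is over representatives of a coset
  and is a union of equal sets.
\<close>

definition quot_space ::
    "('x \<Rightarrow>\<^sub>0 complex) set \<Rightarrow> ('x \<Rightarrow>\<^sub>0 complex) set \<Rightarrow> (complex, ('x \<Rightarrow>\<^sub>0 complex) set) module" where
  "quot_space E K =
     \<lparr>carrier = coset K ` E, monoid.mult = undefined, one = undefined, ring.zero = K,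
      add = (\<lambda>A B. \<Union>p\<in>A. \<Union>q\<in>B. coset K (p + q)),
      module.smult = (\<lambda>s A. \<Union>p\<in>A. coset K (pscale s p))\<rparr>"

section \<open>Tensor products\<close>

definition tensor_relations ::
    "(complex, 'a, 'm) module_scheme \<Rightarrow> (complex, 'b, 'n) module_scheme \<Rightarrow> ('a \<times> 'b \<Rightarrow>\<^sub>0 complex) set" where
  "tensor_relations U W =
     {Poly_Mapping.single (a \<oplus>\<^bsub>U\<^esub> a', b) 1 - Poly_Mapping.single (a, b) 1
        - Poly_Mapping.single (a', b) 1 | a a' b. a \<in> carrier U \<and> a' \<in> carrier U \<and> b \<in> carrier W} \<union>
     {Poly_Mapping.single (a, b \<oplus>\<^bsub>W\<^esub> b') 1 - Poly_Mapping.single (a, b) 1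
        - Poly_Mapping.single (a, b') 1 | a b b'. a \<in> carrier U \<and> b \<in> carrier W \<and> b' \<in> carrier W} \<union>
     {Poly_Mapping.single (s \<odot>\<^bsub>U\<^esub> a, b) 1 - Poly_Mapping.single (a, b) s
        | s a b. a \<in> carrier U \<and> b \<in> carrier W} \<union>
     {Poly_Mapping.single (a, s \<odot>\<^bsub>W\<^esub> b) 1 - Poly_Mapping.single (a, b) s
        | s a b. a \<in> carrier U \<and> b \<in> carrier W}"

definition tensor_kernel ::
    "(complex, 'a, 'm) module_scheme \<Rightarrow> (complex, 'b, 'n) module_scheme \<Rightarrow> ('a \<times> 'b \<Rightarrow>\<^sub>0 complex) set" where
  "tensor_kernel U W = Modules.module.span pscale (tensor_relations U W)"

definition tensor_space ::
    "(complex, 'a, 'm) module_scheme \<Rightarrow> (complex, 'b, 'n) module_scheme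
      \<Rightarrow> (complex, ('a \<times> 'b \<Rightarrow>\<^sub>0 complex) set) module" where
  "tensor_space U W =
     quot_space {p. Poly_Mapping.keys p \<subseteq> carrier U \<times> carrier W} (tensor_kernel U W)"

text \<open>
  $Y(a \otimes b, z) = Y(a,z) \otimes Y(b,z)$, that is,
  $(a \otimes b)_n (u \otimes v) = \sum_{i + j = n - 1} a_i u \otimes b_j v$;
  by truncation only finitely many terms have both factors nonzero.
\<close>

definition tensor_mode_pure ::
    "('a, 'm) voa_scheme \<Rightarrow> ('b, 'n) voa_scheme
      \<Rightarrow> 'a \<times> 'b \<Rightarrow> int \<Rightarrow> 'a \<times> 'b \<Rightarrow> ('a \<times> 'b \<Rightarrow>\<^sub>0 complex)" where
  "tensor_mode_pure U W x n y =
     (\<Sum>i\<in>{i. mode U (fst x) i (fst y) \<noteq> \<zero>\<^bsub>U\<^esub> \<and> mode W (snd x) (n - 1 - i) (snd y) \<noteq> \<zero>\<^bsub>W\<^esub>}.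
        Poly_Mapping.single (mode U (fst x) i (fst y), mode W (snd x) (n - 1 - i) (snd y)) 1)"

definition tensor_mode ::
    "('a, 'm) voa_scheme \<Rightarrow> ('b, 'n) voa_scheme
      \<Rightarrow> ('a \<times> 'b \<Rightarrow>\<^sub>0 complex) set \<Rightarrow> int \<Rightarrow> ('a \<times> 'b \<Rightarrow>\<^sub>0 complex) set \<Rightarrow> ('a \<times> 'b \<Rightarrow>\<^sub>0 complex) set" where
  "tensor_mode U W A n B =
     (\<Union>p\<in>A. \<Union>q\<in>B. coset (tensor_kernel U W)
        (\<Sum>x\<in>Poly_Mapping.keys p. \<Sum>y\<in>Poly_Mapping.keys q.
           pscale (Poly_Mapping.lookup p x * Poly_Mapping.lookup q y) (tensor_mode_pure U W x n y)))"

definition tensor_voa ::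
    "('a, 'm) voa_scheme \<Rightarrow> ('b, 'n) voa_scheme \<Rightarrow> ('a \<times> 'b \<Rightarrow>\<^sub>0 complex) set voa" where
  "tensor_voa U W = module.extend (tensor_space U W)
     (voa.fields (tensor_mode U W)
        (coset (tensor_kernel U W) (Poly_Mapping.single (vacuum U, vacuum W) 1))
        (coset (tensor_kernel U W) (Poly_Mapping.single (conformal U, vacuum W) 1
                                    + Poly_Mapping.single (vacuum U, conformal W) 1)))"

section \<open>Irreducible quotients of modules \<open>U(\<gg>) / I\<close>\<close>

text \<open>
  The free monoid on \<open>'g\<close>; accordingly \<open>'g fmon \<Rightarrow>\<^sub>0 complex\<close> is the free associative unital
  algebra on \<open>'g\<close> (the tensor algebra of the vector space with basis \<open>'g\<close>), with the convolution
  product of \<open>poly_mapping\<close>.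
\<close>

datatype 'g fmon = FMon "'g list"

instantiation fmon :: (type) monoid_add
begin

definition zero_fmon :: "'a fmon" where "0 = FMon []"

fun plus_fmon :: "'a fmon \<Rightarrow> 'a fmon \<Rightarrow> 'a fmon" where
  "FMon xs + FMon ys = FMon (xs @ ys)"

instance
proof
  fix x y z :: "'a fmon"
  show "x + y + z = x + (y + z)" by (cases x; cases y; cases z) simp
  show "0 + x = x" by (cases x) (simp add: zero_fmon_def)
  show "x + 0 = x" by (cases x) (simp add: zero_fmon_def)
qed

end

type_synonym 'g free_alg = "'g fmon \<Rightarrow>\<^sub>0 complex"

definition gen :: "'g \<Rightarrow> 'g free_alg" where
  "gen g = Poly_Mapping.single (FMon [g]) 1"

definition const_alg :: "complex \<Rightarrow> 'g free_alg" where
  "const_alg s = Poly_Mapping.single 0 s"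

definition embed_lie :: "('g \<Rightarrow>\<^sub>0 complex) \<Rightarrow> 'g free_alg" where
  "embed_lie x = (\<Sum>g\<in>Poly_Mapping.keys x. const_alg (Poly_Mapping.lookup x g) * gen g)"

definition left_ideal :: "'r::ring_1 set \<Rightarrow> bool" where
  "left_ideal J \<longleftrightarrow> 0 \<in> J \<and> (\<forall>x\<in>J. \<forall>y\<in>J. x + y \<in> J) \<and> (\<forall>r. \<forall>x\<in>J. r * x \<in> J)"

definition two_sided_ideal :: "'r::ring_1 set \<Rightarrow> bool" where
  "two_sided_ideal J \<longleftrightarrow> left_ideal J \<and> (\<forall>r. \<forall>x\<in>J. x * r \<in> J)"

text \<open>
  A Lie algebra with basis \<open>'g\<close> is given by the brackets \<open>br\<close> of basis elements. Its enveloping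
  algebra \<open>U(\<gg>)\<close> is the free algebra modulo \<open>env_ideal br\<close>.
\<close>

definition env_ideal :: "('g \<Rightarrow> 'g \<Rightarrow> ('g \<Rightarrow>\<^sub>0 complex)) \<Rightarrow> 'g free_alg set" where
  "env_ideal br = \<Inter>{J. two_sided_ideal J \<and>
     (\<forall>x y. gen x * gen y - gen y * gen x - embed_lie (br x y) \<in> J)}"

text \<open>
  Left ideals of \<open>U(\<gg>)\<close> are represented by their preimages in the free algebra, i.e. by the left
  ideals containing \<open>env_ideal br\<close>. Thus the free algebra modulo \<open>module_ideal br S\<close> is \<open>U(\<gg>) / I\<close>
  for the left ideal \<open>I\<close> generated by (the image of) \<open>S\<close>.
\<close>

definition module_ideal ::
    "('g \<Rightarrow> 'g \<Rightarrow> ('g \<Rightarrow>\<^sub>0 complex)) \<Rightarrow> 'g free_alg set \<Rightarrow> 'g free_alg set" where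
  "module_ideal br S = \<Inter>{J. left_ideal J \<and> env_ideal br \<subseteq> J \<and> S \<subseteq> J}"

text \<open>
  The submodules of \<open>U(\<gg>) / I\<close> correspond to the left ideals containing \<open>module_ideal br S\<close>.
  The following is the preimage of the sum of all proper submodules, which, for the highest weight
  modules considered below, is the unique maximal proper submodule.
\<close>

definition irr_ideal ::
    "('g \<Rightarrow> 'g \<Rightarrow> ('g \<Rightarrow>\<^sub>0 complex)) \<Rightarrow> 'g free_alg set \<Rightarrow> 'g free_alg set" where
  "irr_ideal br S = \<Inter>{J. left_ideal J \<and>
     \<Union>{N. left_ideal N \<and> module_ideal br S \<subseteq> N \<and> N \<noteq> UNIV} \<subseteq> J}"

definition irr_module ::
    "('g \<Rightarrow> 'g \<Rightarrow> ('g \<Rightarrow>\<^sub>0 complex)) \<Rightarrow> 'g free_alg set \<Rightarrow> (complex, 'g free_alg set) module" where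
  "irr_module br S = quot_space UNIV (irr_ideal br S)"

definition irr_class ::
    "('g \<Rightarrow> 'g \<Rightarrow> ('g \<Rightarrow>\<^sub>0 complex)) \<Rightarrow> 'g free_alg set \<Rightarrow> 'g free_alg \<Rightarrow> 'g free_alg set" where
  "irr_class br S p = coset (irr_ideal br S) p"

definition irr_action ::
    "('g \<Rightarrow> 'g \<Rightarrow> ('g \<Rightarrow>\<^sub>0 complex)) \<Rightarrow> 'g free_alg set \<Rightarrow> 'g \<Rightarrow> 'g free_alg set \<Rightarrow> 'g free_alg set" where
  "irr_action br S g A = (\<Union>p\<in>A. irr_class br S (gen g * p))"

section \<open>The Virasoro vertex operator algebra \<open>L(c,0)\<close>\<close>

datatype vir = VirL int | VirC

fun vir_bracket :: "vir \<Rightarrow> vir \<Rightarrow> (vir \<Rightarrow>\<^sub>0 complex)" where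
  "vir_bracket (VirL m) (VirL n) =
     Poly_Mapping.single (VirL (m + n)) (of_int (m - n))
     + Poly_Mapping.single VirC (if m + n = 0 then of_int (m ^ 3 - m) / 12 else 0)"
| "vir_bracket VirC _ = 0"
| "vir_bracket _ VirC = 0"

definition vir_hw :: "complex \<Rightarrow> vir free_alg set" where
  "vir_hw c = {gen (VirL m) | m. m \<ge> 0} \<union> {gen VirC - const_alg c}"

text \<open>
  \<open>U\<close> is the vertex operator algebra \<open>L(c,0)\<close>: the irreducible highest weight module with
  its standard vertex operator algebra structure, in which the modes of the Virasoro element
  are the given operators $L_n$. As $\omega$ generates, this determines the structure.
\<close>

definition is_Vir_voa :: "complex \<Rightarrow> vir free_alg set voa \<Rightarrow> bool" where
  "is_Vir_voa c U \<longleftrightarrow>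
     vertex_operator_algebra U c \<and>
     module.truncate U = irr_module vir_bracket (vir_hw c) \<and>
     vacuum U = irr_class vir_bracket (vir_hw c) 1 \<and>
     conformal U = irr_action vir_bracket (vir_hw c) (VirL (-2)) (vacuum U) \<and>
     (\<forall>n. \<forall>v\<in>carrier U. mode U (conformal U) (n + 1) v
        = irr_action vir_bracket (vir_hw c) (VirL n) v)"

section \<open>The vertex operator algebra \<open>L(c,0,0)\<close> of \<open>W(2,2)\<close>\<close>

datatype w22 = W22L int | W22W int | W22C

fun w22_bracket :: "w22 \<Rightarrow> w22 \<Rightarrow> (w22 \<Rightarrow>\<^sub>0 complex)" where
  "w22_bracket (W22L m) (W22L n) =
     Poly_Mapping.single (W22L (m + n)) (of_int (m - n))
     + Poly_Mapping.single W22C (if m + n = 0 then of_int (m ^ 3 - m) / 12 else 0)"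
| "w22_bracket (W22L m) (W22W n) =
     Poly_Mapping.single (W22W (m + n)) (of_int (m - n))
     + Poly_Mapping.single W22C (if m + n = 0 then of_int (m ^ 3 - m) / 12 else 0)"
| "w22_bracket (W22W m) (W22L n) =
     - (Poly_Mapping.single (W22W (n + m)) (of_int (n - m))
        + Poly_Mapping.single W22C (if n + m = 0 then of_int (n ^ 3 - n) / 12 else 0))"
| "w22_bracket (W22W m) (W22W n) = 0"
| "w22_bracket W22C _ = 0"
| "w22_bracket _ W22C = 0"

definition w22_hw :: "complex \<Rightarrow> w22 free_alg set" where
  "w22_hw c = {gen (W22L m) | m. m \<ge> 0} \<union> {gen (W22W m) | m. m \<ge> 0} \<union> {gen W22C - const_alg c}"

definition is_W22_voa :: "complex \<Rightarrow> w22 free_alg set voa \<Rightarrow> bool" where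
  "is_W22_voa c U \<longleftrightarrow>
     vertex_operator_algebra U c \<and>
     module.truncate U = irr_module w22_bracket (w22_hw c) \<and>
     vacuum U = irr_class w22_bracket (w22_hw c) 1 \<and>
     conformal U = irr_action w22_bracket (w22_hw c) (W22L (-2)) (vacuum U) \<and>
     (\<forall>n. \<forall>v\<in>carrier U. mode U (conformal U) (n + 1) v
        = irr_action w22_bracket (w22_hw c) (W22L n) v) \<and>
     (let x = irr_action w22_bracket (w22_hw c) (W22W (-2)) (vacuum U) in
        (\<forall>n. \<forall>v\<in>carrier U. mode U x (n + 1) v
           = irr_action w22_bracket (w22_hw c) (W22W n) v) \<and>
        generated_by U {conformal U, x})"

end

theory Submission
  imports Defs
begin

text \<open>
  Since \<open>V\<^sub>1 = 0\<close> and \<open>V\<^sub>2\<close> is spanned by \<open>\<omega>\<close> and one more element, skew symmetry forces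
  \<open>u\<^sub>0 v = L(-1)(u\<^sub>1 v) / 2\<close> on \<open>V\<^sub>2\<close>, so that the modes of \<open>V\<^sub>2\<close> span a Lie algebra determined by the
  product and the bilinear form \<open>u\<^sub>3 v\<close>. Completing the square, \<open>V\<^sub>2\<close> contains either an element with
  square 0, which yields \<open>W(2,2)\<close>, or two orthogonal idempotents, which yield two commuting Virasoro
  algebras. The form is nondegenerate: an element in its radical spanning an ideal of \<open>V\<^sub>2\<close> would
  generate an ideal of \<open>V\<close> without component along the vacuum.

  The evaluation \<open>p \<mapsto> p\<one>\<close> identifies the free algebra modulo the maximal left ideal with the
  orbit of the vacuum, and the vertex operator algebra structure of \<open>L(c,0)\<close> or \<open>L(c,0,0)\<close> is
  transported from there. In the semisimple case the two orbits are irreducible, and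
  \<open>a \<otimes> b \<mapsto> a\<^sub>-\<^sub>1 b\<close> is injective because one can first move any nonzero \<open>a\<close> to the vacuum
  and then project to the vacuum with a polynomial in \<open>L(0)\<close> of the first factor.

  For the computations \<open>V\<close> is embedded linearly in \<open>'a \<Rightarrow>\<^sub>0 complex\<close>, where addition and sums are those
  of the type.
\<close>


section \<open>Free associative algebras and graded left ideals\<close>

text \<open>\<open>is_Vir_voa\<close> and \<open>is_W22_voa\<close> ask for a vertex operator
  algebra whose module is literally the quotient by \<open>irr_ideal\<close>. Its structure is taken
  from inside V, so everything rests on \<open>irr_ideal\<close> being the annihilator of the
  vacuum. For this it suffices that every nonzero vector of the orbit can be moved back to the
  vacuum. In the W(2,2) case that is simplicity of V. In the semisimple case simplicity gives it
  only for both Virasoro algebras jointly, and one of them has to be removed by projecting to its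
  vacuum. Two-dimensionality matters beyond the classification of the product: skew symmetry leaves
  an alternating part of u_0 v open, and this vanishes because one of two basis vectors can be taken
  to be omega. The constants come from omega/2 being the identity: the conformal vectors of the
  factors are twice the idempotents, and u_3 u = c/2 times the vacuum encodes central charge c. The
  nilpotent generator y is scaled to omega_3 y = c/2 times the vacuum because [L_m, L_n] and
  [L_m, W_n] share one central element.\<close>

lemma const_alg_simps:
  "const_alg 0 = 0" "const_alg 1 = (1 :: 'g free_alg)"
  "const_alg (s + t) = (const_alg s + const_alg t :: 'g free_alg)"
  "const_alg (- s) = (- const_alg s :: 'g free_alg)"
  "const_alg (s - t) = (const_alg s - const_alg t :: 'g free_alg)"
  "const_alg (s * t) = (const_alg s * const_alg t :: 'g free_alg)"
  by (simp_all add: const_alg_def single_add single_uminus single_diff mult_single)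

lemma const_alg_mult_single:
  "const_alg s * Poly_Mapping.single w t = (Poly_Mapping.single w (s * t) :: 'g free_alg)"
  "Poly_Mapping.single w t * const_alg s = (Poly_Mapping.single w (s * t) :: 'g free_alg)"
  by (simp_all add: const_alg_def mult_single mult.commute)

lemma poly_mapping_sum_singles:
  fixes p :: "'k \<Rightarrow>\<^sub>0 'c::comm_monoid_add"
  assumes "finite S" "Poly_Mapping.keys p \<subseteq> S"
  shows "p = (\<Sum>k\<in>S. Poly_Mapping.single k (Poly_Mapping.lookup p k))"
proof (rule poly_mapping_eqI)
  fix k
  have "(\<Sum>x\<in>S. Poly_Mapping.lookup (Poly_Mapping.single x (Poly_Mapping.lookup p x)) k)
      = (\<Sum>x\<in>S. if x = k then Poly_Mapping.lookup p k else 0)"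
    by (rule sum.cong) (auto simp: lookup_single when_def)
  also have "\<dots> = Poly_Mapping.lookup p k"
    using assms by (auto simp: sum.delta in_keys_iff)
  finally show "Poly_Mapping.lookup p k
      = Poly_Mapping.lookup (\<Sum>k\<in>S. Poly_Mapping.single k (Poly_Mapping.lookup p k)) k"
    by (simp add: lookup_sum)
qed

text \<open>Only keys of \<open>p\<close> occur in the singles, so that a condition on the support
  of \<open>p\<close>, such as lying in a carrier, remains available in the base case.\<close>

lemma poly_mapping_additive_induct:
  fixes p :: "'k \<Rightarrow>\<^sub>0 'c::comm_monoid_add"
  assumes "P 0" "\<And>k t. k \<in> Poly_Mapping.keys p \<Longrightarrow> P (Poly_Mapping.single k t)"
    "\<And>p q. P p \<Longrightarrow> P q \<Longrightarrow> P (p + q)"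
  shows "P p"
proof -
  have "P (\<Sum>k\<in>S. Poly_Mapping.single k (Poly_Mapping.lookup p k))"
    if "finite S" "S \<subseteq> Poly_Mapping.keys p" for S
    using that by (induction) (auto intro: assms)
  from this[of "Poly_Mapping.keys p"] show ?thesis
    by (simp flip: poly_mapping_sum_singles[of "Poly_Mapping.keys p" p])
qed

lemma const_alg_commute: "const_alg s * p = p * const_alg s"
  by (rule poly_mapping_additive_induct[where p = p])
    (simp_all add: const_alg_mult_single algebra_simps)

lemma const_alg_left_commute: "r * (const_alg s * p) = const_alg s * (r * p)"
proof -
  have "r * (const_alg s * p) = (r * const_alg s) * p" by (simp only: mult.assoc)
  then show ?thesis by (simp only: const_alg_commute[of s r, symmetric] mult.assoc)
qed

lemma const_alg_mult: "const_alg s * p = pscale s p"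
proof (rule poly_mapping_additive_induct[where p = p])
  fix w t
  show "const_alg s * Poly_Mapping.single w t = pscale s (Poly_Mapping.single w t)"
    by (rule poly_mapping_eqI)
      (simp add: const_alg_mult_single lookup_pscale lookup_single when_def)
qed (auto intro: poly_mapping_eqI simp: algebra_simps lookup_pscale lookup_add)

definition wrd :: "'g list \<Rightarrow> 'g free_alg" where
  "wrd xs = Poly_Mapping.single (FMon xs) 1"

lemma wrd_Nil: "wrd [] = 1"
  by (simp add: wrd_def flip: zero_fmon_def)

lemma wrd_append: "wrd (xs @ ys) = wrd xs * wrd ys"
  by (simp add: wrd_def mult_single)

lemma gen_eq_wrd: "gen g = wrd [g]"
  by (simp add: gen_def wrd_def)

lemma wrd_Cons: "wrd (g # xs) = gen g * wrd xs"
  by (simp add: gen_eq_wrd flip: wrd_append)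

lemma single_eq_wrd: "Poly_Mapping.single (FMon xs) t = const_alg t * wrd xs"
  by (simp add: wrd_def const_alg_mult_single)

lemma free_alg_induct:
  fixes p :: "'g free_alg"
  assumes "\<And>xs. P (wrd xs)" "\<And>s p. P p \<Longrightarrow> P (const_alg s * p)" "\<And>p q. P p \<Longrightarrow> P q \<Longrightarrow> P (p + q)"
  shows "P p"
proof (rule poly_mapping_additive_induct[where p = p])
  show "P 0"
    using assms(2)[OF assms(1), of 0] by (simp add: const_alg_simps)
  show "P (Poly_Mapping.single k t)" for k t
    by (cases k) (simp add: single_eq_wrd assms)
qed (rule assms)

lemma embed_lie_sum:
  assumes "finite S" "Poly_Mapping.keys x \<subseteq> S"
  shows "embed_lie x = (\<Sum>g\<in>S. const_alg (Poly_Mapping.lookup x g) * gen g)"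
  unfolding embed_lie_def using assms
  by (intro sum.mono_neutral_left) (auto simp: in_keys_iff const_alg_simps)

lemma embed_lie_add: "embed_lie (x + y) = embed_lie x + embed_lie y"
proof -
  let ?S = "Poly_Mapping.keys x \<union> Poly_Mapping.keys y"
  have "embed_lie (x + y) = (\<Sum>g\<in>?S. const_alg (Poly_Mapping.lookup (x + y) g) * gen g)"
    by (rule embed_lie_sum) (auto dest: subsetD[OF keys_add])
  also have "\<dots> = embed_lie x + embed_lie y"
    using embed_lie_sum[of ?S x] embed_lie_sum[of ?S y]
    by (simp add: lookup_add const_alg_simps algebra_simps sum.distrib)
  finally show ?thesis .
qed

lemma embed_lie_single: "embed_lie (Poly_Mapping.single g s) = const_alg s * gen g"
  by (simp add: embed_lie_def const_alg_simps)

lemma embed_lie_zero: "embed_lie 0 = 0"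
  by (simp add: embed_lie_def)

lemma embed_lie_minus: "embed_lie (- x) = - embed_lie x"
  using embed_lie_add[of x "- x"] by (simp add: embed_lie_zero eq_neg_iff_add_eq_0 add.commute)

section \<open>Left ideals of an enveloping algebra, lifted to the free algebra\<close>

lemma left_ideal_zero: "left_ideal J \<Longrightarrow> 0 \<in> J"
  and left_ideal_add: "left_ideal J \<Longrightarrow> x \<in> J \<Longrightarrow> y \<in> J \<Longrightarrow> x + y \<in> J"
  and left_ideal_mult: "left_ideal J \<Longrightarrow> x \<in> J \<Longrightarrow> r * x \<in> J"
  by (auto simp: left_ideal_def)

lemma left_ideal_minus: "left_ideal J \<Longrightarrow> x \<in> J \<Longrightarrow> - x \<in> J"
  using left_ideal_mult[of J x "- 1"] by simp

lemma left_ideal_diff: "left_ideal J \<Longrightarrow> x \<in> J \<Longrightarrow> y \<in> J \<Longrightarrow> x - y \<in> J"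
  using left_ideal_add[OF _ _ left_ideal_minus, of J x y] by simp

lemma two_sided_ideal_env_ideal: "two_sided_ideal (env_ideal br)"
  unfolding env_ideal_def two_sided_ideal_def left_ideal_def by blast

lemma env_ideal_zero: "0 \<in> env_ideal br"
  and env_ideal_add: "x \<in> env_ideal br \<Longrightarrow> y \<in> env_ideal br \<Longrightarrow> x + y \<in> env_ideal br"
  and env_ideal_mult_left: "x \<in> env_ideal br \<Longrightarrow> r * x \<in> env_ideal br"
  and env_ideal_mult_right: "x \<in> env_ideal br \<Longrightarrow> x * r \<in> env_ideal br"
  using two_sided_ideal_env_ideal[of br] unfolding two_sided_ideal_def left_ideal_def by blast+

lemma bracket_in_env_ideal: "gen x * gen y - gen y * gen x - embed_lie (br x y) \<in> env_ideal br"
  unfolding env_ideal_def by blast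

lemma left_ideal_module_ideal: "left_ideal (module_ideal br S)"
  unfolding module_ideal_def left_ideal_def by blast

lemma env_ideal_subset_module_ideal: "env_ideal br \<subseteq> module_ideal br S"
  unfolding module_ideal_def by blast

lemma generators_subset_module_ideal: "S \<subseteq> module_ideal br S"
  unfolding module_ideal_def by blast

lemma module_ideal_least:
  "left_ideal J \<Longrightarrow> env_ideal br \<subseteq> J \<Longrightarrow> S \<subseteq> J \<Longrightarrow> module_ideal br S \<subseteq> J"
  unfolding module_ideal_def by blast

text \<open>What the Virasoro algebra and W(2,2) have in common. For both, \<open>deg\<close> is
  minus the mode number, so that generators of positive degree raise the weight, and
  \<open>d0\<close> is L_0. The set \<open>S\<close> makes the generator of the cyclic module a
  highest weight vector: negative degree kills it, degree 0 acts by scalars.\<close>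

locale graded_lie =
  fixes br :: "'g \<Rightarrow> 'g \<Rightarrow> ('g \<Rightarrow>\<^sub>0 complex)" and S :: "'g free_alg set" and deg :: "'g \<Rightarrow> int" and d0 :: 'g
  assumes deg_br: "h \<in> Poly_Mapping.keys (br x y) \<Longrightarrow> deg h = deg x + deg y"
    and lowering: "deg g < 0 \<Longrightarrow> gen g \<in> S"
    and neutral: "deg g = 0 \<Longrightarrow> \<exists>s. gen g - const_alg s \<in> S"
    and d0_in: "gen d0 \<in> S"
    and br_d0: "br d0 g = Poly_Mapping.single g (of_int (deg g))"
begin

abbreviation "I \<equiv> module_ideal br S"

definition mdeg :: "'g list \<Rightarrow> int" where "mdeg xs = sum_list (map deg xs)"

lemma mdeg_simps [simp]: "mdeg [] = 0" "mdeg (x # xs) = deg x + mdeg xs"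
  "mdeg (xs @ ys) = mdeg xs + mdeg ys"
  by (simp_all add: mdeg_def)

text \<open>The module U(g)/I in degrees up to 0: zero below degree 0 and spanned by the generator
  in degree 0. Nothing is claimed in positive degree.\<close>

definition collapses :: "int \<Rightarrow> 'g free_alg \<Rightarrow> bool" where
  "collapses d p \<longleftrightarrow> (d < 0 \<longrightarrow> p \<in> I) \<and> (d = 0 \<longrightarrow> (\<exists>s. p - const_alg s \<in> I))"

lemma I_ideal: "left_ideal I" by (rule left_ideal_module_ideal)

lemma collapses_I: "p \<in> I \<Longrightarrow> collapses d p"
  by (auto simp: collapses_def const_alg_simps intro!: exI[of _ 0])

lemma collapses_add: "collapses d p \<Longrightarrow> collapses d q \<Longrightarrow> collapses d (p + q)"
proof -
  assume *: "collapses d p" "collapses d q"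
  have "\<exists>s. p + q - const_alg s \<in> I" if "d = 0"
  proof -
    from * that obtain s t where "p - const_alg s \<in> I" "q - const_alg t \<in> I"
      by (auto simp: collapses_def)
    from left_ideal_add[OF I_ideal this] have "p + q - const_alg (s + t) \<in> I"
      by (simp add: const_alg_simps algebra_simps)
    then show ?thesis by blast
  qed
  with * show ?thesis by (auto simp: collapses_def intro: left_ideal_add[OF I_ideal])
qed

lemma collapses_const_mult: "collapses d p \<Longrightarrow> collapses d (const_alg t * p)"
proof -
  assume *: "collapses d p"
  have "\<exists>s. const_alg t * p - const_alg s \<in> I" if "d = 0"
  proof -
    from * that obtain s where "p - const_alg s \<in> I" by (auto simp: collapses_def)
    from left_ideal_mult[OF I_ideal this, of "const_alg t"]
    have "const_alg t * p - const_alg (t * s) \<in> I" by (simp add: const_alg_simps(6) right_diff_distrib)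
    then show ?thesis by blast
  qed
  with * show ?thesis by (auto simp: collapses_def intro: left_ideal_mult[OF I_ideal])
qed

lemma collapses_sum: "(\<And>i. i \<in> A \<Longrightarrow> collapses d (f i)) \<Longrightarrow> collapses d (sum f A)"
  by (induction A rule: infinite_finite_induct) (auto intro: collapses_add collapses_I left_ideal_zero[OF I_ideal])

lemma bracket_in_I: "r * (gen x * gen y - gen y * gen x - embed_lie (br x y)) * q \<in> I"
  by (intro subsetD[OF env_ideal_subset_module_ideal] env_ideal_mult_right env_ideal_mult_left bracket_in_env_ideal)

text \<open>A letter of degree at most 0 is commuted to the right end, where it is a scalar modulo
  \<open>I\<close> or lies in \<open>I\<close>. Each commutator replaces two letters by one of the
  same total degree, so it produces shorter words, which the hypothesis covers.\<close>

lemma move_right: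
  assumes "\<And>w. length w < length (xs @ ys) + 1 \<Longrightarrow> collapses (mdeg w) (wrd w)" "deg g \<le> 0"
  shows "collapses (mdeg xs + deg g + mdeg ys) (wrd xs * gen g * wrd ys)"
  using assms(1)
proof (induction ys arbitrary: xs)
  case Nil
  show ?case
  proof (cases "deg g = 0")
    case True
    then obtain s where "gen g - const_alg s \<in> I"
      using neutral generators_subset_module_ideal by blast
    then have "wrd xs * (gen g - const_alg s) \<in> I"
      by (rule left_ideal_mult[OF I_ideal])
    moreover have "wrd xs * gen g = const_alg s * wrd xs + wrd xs * (gen g - const_alg s)"
      by (simp add: right_diff_distrib const_alg_commute)
    moreover have "collapses (mdeg xs) (wrd xs)" by (rule Nil) simp
    ultimately show ?thesis
      using True by (simp add: wrd_Nil collapses_add collapses_I collapses_const_mult)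
  next
    case False
    then have "gen g \<in> I" using lowering assms(2) generators_subset_module_ideal[of S br] by force
    then show ?thesis
      by (auto simp: wrd_Nil intro!: collapses_I left_ideal_mult[OF I_ideal])
  qed
next
  case (Cons h ys)
  let ?c = "gen g * gen h - gen h * gen g - embed_lie (br g h)"
  have eq: "wrd xs * gen g * wrd (h # ys) = wrd (xs @ [h]) * gen g * wrd ys
      + wrd xs * embed_lie (br g h) * wrd ys + wrd xs * ?c * wrd ys"
    by (simp add: wrd_append wrd_Cons wrd_Nil algebra_simps)
  have 1: "collapses (mdeg xs + deg g + mdeg (h # ys)) (wrd (xs @ [h]) * gen g * wrd ys)"
    using Cons.IH[of "xs @ [h]"] Cons.prems by (simp add: algebra_simps)
  have 2: "wrd xs * ?c * wrd ys \<in> I" by (rule bracket_in_I)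
  have 3: "collapses (mdeg xs + deg g + mdeg (h # ys)) (wrd xs * embed_lie (br g h) * wrd ys)"
  proof -
    have "wrd xs * embed_lie (br g h) * wrd ys = (\<Sum>k\<in>Poly_Mapping.keys (br g h).
        const_alg (Poly_Mapping.lookup (br g h) k) * wrd (xs @ k # ys))"
    proof -
      have "wrd xs * (const_alg s * gen k) * wrd ys = const_alg s * wrd (xs @ k # ys)" for s k
        by (simp add: wrd_append wrd_Cons mult.assoc const_alg_left_commute)
      then show ?thesis by (simp add: embed_lie_def sum_distrib_left sum_distrib_right)
    qed
    moreover have "collapses (mdeg xs + deg g + mdeg (h # ys)) (wrd (xs @ k # ys))"
      if "k \<in> Poly_Mapping.keys (br g h)" for k
    proof -
      have "collapses (mdeg (xs @ k # ys)) (wrd (xs @ k # ys))"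
        by (rule Cons.prems) simp
      then show ?thesis using deg_br[OF that] by (simp add: algebra_simps)
    qed
    ultimately show ?thesis
      by (auto intro!: collapses_sum collapses_const_mult)
  qed
  show ?case
    unfolding eq by (intro collapses_add 1 3 collapses_I[OF 2])
qed

text \<open>Induction on the length. If the first letter has positive degree and the word does not,
  then the tail has negative degree and lies in \<open>I\<close>, hence so does the word. Otherwise
  the first letter can be moved to the right.\<close>

lemma collapses_wrd: "collapses (mdeg w) (wrd w)"
proof (induction w rule: length_induct)
  case (1 w)
  show ?case
  proof (cases w)
    case Nil
    then show ?thesis
      by (auto simp: collapses_def wrd_Nil const_alg_simps left_ideal_zero[OF I_ideal] intro!: exI[of _ 1])
  next
    case (Cons g w')
    show ?thesis
    proof (cases "deg g \<le> 0")
      case True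
      have "collapses (mdeg [] + deg g + mdeg w') (wrd [] * gen g * wrd w')"
        using 1 Cons True by (intro move_right) auto
      then show ?thesis by (simp add: Cons wrd_Nil wrd_Cons)
    next
      case False
      have "collapses (mdeg w') (wrd w')" using 1 Cons by auto
      then have "mdeg w \<le> 0 \<Longrightarrow> wrd w' \<in> I" using False Cons by (auto simp: collapses_def)
      then have "mdeg w \<le> 0 \<Longrightarrow> wrd w \<in> I"
        by (auto simp: Cons wrd_Cons intro: left_ideal_mult[OF I_ideal])
      then show ?thesis using collapses_I[of "wrd w" "mdeg w"] by (force simp: collapses_def)
    qed
  qed
qed

text \<open>Modulo \<open>env_ideal br\<close> the commutator with \<open>d0\<close> is a derivation
  that multiplies a word by its degree. The leftover term ends in \<open>d0\<close>, an element of
  \<open>S\<close>.\<close>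

lemma d0_wrd: "gen d0 * wrd w - const_alg (of_int (mdeg w)) * wrd w \<in> I"
proof -
  have "gen d0 * wrd w - wrd w * gen d0 - const_alg (of_int (mdeg w)) * wrd w \<in> env_ideal br"
  proof (induction w)
    case Nil
    show ?case by (simp add: wrd_Nil const_alg_simps(1) env_ideal_zero)
  next
    case (Cons g w)
    have "(gen d0 * gen g - gen g * gen d0 - embed_lie (br d0 g)) * wrd w
       + gen g * (gen d0 * wrd w - wrd w * gen d0 - const_alg (of_int (mdeg w)) * wrd w) \<in> env_ideal br"
      by (intro env_ideal_add env_ideal_mult_right[OF bracket_in_env_ideal] env_ideal_mult_left[OF Cons])
    then show ?case
      using const_alg_left_commute[of "gen g" "of_int (mdeg w)" "wrd w"]
      by (simp add: br_d0 embed_lie_single wrd_Cons algebra_simps const_alg_simps(3))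
  qed
  then have "gen d0 * wrd w - wrd w * gen d0 - const_alg (of_int (mdeg w)) * wrd w \<in> I"
    using env_ideal_subset_module_ideal by blast
  moreover have "wrd w * gen d0 \<in> I"
    using d0_in generators_subset_module_ideal by (blast intro: left_ideal_mult[OF I_ideal])
  ultimately show ?thesis
    using left_ideal_add[OF I_ideal] by force
qed

text \<open>Modulo the left ideal, \<open>vac_proj M\<close> is the projection to degree 0 along the degrees \<open>1, \<dots>, M\<close>.\<close>

fun vac_proj :: "nat \<Rightarrow> 'g free_alg" where
  "vac_proj 0 = 1"
| "vac_proj (Suc n) = (1 - const_alg (1 / of_nat (Suc n)) * gen d0) * vac_proj n"

lemma vac_proj_one: "vac_proj n - 1 \<in> I"
proof (induction n)
  case 0
  show ?case by (simp add: left_ideal_zero[OF I_ideal])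
next
  case (Suc n)
  let ?f = "1 - const_alg (1 / of_nat (Suc n)) * gen d0"
  have "?f * (vac_proj n - 1) \<in> I" by (rule left_ideal_mult[OF I_ideal Suc])
  moreover have "const_alg (1 / of_nat (Suc n)) * gen d0 \<in> I"
    using d0_in generators_subset_module_ideal by (blast intro: left_ideal_mult[OF I_ideal])
  ultimately have "?f * (vac_proj n - 1) - const_alg (1 / of_nat (Suc n)) * gen d0 \<in> I"
    by (rule left_ideal_diff[OF I_ideal])
  then show ?case by (simp add: algebra_simps)
qed

text \<open>The factor with denominator k acts on a word of degree d as the scalar 1 - d/k, and the
  factor k = d is present because d lies between 1 and \<open>n\<close>.\<close>

lemma vac_proj_wrd_pos:
  assumes "0 < mdeg w" "mdeg w \<le> int n"
  shows "vac_proj n * wrd w \<in> I"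
proof -
  have step: "(1 - const_alg (1 / of_nat (Suc k)) * gen d0) * wrd w
      - const_alg (1 - of_int (mdeg w) / of_nat (Suc k)) * wrd w \<in> I" for k
  proof -
    let ?r = "1 / of_nat (Suc k) :: complex"
    have "- const_alg ?r * (gen d0 * wrd w - const_alg (of_int (mdeg w)) * wrd w)
       = - (const_alg ?r * gen d0 * wrd w) + const_alg (?r * of_int (mdeg w)) * wrd w"
      unfolding const_alg_simps(6) by (simp add: algebra_simps)
    also have "\<dots> = (1 - const_alg ?r * gen d0) * wrd w - const_alg (1 - of_int (mdeg w) / of_nat (Suc k)) * wrd w"
      by (simp add: const_alg_simps(2,5) algebra_simps)
    finally show ?thesis
      using left_ideal_mult[OF I_ideal d0_wrd[of w], of "- const_alg ?r"] by simp
  qed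
  have ev: "\<exists>s. vac_proj k * wrd w - const_alg s * wrd w \<in> I \<and> (mdeg w \<le> int k \<longrightarrow> s = 0)" for k
  proof (induction k)
    case 0
    have "vac_proj 0 * wrd w - const_alg 1 * wrd w \<in> I"
      by (simp add: const_alg_simps left_ideal_zero[OF I_ideal])
    with assms(1) show ?case by (intro exI[of _ 1]) auto
  next
    case (Suc k)
    then obtain s where s: "vac_proj k * wrd w - const_alg s * wrd w \<in> I" "mdeg w \<le> int k \<Longrightarrow> s = 0" by blast
    let ?f = "1 - const_alg (1 / of_nat (Suc k)) * gen d0"
    define t :: complex where "t = 1 - of_int (mdeg w) / of_nat (Suc k)"
    have comm: "?f * (const_alg s * wrd w) = const_alg s * (?f * wrd w)"
      by (rule const_alg_left_commute)
    have "?f * (vac_proj k * wrd w - const_alg s * wrd w) + const_alg s * (?f * wrd w - const_alg t * wrd w) \<in> I"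
      unfolding t_def by (intro left_ideal_add[OF I_ideal] left_ideal_mult[OF I_ideal] s step)
    also have "?f * (vac_proj k * wrd w - const_alg s * wrd w) + const_alg s * (?f * wrd w - const_alg t * wrd w)
       = ?f * vac_proj k * wrd w - const_alg s * const_alg t * wrd w"
      unfolding right_diff_distrib comm by (simp only: mult.assoc diff_add_eq diff_diff_eq2) simp
    finally have "vac_proj (Suc k) * wrd w - const_alg (s * t) * wrd w \<in> I"
      by (simp add: const_alg_simps)
    moreover have "s * t = 0" if "mdeg w \<le> int (Suc k)"
    proof (cases "mdeg w = int (Suc k)")
      case True
      then have "t = 1 - of_nat (Suc k) / of_nat (Suc k)"
        by (simp only: t_def of_int_of_nat_eq)
      also have "\<dots> = 0" by (simp del: of_nat_Suc)
      finally show ?thesis by simp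
    next
      case False
      then show ?thesis using s(2) that by auto
    qed
    ultimately show ?case by blast
  qed
  from ev[of n] assms(2) show ?thesis by (auto simp: const_alg_simps)
qed

lemma vac_proj_wrd:
  assumes "mdeg w \<le> int n"
  shows "\<exists>s. vac_proj n * wrd w - const_alg s \<in> I"
proof (cases "0 < mdeg w")
  case True
  then show ?thesis using vac_proj_wrd_pos[OF True assms] by (auto simp: const_alg_simps intro!: exI[of _ 0])
next
  case False
  then have "\<exists>s. wrd w - const_alg s \<in> I"
    using collapses_wrd[of w] by (cases "mdeg w = 0") (auto simp: collapses_def const_alg_simps(1) intro: exI[of _ 0])
  then obtain s where "wrd w - const_alg s \<in> I" by blast
  then have "vac_proj n * (wrd w - const_alg s) + const_alg s * (vac_proj n - 1) \<in> I"
    by (intro left_ideal_add[OF I_ideal] left_ideal_mult[OF I_ideal] vac_proj_one)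
  then have "vac_proj n * wrd w - const_alg s \<in> I"
    by (simp add: right_diff_distrib const_alg_commute)
  then show ?thesis by blast
qed

text \<open>The bound depends on the largest degree occurring in \<open>p\<close>. Having the
  property for all large \<open>n\<close>, rather than for one, lets finitely many elements share a
  projection.\<close>

lemma vac_proj_eventually: "\<exists>N. \<forall>n\<ge>N. \<exists>s. vac_proj n * p - const_alg s \<in> I"
proof (induction p rule: free_alg_induct)
  case (1 xs)
  have "\<forall>n\<ge>nat (mdeg xs). \<exists>s. vac_proj n * wrd xs - const_alg s \<in> I"
    by (auto intro!: vac_proj_wrd)
  then show ?case by blast
next
  case (2 t p)
  have "\<exists>s. vac_proj n * (const_alg t * p) - const_alg s \<in> I" if "vac_proj n * p - const_alg s \<in> I" for n s
  proof -
    have "const_alg t * (vac_proj n * p - const_alg s) \<in> I" by (rule left_ideal_mult[OF I_ideal that])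
    moreover have "vac_proj n * (const_alg t * p) = const_alg t * (vac_proj n * p)"
      by (rule const_alg_left_commute)
    ultimately have "vac_proj n * (const_alg t * p) - const_alg (t * s) \<in> I"
      by (simp add: right_diff_distrib const_alg_simps(6))
    then show ?thesis by blast
  qed
  with 2 show ?case by blast
next
  case (3 p q)
  then obtain N M where *: "\<forall>n\<ge>N. \<exists>s. vac_proj n * p - const_alg s \<in> I"
    "\<forall>n\<ge>M. \<exists>s. vac_proj n * q - const_alg s \<in> I" by blast
  have "\<exists>s. vac_proj n * (p + q) - const_alg s \<in> I" if "n \<ge> max N M" for n
  proof -
    from * that obtain s t where "vac_proj n * p - const_alg s \<in> I" "vac_proj n * q - const_alg t \<in> I"
      by (meson max.boundedE)
    from left_ideal_add[OF I_ideal this] have "vac_proj n * (p + q) - const_alg (s + t) \<in> I"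
      by (simp add: algebra_simps const_alg_simps)
    then show ?thesis by blast
  qed
  then show ?case by blast
qed

text \<open>\<open>K\<close> is itself one of the proper left ideals in the union, so only their
  inclusion in \<open>K\<close> needs work. If \<open>N\<close> contains some \<open>p\<close>
  outside \<open>K\<close>, some \<open>r * p\<close> is 1 modulo \<open>K\<close>. As
  \<open>N\<close> contains \<open>I\<close> but perhaps not \<open>K\<close>, the projection is
  needed: it makes \<open>r * p\<close> a scalar modulo \<open>I\<close>, and comparison modulo
  \<open>K\<close> shows that the scalar is 1.\<close>

lemma irr_ideal_eqI:
  assumes K: "left_ideal K" "I \<subseteq> K" "1 \<notin> K" and max: "\<And>p. p \<notin> K \<Longrightarrow> \<exists>r. r * p - 1 \<in> K"
  shows "irr_ideal br S = K"
proof -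
  have const_K: "s = 0" if "const_alg s \<in> K" for s
  proof (rule ccontr)
    assume "s \<noteq> 0"
    with left_ideal_mult[OF K(1) that, of "const_alg (1 / s)"] have "1 \<in> K"
      by (simp add: const_alg_simps(2) \<open>s \<noteq> 0\<close> flip: const_alg_simps(6))
    with K(3) show False ..
  qed
  have sub: "N \<subseteq> K" if N: "left_ideal N" "I \<subseteq> N" "N \<noteq> UNIV" for N
  proof
    fix p assume p: "p \<in> N"
    show "p \<in> K"
    proof (rule ccontr)
      assume "p \<notin> K"
      with max obtain r where r: "r * p - 1 \<in> K" by blast
      obtain n s where s: "vac_proj n * (r * p) - const_alg s \<in> I"
        using vac_proj_eventually by blast
      \<comment> \<open>The terms cancel to the constant \<open>s - 1\<close>.\<close>
      have "vac_proj n * (r * p - 1) + (vac_proj n - 1) - (vac_proj n * (r * p) - const_alg s) \<in> K"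
        by (intro left_ideal_diff[OF K(1)] left_ideal_add[OF K(1)] left_ideal_mult[OF K(1) r]
            subsetD[OF K(2) s] subsetD[OF K(2) vac_proj_one])
      then have "const_alg (s - 1) \<in> K" by (simp add: algebra_simps const_alg_simps)
      then have "s = 1" using const_K by fastforce
      then have "vac_proj n * (r * p) - (vac_proj n * (r * p) - const_alg 1) \<in> N"
        using s by (intro left_ideal_diff[OF N(1)] left_ideal_mult[OF N(1)] p subsetD[OF N(2)]) auto
      then have "1 \<in> N" by (simp add: const_alg_simps)
      then have "x \<in> N" for x using left_ideal_mult[OF N(1), of 1 x] by simp
      with N(3) show False by blast
    qed
  qed
  then have "\<Union>{N. left_ideal N \<and> I \<subseteq> N \<and> N \<noteq> UNIV} \<subseteq> K" by blast
  moreover have "K \<noteq> UNIV" using K(3) by blast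
  ultimately show ?thesis
    unfolding irr_ideal_def using K by blast
qed

end

section \<open>Representations of a graded Lie algebra\<close>

locale vspace = vector_space scale for scale :: "complex \<Rightarrow> 'b::ab_group_add \<Rightarrow> 'b" (infixr "*v" 75)
begin

definition lext :: "('k \<Rightarrow> 'b) \<Rightarrow> ('k \<Rightarrow>\<^sub>0 complex) \<Rightarrow> 'b" where
  "lext f p = (\<Sum>k\<in>Poly_Mapping.keys p. Poly_Mapping.lookup p k *v f k)"

lemma lext_superset:
  assumes "finite S" "Poly_Mapping.keys p \<subseteq> S"
  shows "lext f p = (\<Sum>k\<in>S. Poly_Mapping.lookup p k *v f k)"
  unfolding lext_def using assms by (intro sum.mono_neutral_left) (auto simp: in_keys_iff)

lemma lext_add: "lext f (p + q) = lext f p + lext f q"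
proof -
  let ?S = "Poly_Mapping.keys p \<union> Poly_Mapping.keys q"
  have "lext f (p + q) = (\<Sum>k\<in>?S. Poly_Mapping.lookup (p + q) k *v f k)"
    by (rule lext_superset) (auto dest: subsetD[OF keys_add])
  also have "\<dots> = lext f p + lext f q"
    using lext_superset[of ?S p f] lext_superset[of ?S q f]
    by (simp add: lookup_add scale_left_distrib sum.distrib)
  finally show ?thesis .
qed

lemma lext_zero: "lext f 0 = 0"
  by (simp add: lext_def)

lemma lext_minus: "lext f (- p) = - lext f p"
  using lext_add[of f p "- p"] by (simp add: lext_zero eq_neg_iff_add_eq_0 add.commute)

lemma lext_diff: "lext f (p - q) = lext f p - lext f q"
  using lext_add[of f p "- q"] by (simp add: lext_minus)

lemma lext_sum: "lext f (sum g A) = (\<Sum>i\<in>A. lext f (g i))"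
  by (induction A rule: infinite_finite_induct) (auto simp: lext_zero lext_add)

lemma lext_single: "lext f (Poly_Mapping.single k s) = s *v f k"
  by (simp add: lext_def)

lemma lext_pscale: "lext f (pscale s p) = s *v lext f p"
proof -
  have "Poly_Mapping.keys (pscale s p) \<subseteq> Poly_Mapping.keys p"
    by (auto simp: in_keys_iff lookup_pscale)
  then have "lext f (pscale s p) = (\<Sum>k\<in>Poly_Mapping.keys p. Poly_Mapping.lookup (pscale s p) k *v f k)"
    by (intro lext_superset) auto
  then show ?thesis by (simp add: lext_def lookup_pscale scale_sum_right)
qed

end

fun unfmon :: "'g fmon \<Rightarrow> 'g list" where "unfmon (FMon xs) = xs"

locale linear_ops = vspace scale for scale :: "complex \<Rightarrow> 'b::ab_group_add \<Rightarrow> 'b" (infixr "*v" 75) +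
  fixes op :: "'g \<Rightarrow> 'b \<Rightarrow> 'b"
  assumes op_add: "op g (v + w) = op g v + op g w" and op_scale: "op g (s *v v) = s *v op g v"
begin

definition act :: "'g free_alg \<Rightarrow> 'b \<Rightarrow> 'b" where
  "act p v = lext (\<lambda>w. foldr op (unfmon w) v) p"

lemma foldr_op_add: "foldr op xs (v + w) = foldr op xs v + foldr op xs w"
  by (induction xs) (auto simp: op_add)

lemma foldr_op_scale: "foldr op xs (s *v v) = s *v foldr op xs v"
  by (induction xs) (auto simp: op_scale)

lemma act_add: "act (p + q) v = act p v + act q v"
  and act_zero: "act 0 v = 0"
  and act_minus: "act (- p) v = - act p v"
  and act_diff: "act (p - q) v = act p v - act q v"
  and act_pscale: "act (pscale s p) v = s *v act p v"
  by (simp_all add: act_def lext_add lext_zero lext_minus lext_diff lext_pscale lext_sum)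

lemma act_add_right: "act p (v + w) = act p v + act p w"
  by (simp add: act_def lext_def foldr_op_add scale_right_distrib sum.distrib)

lemma act_scale_right: "act p (s *v v) = s *v act p v"
  by (simp add: act_def lext_def foldr_op_scale scale_sum_right mult.commute)

lemma act_zero_right: "act p 0 = 0"
  using act_scale_right[of p 0 0] by simp

lemma act_sum_right: "act p (sum f A) = (\<Sum>i\<in>A. act p (f i))"
  by (induction A rule: infinite_finite_induct) (auto simp: act_add_right act_zero_right)

lemma act_wrd: "act (wrd xs) v = foldr op xs v"
  by (simp add: act_def wrd_def lext_single)

lemma act_one: "act 1 v = v"
  using act_wrd[of "[]"] by (simp add: wrd_Nil)

lemma act_gen: "act (gen g) v = op g v"
  using act_wrd[of "[g]"] by (simp add: gen_eq_wrd)

lemma act_const_mult: "act (const_alg s * p) v = s *v act p v"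
  by (simp add: const_alg_mult act_pscale)

lemma act_const: "act (const_alg s) v = s *v v"
  using act_const_mult[of s 1] by (simp add: act_one)

lemma act_mult: "act (p * q) v = act p (act q v)"
proof (induction p rule: free_alg_induct)
  case (1 xs)
  show ?case
  proof (induction q rule: free_alg_induct)
    case (1 ys)
    show ?case by (simp add: act_wrd flip: wrd_append)
  next
    case (2 s q)
    then show ?case by (simp add: const_alg_left_commute act_const_mult act_scale_right)
  next
    case (3 q r)
    then show ?case by (simp add: distrib_left act_add act_add_right)
  qed
next
  case (2 s p)
  then show ?case by (simp add: mult.assoc act_const_mult)
next
  case (3 p r)
  then show ?case by (simp add: distrib_right act_add)
qed

lemma act_in:
  assumes "subspace D" "\<And>g v. v \<in> D \<Longrightarrow> op g v \<in> D" "v \<in> D"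
  shows "act p v \<in> D"
proof (induction p rule: free_alg_induct)
  case (1 xs)
  have "foldr op xs v \<in> D" by (induction xs) (auto simp: assms)
  then show ?case by (simp add: act_wrd)
next
  case (2 s p)
  then show ?case using assms(1) by (simp add: act_const_mult subspace_scale)
next
  case (3 p q)
  then show ?case using assms(1) by (simp add: act_add subspace_add)
qed

lemma left_ideal_annihilator: "left_ideal {p. act p v = 0}"
  by (auto simp: left_ideal_def act_zero act_add act_mult act_zero_right)

lemma act_commute:
  assumes op: "\<And>g v. v \<in> D \<Longrightarrow> F (op g v) = op g (F v)" and D: "subspace D" "\<And>g v. v \<in> D \<Longrightarrow> op g v \<in> D" "v \<in> D"
    and F: "\<And>v w. F (v + w) = F v + F w" "\<And>s v. F (s *v v) = s *v F v"
  shows "F (act p v) = act p (F v)"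
proof (induction p rule: free_alg_induct)
  case (1 xs)
  have "foldr op xs v \<in> D \<and> F (foldr op xs v) = foldr op xs (F v)"
    by (induction xs) (auto simp: D op)
  then show ?case by (simp add: act_wrd)
next
  case (2 s p)
  then show ?case by (simp add: act_const_mult F)
next
  case (3 p q)
  then show ?case by (simp add: act_add F)
qed

end

text \<open>The operators are linear on all of \<open>'b\<close>; the Lie algebra relations are required on \<open>D\<close> only.\<close>

locale hw_rep = linear_ops scale op + graded_lie br S deg d0
  for scale :: "complex \<Rightarrow> 'b::ab_group_add \<Rightarrow> 'b" (infixr "*v" 75) and op :: "'g \<Rightarrow> 'b \<Rightarrow> 'b"
    and br :: "'g \<Rightarrow> 'g \<Rightarrow> ('g \<Rightarrow>\<^sub>0 complex)" and S deg d0 +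
  fixes D :: "'b set" and vac :: 'b
  assumes D_subspace: "subspace D" and op_in: "v \<in> D \<Longrightarrow> op g v \<in> D" and vac_in: "vac \<in> D"
    and op_bracket: "v \<in> D \<Longrightarrow> op x (op y v) - op y (op x v) = act (embed_lie (br x y)) v"
    and hw: "s \<in> S \<Longrightarrow> act s vac = 0"
begin

lemma act_in_D: "v \<in> D \<Longrightarrow> act p v \<in> D"
  using act_in[OF D_subspace op_in] .

text \<open>The elements annihilating all of \<open>D\<close> form a two-sided ideal, since
  \<open>D\<close> is stable. This is why the relations are asked for on a whole stable subspace and
  not at a single vector.\<close>

lemma env_ideal_annihilates:
  assumes "p \<in> env_ideal br" "v \<in> D" shows "act p v = 0"
proof -
  have "two_sided_ideal {p. \<forall>v\<in>D. act p v = 0}"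
    by (auto simp: two_sided_ideal_def left_ideal_def act_zero act_add act_mult act_zero_right act_in_D)
  moreover have "gen x * gen y - gen y * gen x - embed_lie (br x y) \<in> {p. \<forall>v\<in>D. act p v = 0}" for x y
    by (auto simp: act_diff act_mult act_gen op_bracket)
  ultimately have "env_ideal br \<subseteq> {p. \<forall>v\<in>D. act p v = 0}"
    unfolding env_ideal_def by blast
  with assms show ?thesis by blast
qed

text \<open>The vector need not be \<open>vac\<close>: in the semisimple case every vector in the
  vacuum orbit of the first Virasoro algebra satisfies the hypothesis for the second.\<close>

lemma I_annihilates:
  assumes "v \<in> D" "\<And>s. s \<in> S \<Longrightarrow> act s v = 0" "p \<in> I"
  shows "act p v = 0"
proof -
  have "I \<subseteq> {p. act p v = 0}"
    using env_ideal_annihilates assms by (intro module_ideal_least left_ideal_annihilator) auto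
  with assms show ?thesis by blast
qed

lemma I_annihilates_vac: "p \<in> I \<Longrightarrow> act p vac = 0"
  using I_annihilates[OF vac_in hw] .

lemma vac_proj_vac: "act (vac_proj n) vac = vac"
  using I_annihilates_vac[OF vac_proj_one[of n]] by (simp add: act_diff act_one)

lemma vac_proj_act: "\<exists>N. \<forall>n\<ge>N. \<exists>s. act (vac_proj n) (act p vac) = s *v vac"
proof -
  obtain N where N: "\<forall>n\<ge>N. \<exists>s. vac_proj n * p - const_alg s \<in> I"
    using vac_proj_eventually by blast
  have "\<exists>s. act (vac_proj n) (act p vac) = s *v vac" if "n \<ge> N" for n
  proof -
    from N that obtain s where "vac_proj n * p - const_alg s \<in> I" by blast
    from I_annihilates_vac[OF this] show ?thesis by (auto simp: act_diff act_mult act_const)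
  qed
  then show ?thesis by blast
qed

lemma irr_ideal_eq_annihilator:
  assumes "vac \<noteq> 0"
    and "\<And>p. act p vac \<noteq> 0 \<Longrightarrow> \<exists>r. act r (act p vac) = vac"
  shows "irr_ideal br S = {p. act p vac = 0}"
proof (rule irr_ideal_eqI)
  show "left_ideal {p. act p vac = 0}" by (rule left_ideal_annihilator)
  show "I \<subseteq> {p. act p vac = 0}" using I_annihilates_vac by blast
  show "1 \<notin> {p. act p vac = 0}" using assms(1) by (simp add: act_one)
  show "\<exists>r. r * p - 1 \<in> {p. act p vac = 0}" if "p \<notin> {p. act p vac = 0}" for p
    using assms(2)[of p] that by (auto simp: act_diff act_mult act_one)
qed

end

section \<open>Vertex operator algebras on a vector space\<close>

text \<open>The axioms of a vertex operator algebra with carrier \<open>C\<close> in a vector space \<open>'b\<close>. The modes are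
  total, being composed with a projection to \<open>C\<close> in both arguments, so that most identities hold
  on all of \<open>'b\<close>.\<close>

locale voa_model = vspace scale for scale :: "complex \<Rightarrow> 'b::ab_group_add \<Rightarrow> 'b" (infixr "*v" 75) +
  fixes M :: "'b \<Rightarrow> int \<Rightarrow> 'b \<Rightarrow> 'b" and C :: "'b set" and vac om :: 'b and c :: complex
  assumes C_subspace: "subspace C"
    and M_in: "M u n v \<in> C"
    and M_add_left: "M (u + u') n v = M u n v + M u' n v"
    and M_scale_left: "M (s *v u) n v = s *v M u n v"
    and M_add_right: "M u n (v + v') = M u n v + M u n v'"
    and M_scale_right: "M u n (s *v v) = s *v M u n v"
    and M_truncation: "\<exists>N. \<forall>n\<ge>N. M u n v = 0"
    and vac_in_C: "vac \<in> C" and om_in_C: "om \<in> C"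
    and M_vac: "v \<in> C \<Longrightarrow> M vac n v = (if n = -1 then v else 0)"
    and M_create: "v \<in> C \<Longrightarrow> M v (-1) vac = v"
    and M_create_zero: "n \<ge> 0 \<Longrightarrow> M v n vac = 0"
    and M_borcherds: "\<exists>N. \<forall>K\<ge>N.
      (\<Sum>i<K. (of_int m gchoose i) *v M (M u (l + int i) v) (m + n - int i) w)
      = (\<Sum>i<K. ((-1) ^ i * (of_int l gchoose i)) *v
          (M u (m + l - int i) (M v (n + int i) w)
           - ((-1) powi l) *v M v (n + l - int i) (M u (m + int i) w)))"
    and M_virasoro: "v \<in> C \<Longrightarrow> M om (m + 1) (M om (n + 1) v) - M om (n + 1) (M om (m + 1) v)
      = of_int (m - n) *v M om (m + n + 1) v + (if m + n = 0 then of_int (m ^ 3 - m) / 12 * c else 0) *v v"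
    and M_translation: "M (M om 0 u) n v = (- of_int n) *v M u (n - 1) v"
begin

abbreviation L :: "int \<Rightarrow> 'b \<Rightarrow> 'b" where "L n v \<equiv> M om (n + 1) v"

lemma M_zero_left: "M 0 n v = 0" using M_scale_left[of 0 0] by simp
lemma M_zero_right: "M u n 0 = 0" using M_scale_right[of u n 0 0] by simp
lemma M_minus_left: "M (- u) n v = - M u n v" using M_scale_left[of "-1" u] by simp
lemma M_minus_right: "M u n (- v) = - M u n v" using M_scale_right[of u n "-1"] by simp
lemma M_diff_left: "M (u - u') n v = M u n v - M u' n v"
  using M_add_left[of u "- u'"] by (simp add: M_minus_left)
lemma M_diff_right: "M u n (v - v') = M u n v - M u n v'"
  using M_add_right[of u n v "- v'"] by (simp add: M_minus_right)
lemma M_sum_left: "M (sum f A) n v = (\<Sum>i\<in>A. M (f i) n v)"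
  by (induction A rule: infinite_finite_induct) (auto simp: M_add_left M_zero_left)
lemma M_sum_right: "M u n (sum f A) = (\<Sum>i\<in>A. M u n (f i))"
  by (induction A rule: infinite_finite_induct) (auto simp: M_add_right M_zero_right)

lemmas M_linear = M_add_left M_scale_left M_add_right M_scale_right M_diff_left M_diff_right
  M_minus_left M_minus_right M_zero_left M_zero_right

text \<open>The case l = 0 of the Borcherds identity: \<open>0 gchoose i\<close> leaves only the
  term i = 0 on the right.\<close>

lemma commutator:
  "\<exists>N. \<forall>K\<ge>N. M u m (M v n w) - M v n (M u m w)
     = (\<Sum>i<K. (of_int m gchoose i) *v M (M u (int i) v) (m + n - int i) w)"
proof -
  obtain N where N: "\<And>K. K \<ge> N \<Longrightarrow> (\<Sum>i<K. (of_int m gchoose i) *v M (M u (int i) v) (m + n - int i) w)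
      = (\<Sum>i<K. ((-1) ^ i * (0 gchoose i)) *v
          (M u (m - int i) (M v (n + int i) w) - M v (n - int i) (M u (m + int i) w)))"
    using M_borcherds[of m u 0 v n w] by auto
  have h: "(\<Sum>i<K. ((-1) ^ i * (0 gchoose i)) *v
          (M u (m - int i) (M v (n + int i) w) - M v (n - int i) (M u (m + int i) w)))
      = M u m (M v n w) - M v n (M u m w)" if "K \<ge> Suc N" for K
  proof -
    from that obtain K' where K: "K = Suc K'" by (cases K) auto
    show ?thesis unfolding K by (subst sum.lessThan_Suc_shift) simp
  qed
  show ?thesis
  proof (intro exI[of _ "Suc N"] allI impI)
    fix K assume "K \<ge> Suc N"
    with N[of K] h[of K] show "M u m (M v n w) - M v n (M u m w)
       = (\<Sum>i<K. (of_int m gchoose i) *v M (M u (int i) v) (m + n - int i) w)" by simp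
  qed
qed

lemma commutator_bounded:
  assumes "\<And>i. i \<ge> k \<Longrightarrow> M u (int i) v = 0"
  shows "M u m (M v n w) - M v n (M u m w)
     = (\<Sum>i<k. (of_int m gchoose i) *v M (M u (int i) v) (m + n - int i) w)"
proof -
  obtain N where N: "\<And>K. K \<ge> N \<Longrightarrow> M u m (M v n w) - M v n (M u m w)
     = (\<Sum>i<K. (of_int m gchoose i) *v M (M u (int i) v) (m + n - int i) w)"
    using commutator by blast
  have "(\<Sum>i<max k N. (of_int m gchoose i) *v M (M u (int i) v) (m + n - int i) w)
    = (\<Sum>i<k. (of_int m gchoose i) *v M (M u (int i) v) (m + n - int i) w)"
    using assms by (intro sum.mono_neutral_right) (auto simp: M_zero_left)
  with N[of "max k N"] show ?thesis by simp
qed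

text \<open>The case m = 0 of the Borcherds identity leaves only i = 0 on the left, so a mode of
  \<open>M u l v\<close> is a combination of products of a mode of \<open>u\<close> and a mode of
  \<open>v\<close> in either order.\<close>

lemma iterate_in_subspace:
  assumes "subspace W" "\<And>a b. M u a (M v b w) \<in> W" "\<And>a b. M v a (M u b w) \<in> W"
  shows "M (M u l v) n w \<in> W"
proof -
  obtain N where N: "\<And>K. K \<ge> N \<Longrightarrow>
      (\<Sum>i<K. (0 gchoose i) *v M (M u (l + int i) v) (n - int i) w)
      = (\<Sum>i<K. ((-1) ^ i * (of_int l gchoose i)) *v
          (M u (l - int i) (M v (n + int i) w) - ((-1) powi l) *v M v (n + l - int i) (M u (int i) w)))"
    using M_borcherds[of 0 u l v n w] by auto
  have "M (M u l v) n w = (\<Sum>i<Suc N. (0 gchoose i) *v M (M u (l + int i) v) (n - int i) w)"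
    by (subst sum.lessThan_Suc_shift) simp
  also have "\<dots> \<in> W"
    by (subst N, simp) (intro subspace_sum subspace_scale subspace_diff assms)
  finally show ?thesis .
qed

text \<open>The same expansion at \<open>w\<close> and at \<open>F w\<close>, compared at a common
  number of terms.\<close>

lemma iterate_eqI:
  assumes "\<And>a b. F (M u a (M v b w)) = M u a (M v b (F w))" "\<And>a b. F (M v a (M u b w)) = M v a (M u b (F w))"
    and F: "\<And>v w. F (v + w) = F v + F w" "\<And>s v. F (s *v v) = s *v F v"
  shows "F (M (M u l v) n w) = M (M u l v) n (F w)"
proof -
  have F0: "F 0 = 0" using F(2)[of 0 0] by simp
  have Fm: "F (x - y) = F x - F y" for x y
    using F(1)[of x "- y"] F(2)[of "-1" y] by simp
  have Fs: "F (sum g A) = (\<Sum>i\<in>A. F (g i))" for g :: "nat \<Rightarrow> 'b" and A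
    by (induction A rule: infinite_finite_induct) (auto simp: F F0)
  have b: "\<exists>N. \<forall>K\<ge>N. M (M u l v) n w = (\<Sum>i<K. ((-1) ^ i * (of_int l gchoose i)) *v
          (M u (l - int i) (M v (n + int i) w) - ((-1) powi l) *v M v (n + l - int i) (M u (int i) w)))" for w
  proof -
    obtain N where N: "\<And>K. K \<ge> N \<Longrightarrow>
        (\<Sum>i<K. (0 gchoose i) *v M (M u (l + int i) v) (n - int i) w)
        = (\<Sum>i<K. ((-1) ^ i * (of_int l gchoose i)) *v
            (M u (l - int i) (M v (n + int i) w) - ((-1) powi l) *v M v (n + l - int i) (M u (int i) w)))"
      using M_borcherds[of 0 u l v n w] by auto
    have h: "M (M u l v) n w = (\<Sum>i<K. (0 gchoose i) *v M (M u (l + int i) v) (n - int i) w)" if "K \<ge> Suc N" for K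
    proof -
      from that obtain K' where K: "K = Suc K'" by (cases K) auto
      show ?thesis unfolding K by (subst sum.lessThan_Suc_shift) simp
    qed
    show ?thesis
    proof (intro exI[of _ "Suc N"] allI impI)
      fix K assume "K \<ge> Suc N"
      with N[of K] h[of K] show "M (M u l v) n w = (\<Sum>i<K. ((-1) ^ i * (of_int l gchoose i)) *v
          (M u (l - int i) (M v (n + int i) w) - ((-1) powi l) *v M v (n + l - int i) (M u (int i) w)))"
        by (simp only: Suc_leD)
    qed
  qed
  obtain N N' where N:
    "\<And>K. K \<ge> N \<Longrightarrow> M (M u l v) n w = (\<Sum>i<K. ((-1) ^ i * (of_int l gchoose i)) *v
       (M u (l - int i) (M v (n + int i) w) - ((-1) powi l) *v M v (n + l - int i) (M u (int i) w)))"
    "\<And>K. K \<ge> N' \<Longrightarrow> M (M u l v) n (F w) = (\<Sum>i<K. ((-1) ^ i * (of_int l gchoose i)) *v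
       (M u (l - int i) (M v (n + int i) (F w)) - ((-1) powi l) *v M v (n + l - int i) (M u (int i) (F w))))"
    using b[of w] b[of "F w"] by blast
  show ?thesis
    by (subst N(1)[of "max N N'"], simp, subst N(2)[of "max N N'"], simp)
      (simp add: Fs F Fm assms)
qed

section \<open>Subalgebras, stabilizers and centralizers\<close>

definition subalg :: "'b set \<Rightarrow> bool" where
  "subalg A \<longleftrightarrow> subspace A \<and> A \<subseteq> C \<and> vac \<in> A \<and> (\<forall>u\<in>A. \<forall>v\<in>A. \<forall>n. M u n v \<in> A)"

text \<open>The way generation is exploited, here and in \<open>subalg_centralizer\<close>: a
  property of all modes of \<open>u\<close> that cuts out a subalgebra has to be checked for
  generators only.\<close>

lemma subalg_stabilizer:
  assumes "subspace W" "W \<subseteq> C"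
  shows "subalg {u \<in> C. \<forall>n. \<forall>w\<in>W. M u n w \<in> W}"
proof -
  have "M (M u l v) n w \<in> W"
    if "\<forall>n. \<forall>w\<in>W. M u n w \<in> W" "\<forall>n. \<forall>w\<in>W. M v n w \<in> W" "w \<in> W" for u v l n w
    using that by (intro iterate_in_subspace assms) auto
  moreover have "subspace {u \<in> C. \<forall>n. \<forall>w\<in>W. M u n w \<in> W}"
    unfolding subspace_def using assms C_subspace
    by (auto simp: M_linear subspace_0 subspace_add subspace_scale)
  ultimately show ?thesis
    unfolding subalg_def using assms by (auto simp: vac_in_C M_in M_vac subspace_0)
qed

lemma subalg_centralizer:
  assumes F: "\<And>v w. F (v + w) = F v + F w" "\<And>s v. F (s *v v) = s *v F v" and FC: "\<And>w. w \<in> C \<Longrightarrow> F w \<in> C"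
  shows "subalg {u \<in> C. \<forall>n. \<forall>w\<in>C. F (M u n w) = M u n (F w)}"
proof -
  have F0: "F 0 = 0" using F(2)[of 0 0] by simp
  have "F (M (M u l v) n w) = M (M u l v) n (F w)"
    if "\<forall>n. \<forall>w\<in>C. F (M u n w) = M u n (F w)" "\<forall>n. \<forall>w\<in>C. F (M v n w) = M v n (F w)" "w \<in> C" for u v l n w
    using that by (intro iterate_eqI F) (auto simp: M_in)
  moreover have "subspace {u \<in> C. \<forall>n. \<forall>w\<in>C. F (M u n w) = M u n (F w)}"
    unfolding subspace_def using C_subspace
    by (auto simp: M_linear subspace_0 subspace_add subspace_scale F F0)
  ultimately show ?thesis
    unfolding subalg_def by (auto simp: vac_in_C M_in M_vac F0 FC)
qed

text \<open>\<open>W\<close> lies in its own stabilizer, which is a subalgebra.\<close>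

lemma subalg_of_orbit:
  assumes W: "subspace W" "W \<subseteq> C" "vac \<in> W" and S: "S \<subseteq> C" "\<And>u n w. u \<in> S \<Longrightarrow> w \<in> W \<Longrightarrow> M u n w \<in> W"
    and least: "\<And>Z. subspace Z \<Longrightarrow> vac \<in> Z \<Longrightarrow> (\<And>u n w. u \<in> S \<Longrightarrow> w \<in> Z \<Longrightarrow> M u n w \<in> Z) \<Longrightarrow> W \<subseteq> Z"
  shows "subalg W"
proof -
  let ?Z = "{u \<in> C. \<forall>n. \<forall>w\<in>W. M u n w \<in> W}"
  have Z: "subalg ?Z" by (rule subalg_stabilizer[OF W(1,2)])
  have "W \<subseteq> ?Z"
  proof (rule least)
    show "subspace ?Z" "vac \<in> ?Z" using Z by (auto simp: subalg_def)
    show "M u n w \<in> ?Z" if "u \<in> S" "w \<in> ?Z" for u n w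
    proof -
      have "u \<in> ?Z" using that S by auto
      with Z that show ?thesis unfolding subalg_def by blast
    qed
  qed
  then show ?thesis unfolding subalg_def using W by blast
qed

section \<open>Weights\<close>

definition wt :: "int \<Rightarrow> 'b set" where "wt n = {v \<in> C. L 0 v = of_int n *v v}"

lemma subspace_wt: "subspace (wt n)"
  unfolding subspace_def wt_def using C_subspace
  by (auto simp: subspace_0 subspace_add subspace_scale M_linear scale_right_distrib mult.commute)

lemma gbinomial_small: "(a::complex) gchoose 1 = a" "a gchoose (Suc 0) = a" "a gchoose 2 = a * (a - 1) / 2"
  "a gchoose 3 = a * (a - 1) * (a - 2) / 6"
  by (simp_all add: gbinomial_prod_rev numeral_eq_Suc)

text \<open>In the commutator with L(0), the mode \<open>om\<close> 1, only i = 0 and i = 1 survive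
  because \<open>1 gchoose i\<close> vanishes afterwards; translation turns the term i = 0 into a
  multiple of \<open>M u n v\<close>.\<close>

lemma L0_M: "L 0 (M u n v) = M u n (L 0 v) + M (L 0 u) n v - of_int (n + 1) *v M u n v"
proof -
  obtain N where N: "\<And>K. K \<ge> N \<Longrightarrow> M om 1 (M u n v) - M u n (M om 1 v)
     = (\<Sum>i<K. (of_int 1 gchoose i) *v M (M om (int i) u) (1 + n - int i) v)"
    using commutator by blast
  have "(\<Sum>i<max 2 N. (of_int 1 gchoose i) *v M (M om (int i) u) (1 + n - int i) v)
    = (\<Sum>i<2. (of_int 1 gchoose i) *v M (M om (int i) u) (1 + n - int i) v)"
  proof (rule sum.mono_neutral_right)
    have "((1::complex) gchoose i) = 0" if "i \<ge> 2" for i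
    proof -
      have "(of_nat 1 :: complex) gchoose i = of_nat (1 choose i)" by (rule binomial_gbinomial[symmetric])
      also have "1 choose i = 0" using that by (intro binomial_eq_0) simp
      finally show ?thesis by simp
    qed
    then show "\<forall>i\<in>{..<max 2 N} - {..<2}. (of_int 1 gchoose i) *v M (M om (int i) u) (1 + n - int i) v = 0"
      by auto
  qed auto
  with N[of "max 2 N"] have "M om 1 (M u n v) - M u n (M om 1 v)
     = M (M om 0 u) (1 + n) v + M (M om 1 u) n v"
    by (simp add: lessThan_nat_numeral lessThan_Suc)
  then show ?thesis by (simp add: M_translation algebra_simps)
qed

lemma M_wt: "u \<in> wt p \<Longrightarrow> v \<in> wt q \<Longrightarrow> M u n v \<in> wt (p + q - n - 1)"
  unfolding wt_def using L0_M[of u n v]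
  by (simp add: M_in M_linear algebra_simps flip: scale_left_distrib scale_left_diff_distrib)

lemma vac_wt: "vac \<in> wt 0"
  by (simp add: wt_def vac_in_C M_create_zero)

lemma om_wt: "om \<in> wt 2"
  using M_virasoro[OF vac_in_C, of 0 "-2"] M_create[OF om_in_C]
  by (simp add: wt_def om_in_C M_create_zero M_linear)

text \<open>[L(2), L(-2)] applied to the vacuum: L(0) kills it, and (8 - 2)/12 is 1/2.\<close>

lemma om_3_om: "M om 3 om = (c / 2) *v vac"
  using M_virasoro[OF vac_in_C, of 2 "-2"] M_create[OF om_in_C]
  by (simp add: M_create_zero M_linear)

lemma M_om_minus2: "u \<in> C \<Longrightarrow> M u (-2) vac = M om 0 u"
  using M_translation[of u "-1" vac] by (simp add: M_create M_in)

end

section \<open>The space of weight 2\<close>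

locale moonshine_model = voa_model +
  assumes vac_nz: "vac \<noteq> 0"
    and c_nz: "c \<noteq> 0"
    and simple: "subspace J \<Longrightarrow> J \<subseteq> C \<Longrightarrow> (\<And>u n v. u \<in> C \<Longrightarrow> v \<in> J \<Longrightarrow> M u n v \<in> J) \<Longrightarrow> J = {0} \<or> J = C"
    and wt_neg: "n < 0 \<Longrightarrow> wt n = {0}"
    and wt_0: "wt 0 = {s *v vac | s. True}"
    and wt_1: "wt 1 = {0}"
    and wt_finite_dim: "\<exists>B. finite B \<and> wt n \<subseteq> span B"
    and generated: "subalg A \<Longrightarrow> wt 2 \<subseteq> A \<Longrightarrow> A = C"
    and dim_2: "\<exists>a b. wt 2 = {s *v a + t *v b | s t. True} \<and> (\<forall>s t. s *v a + t *v b = 0 \<longrightarrow> s = 0 \<and> t = 0)"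
begin

lemma wt_in_C: "v \<in> wt n \<Longrightarrow> v \<in> C" by (simp add: wt_def)

lemma M_wt2: assumes "u \<in> wt 2" "v \<in> wt n" shows "M u m v \<in> wt (n + 1 - m)"
  using M_wt[OF assms, of m] by (simp add: algebra_simps)

lemma wt2_1: "u \<in> wt 2 \<Longrightarrow> v \<in> wt 2 \<Longrightarrow> M u 1 v \<in> wt 2"
  using M_wt2[of u v 2 1] by auto

lemma wt2_2: "u \<in> wt 2 \<Longrightarrow> v \<in> wt 2 \<Longrightarrow> M u 2 v = 0"
  using M_wt2[of u v 2 2] wt_1 by auto

text \<open>For \<open>u\<close> and \<open>v\<close> of weight 2 the vector \<open>M u 3 v\<close>
  has weight 0 and is a multiple of the vacuum. This is the invariant bilinear form of the Griess
  algebra.\<close>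

definition form :: "'a \<Rightarrow> 'a \<Rightarrow> complex" where "form u v = (THE s. M u 3 v = s *v vac)"

lemma form_eqI: "M u 3 v = s *v vac \<Longrightarrow> form u v = s"
  unfolding form_def using vac_nz by (intro the_equality) auto

lemma wt2_3: "u \<in> wt 2 \<Longrightarrow> v \<in> wt 2 \<Longrightarrow> M u 3 v = form u v *v vac"
  using M_wt2[of u v 2 3] wt_0 form_eqI by fastforce

lemma wt2_ge: "u \<in> wt 2 \<Longrightarrow> v \<in> wt 2 \<Longrightarrow> n \<ge> 4 \<Longrightarrow> M u n v = 0"
  using M_wt2[of u v 2 n] wt_neg[of "3 - n"] by auto

lemma sum4: "(\<Sum>i<4::nat. f i) = f 0 + f 1 + f 2 + (f 3 :: 'a)"
  by (simp add: numeral_eq_Suc add.assoc)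

text \<open>The vector \<open>M u i v\<close> has weight 3 - i, so i = 2 drops out by the vanishing
  of weight 1, i = 3 gives the form, and i > 3 gives negative weights.\<close>

lemma commutator_wt2_raw:
  assumes "u \<in> wt 2" "v \<in> wt 2"
  shows "M u m (M v n w) - M v n (M u m w) = M (M u 0 v) (m + n) w + of_int m *v M (M u 1 v) (m + n - 1) w
     + (of_int m * (of_int m - 1) * (of_int m - 2) / 6 * form u v) *v M vac (m + n - 3) w"
proof -
  have "M u m (M v n w) - M v n (M u m w)
     = (\<Sum>i<4. (of_int m gchoose i) *v M (M u (int i) v) (m + n - int i) w)"
    using assms by (intro commutator_bounded wt2_ge) auto
  then show ?thesis
    using assms by (simp add: sum4 gbinomial_small wt2_2 wt2_3 M_linear)
qed

text \<open>This and the next two lemmas are skew symmetry, read off from the commutator of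
  \<open>M u (-1)\<close> and \<open>M v n\<close> at the vacuum for n = 3, 1, 0: there
  \<open>M v n\<close> kills the vacuum and \<open>M u (-1)\<close> turns it into
  \<open>u\<close>.\<close>

lemma form_sym: assumes "u \<in> wt 2" "v \<in> wt 2" shows "form v u = form u v"
proof -
  have "M u (-1) (M v 3 vac) - M v 3 (M u (-1) vac) = M (M u 0 v) 2 vac - M (M u 1 v) 1 vac
     - (form u v) *v M vac (-1) vac"
    using commutator_wt2_raw[OF assms, of "-1" 3 vac] by simp
  then have "M v 3 u = form u v *v vac"
    using assms by (simp add: M_create_zero M_create wt_in_C vac_in_C M_linear)
  then show ?thesis by (rule form_eqI)
qed

lemma product_commute: assumes "u \<in> wt 2" "v \<in> wt 2" shows "M v 1 u = M u 1 v"
proof -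
  have "M u (-1) (M v 1 vac) - M v 1 (M u (-1) vac) = M (M u 0 v) 0 vac - M (M u 1 v) (-1) vac
     - (form u v) *v M vac (-3) vac"
    using commutator_wt2_raw[OF assms, of "-1" 1 vac] by simp
  then show ?thesis
    using assms by (simp add: M_create_zero M_create wt_in_C M_in vac_in_C M_vac M_linear)
qed

lemma skew_0: assumes "u \<in> wt 2" "v \<in> wt 2" shows "M v 0 u = M om 0 (M u 1 v) - M u 0 v"
proof -
  have "M u (-1) (M v 0 vac) - M v 0 (M u (-1) vac) = M (M u 0 v) (-1) vac - M (M u 1 v) (-2) vac
     - (form u v) *v M vac (-4) vac"
    using commutator_wt2_raw[OF assms, of "-1" 0 vac] by simp
  then have "- M v 0 u = M u 0 v - M om 0 (M u 1 v)"
    using assms by (simp add: M_create_zero M_create wt_in_C M_in vac_in_C M_vac M_linear M_om_minus2)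
  then show ?thesis by (metis minus_diff_eq minus_minus)
qed

lemma om_product: "u \<in> wt 2 \<Longrightarrow> M om 1 u = 2 *v u" "u \<in> wt 2 \<Longrightarrow> M u 1 om = 2 *v u"
  using product_commute[OF om_wt] by (auto simp: wt_def)

lemma form_om_om: "form om om = c / 2"
  by (rule form_eqI[OF om_3_om])

lemma form_linear:
  "u \<in> wt 2 \<Longrightarrow> v \<in> wt 2 \<Longrightarrow> w \<in> wt 2 \<Longrightarrow> form (u + v) w = form u w + form v w"
  "u \<in> wt 2 \<Longrightarrow> v \<in> wt 2 \<Longrightarrow> w \<in> wt 2 \<Longrightarrow> form w (u + v) = form w u + form w v"
  "u \<in> wt 2 \<Longrightarrow> w \<in> wt 2 \<Longrightarrow> form (s *v u) w = s * form u w"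
  "u \<in> wt 2 \<Longrightarrow> w \<in> wt 2 \<Longrightarrow> form w (s *v u) = s * form w u"
  by (auto intro!: form_eqI simp: M_linear wt2_3 scale_left_distrib)

lemma om_nz: "om \<noteq> 0"
proof
  assume "om = 0"
  then have "(c / 2) *v vac = 0" using om_3_om by (simp add: M_zero_left)
  with c_nz vac_nz show False by simp
qed

lemma basis_with_om:
  obtains y where "wt 2 = {s *v om + t *v y | s t. True}" "\<And>s t. s *v om + t *v y = 0 \<Longrightarrow> s = 0 \<and> t = 0"
proof -
  obtain a b where ab: "wt 2 = {s *v a + t *v b | s t. True}" "\<And>s t. s *v a + t *v b = 0 \<Longrightarrow> s = 0 \<and> t = 0"
    using dim_2 by blast
  note goal = that
  have gen: thesis if ab: "wt 2 = {s *v a + t *v b | s t. True}" "\<And>s t. s *v a + t *v b = 0 \<Longrightarrow> s = 0 \<and> t = 0"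
    and om: "om = p *v a + q *v b" and p: "p \<noteq> 0" for a b p q
  proof (rule goal)
    show "wt 2 = {s *v om + t *v b | s t. True}"
    proof (intro equalityI subsetI)
      fix v assume "v \<in> wt 2"
      then obtain s t where "v = s *v a + t *v b" using ab by blast
      then have "v = (s / p) *v om + (t - s * q / p) *v b"
        using p by (simp add: om scale_right_distrib scale_left_diff_distrib)
      then show "v \<in> {s *v om + t *v b | s t. True}" by blast
    next
      fix v assume "v \<in> {s *v om + t *v b | s t. True}"
      then obtain s t where "v = s *v om + t *v b" by blast
      then have "v = (s * p) *v a + (s * q + t) *v b"
        by (simp add: om scale_right_distrib scale_left_distrib)
      then show "v \<in> wt 2" using ab by blast
    qed
    show "s = 0 \<and> t = 0" if "s *v om + t *v b = 0" for s t
    proof -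
      have "(s * p) *v a + (s * q + t) *v b = 0"
        using that by (simp add: om scale_right_distrib scale_left_distrib add.assoc)
      then have "s * p = 0 \<and> s * q + t = 0" by (rule ab)
      with p show ?thesis by auto
    qed
  qed
  have "om \<in> wt 2" by (rule om_wt)
  then obtain p q where pq: "om = p *v a + q *v b" using ab by blast
  show thesis
  proof (cases "p = 0")
    case False
    from gen[OF ab pq this] show thesis .
  next
    case True
    have "q \<noteq> 0" using True pq om_nz by auto
    moreover have "wt 2 = {s *v b + t *v a | s t. True}" using ab(1) by (auto simp: add.commute) (metis add.commute)+
    moreover have "\<And>s t. s *v b + t *v a = 0 \<Longrightarrow> s = 0 \<and> t = 0" using ab(2) by (metis add.commute)
    moreover have "om = q *v b + p *v a" using pq by (simp add: add.commute)
    ultimately show thesis using gen by blast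
  qed
qed

text \<open>Skew symmetry gives the symmetric part of \<open>M u 0 v\<close>. The antisymmetric part
  is alternating, hence determined on the span of \<open>om\<close> and \<open>y\<close> by that one
  pair, where \<open>M om 0 y\<close> is already L(-1) of half the product, as
  \<open>M om 1 y\<close> is twice \<open>y\<close>.\<close>

lemma wt2_0_eq: assumes "u \<in> wt 2" "v \<in> wt 2" shows "M u 0 v = (1 / 2) *v M om 0 (M u 1 v)"
proof -
  obtain y where y: "wt 2 = {s *v om + t *v y | s t. True}" using basis_with_om by metis
  have "0 *v om + 1 *v y \<in> wt 2" unfolding y by blast
  then have y2: "y \<in> wt 2" by simp
  have half: "x = (1 / 2) *v z" if "x = z - x" for x z :: 'a
  proof -
    have "x + x = z" using that by (metis diff_add_cancel)
    then have "2 *v x = z" by (metis scale_one one_add_one scale_left_distrib)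
    then show ?thesis by auto
  qed
  have self: "M x 0 x = (1 / 2) *v M om 0 (M x 1 x)" if "x \<in> wt 2" for x
    using skew_0[OF that that] by (rule half)
  have om_l: "M om 0 x = (1 / 2) *v M om 0 (M om 1 x)" if "x \<in> wt 2" for x
    using that by (simp add: om_product M_linear)
  have om_r: "M x 0 om = (1 / 2) *v M om 0 (M x 1 om)" if "x \<in> wt 2" for x
  proof -
    have "M x 0 om = 2 *v M om 0 x - M om 0 x"
      using skew_0[OF om_wt that] that by (simp add: om_product M_linear)
    also have "2 *v M om 0 x = M om 0 x + M om 0 x"
      using scale_left_distrib[of 1 1 "M om 0 x"] by simp
    finally show ?thesis using that by (simp add: om_product M_linear)
  qed
  obtain s t s' t' where "u = s *v om + t *v y" "v = s' *v om + t' *v y"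
    using assms y by blast
  then show ?thesis
    using self[OF y2] self[OF om_wt] om_l[OF y2] om_r[OF y2]
    by (simp add: M_linear scale_right_distrib)
qed

text \<open>The indices are shifted so that for \<open>om\<close> the modes are L(m) and L(n). The
  coefficient (m - n)/2 is m + 1 minus half of m + n + 2, the latter coming from
  \<open>M u 0 v\<close> by translation. If \<open>u\<close> = \<open>v\<close> has square twice
  itself and \<open>form u u\<close> is k/2, this is the Virasoro relation of central charge
  k.\<close>

lemma commutator_wt2:
  assumes "u \<in> wt 2" "v \<in> wt 2" "w \<in> C"
  shows "M u (m + 1) (M v (n + 1) w) - M v (n + 1) (M u (m + 1) w)
     = (of_int (m - n) / 2) *v M (M u 1 v) (m + n + 1) w
       + (if m + n = 0 then of_int (m ^ 3 - m) / 6 * form u v else 0) *v w"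
proof -
  have 1: "M (M u 0 v) (m + 1 + (n + 1)) w = (- (of_int (m + n + 2) / 2)) *v M (M u 1 v) (m + n + 1) w"
  proof -
    have "m + 1 + (n + 1) - 1 = m + n + 1" by simp
    moreover have "1 / 2 * - complex_of_int (m + 1 + (n + 1)) = - (of_int (m + n + 2) / 2)"
      by (simp add: field_simps)
    ultimately show ?thesis
      by (simp only: wt2_0_eq[OF assms(1,2)] M_scale_left M_translation scale_scale)
  qed
  have 2: "of_int (m + 1) *v M (M u 1 v) (m + 1 + (n + 1) - 1) w
      = of_int (m + 1) *v M (M u 1 v) (m + n + 1) w"
    by (simp add: algebra_simps)
  have 3: "(of_int (m + 1) * (of_int (m + 1) - 1) * (of_int (m + 1) - 2) / 6 * form u v) *v M vac (m + 1 + (n + 1) - 3) w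
     = (if m + n = 0 then of_int (m ^ 3 - m) / 6 * form u v else 0) *v w"
    using assms(3) by (auto simp: M_vac algebra_simps power3_eq_cube)
  have 4: "of_int (m - n) / 2 = (- (of_int (m + n + 2) / 2) + of_int (m + 1) :: complex)"
    by (simp add: field_simps)
  show ?thesis
    unfolding commutator_wt2_raw[OF assms(1,2)] 1 2 3 4 scale_left_distrib[of "- _"] by simp
qed

text \<open>Take the commutator of \<open>M u 1\<close> and \<open>M v 3\<close> at
  \<open>w\<close>: \<open>M u 1\<close> kills the multiple \<open>M v 3 w\<close> of the vacuum,
  and the coefficient (0 - 2)/2 is -1.\<close>

lemma form_invariant:
  assumes "u \<in> wt 2" "v \<in> wt 2" "w \<in> wt 2"
  shows "form (M u 1 v) w = form v (M u 1 w)"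
proof -
  have "M u 1 (M v 3 w) - M v 3 (M u 1 w) = (of_int (0 - 2) / 2) *v M (M u 1 v) 3 w"
    using commutator_wt2[OF assms(1,2) wt_in_C[OF assms(3)], of 0 2] by simp
  then have "M v 3 (M u 1 w) = M (M u 1 v) 3 w"
    using assms by (simp add: wt2_3 M_linear M_create_zero)
  then have "form v (M u 1 w) *v vac = form (M u 1 v) w *v vac"
    using assms by (simp add: wt2_3 wt2_1)
  then show ?thesis using vac_nz by simp
qed

end

section \<open>Conformal vectors of weight 2\<close>

context voa_model begin

fun L0_proj :: "nat \<Rightarrow> 'b \<Rightarrow> 'b" where
  "L0_proj 0 v = v"
| "L0_proj (Suc k) v = L0_proj k v - (1 / of_nat (Suc k)) *v M om 1 (L0_proj k v)"

lemma L0_proj_add: "L0_proj k (v + w) = L0_proj k v + L0_proj k w"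
  by (induction k) (simp_all add: M_linear scale_right_distrib)

lemma L0_proj_scale: "L0_proj k (s *v v) = s *v L0_proj k v"
  by (induction k) (simp_all add: M_linear scale_right_diff_distrib mult.commute)

lemma L0_proj_vac: "L0_proj k vac = vac"
  by (induction k) (simp_all add: M_create_zero)

lemma L0_proj_wt: "v \<in> wt n \<Longrightarrow> \<exists>s. L0_proj k v = s *v v \<and> (1 \<le> n \<and> n \<le> int k \<longrightarrow> s = 0)"
proof (induction k)
  case 0
  then show ?case by (auto intro!: exI[of _ 1])
next
  case (Suc k)
  then obtain s where s: "L0_proj k v = s *v v" "1 \<le> n \<and> n \<le> int k \<longrightarrow> s = 0" by blast
  define t :: complex where "t = 1 - of_int n / of_nat (Suc k)"
  have t0: "t = 0" if "n = int (Suc k)"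
  proof -
    have "t = 1 - of_nat (Suc k) / of_nat (Suc k)" by (simp only: t_def that of_int_of_nat_eq)
    also have "\<dots> = 0" by (simp del: of_nat_Suc)
    finally show ?thesis .
  qed
  have "L0_proj (Suc k) v = (s * t) *v v"
    using Suc.prems by (simp add: s(1) wt_def M_linear t_def scale_left_diff_distrib algebra_simps)
  moreover have "s * t = 0" if "1 \<le> n \<and> n \<le> int (Suc k)"
    using s(2) that t0 by (cases "n = int (Suc k)") auto
  ultimately show ?case by blast
qed

text \<open>A vector of this span involves finitely many positive weights, all killed by
  \<open>L0_proj k\<close> for large \<open>k\<close>, while the vacuum is fixed.\<close>

lemma vac_notin_positive:
  assumes "vac \<noteq> 0"
  shows "vac \<notin> span (\<Union>n\<in>{1..}. wt n)"
proof
  assume "vac \<in> span (\<Union>n\<in>{1..}. wt n)"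
  then have "\<exists>K. \<forall>k\<ge>K. L0_proj k vac = 0"
  proof (induction rule: span_induct_alt)
    case base
    have "L0_proj k 0 = 0" for k using L0_proj_scale[of k 0 0] by simp
    then show ?case by blast
  next
    case (step s x y)
    then obtain K n where K: "\<forall>k\<ge>K. L0_proj k y = 0" and n: "x \<in> wt n" "n \<ge> 1" by auto
    have "L0_proj k (s *v x + y) = 0" if "k \<ge> max K (nat n)" for k
      using K L0_proj_wt[OF n(1), of k] n(2) that by (auto simp: L0_proj_add L0_proj_scale)
    then show ?case by blast
  qed
  then show False using assms by (auto simp: L0_proj_vac)
qed

end

section \<open>Nondegeneracy of the form and the possible algebras of weight 2\<close>

context moonshine_model begin

text \<open>A letter \<open>(u, m)\<close> stands for the mode with index m + 1, which for
  \<open>u\<close> of weight 2 lowers the weight by m. Thus the weight of a word at the vacuum is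
  minus the sum of its indices.\<close>

definition word_op :: "('a \<times> int) list \<Rightarrow> 'a \<Rightarrow> 'a" where
  "word_op ws v = foldr (\<lambda>(u, m). M u (m + 1)) ws v"

lemma word_op_simps: "word_op [] v = v" "word_op ((u, m) # ws) v = M u (m + 1) (word_op ws v)"
  "word_op (xs @ ys) v = word_op xs (word_op ys v)"
  by (simp_all add: word_op_def)

lemma word_op_linear: "word_op ws (v + w) = word_op ws v + word_op ws w"
  "word_op ws (s *v v) = s *v word_op ws v" "word_op ws 0 = 0"
  by (induction ws) (auto simp: word_op_simps M_linear)

lemma word_op_wt:
  "fst ` set ws \<subseteq> wt 2 \<Longrightarrow> word_op ws vac \<in> wt (- sum_list (map snd ws))"
proof (induction ws)
  case Nil
  then show ?case by (simp add: word_op_simps vac_wt)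
next
  case (Cons a ws)
  obtain u m where a: "a = (u, m)" by (cases a)
  have "M u (m + 1) (word_op ws vac) \<in> wt (- sum_list (map snd ws) + 1 - (m + 1))"
    using Cons a by (intro M_wt2) auto
  then show ?case by (simp add: a word_op_simps algebra_simps)
qed

lemma word_op_in: "fst ` set ws \<subseteq> wt 2 \<Longrightarrow> word_op ws vac \<in> C"
  using word_op_wt wt_in_C by blast

text \<open>A product of modes of \<open>V\<^sub>2\<close> involving \<open>x\<close>, applied to the vacuum, has no component along the
  vacuum: commuting an annihilating mode to the right never removes the last \<open>x\<close>.\<close>

context
  fixes x
  assumes x: "x \<in> wt 2" "x \<noteq> 0" and ideal: "\<And>v. v \<in> wt 2 \<Longrightarrow> \<exists>s. M v 1 x = s *v x"
    and null: "\<And>v. v \<in> wt 2 \<Longrightarrow> form v x = 0"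
begin

lemma null_word_move:
  assumes IH: "\<And>ws. length ws < Suc (length (xs @ ys)) \<Longrightarrow> fst ` set ws \<subseteq> wt 2 \<Longrightarrow> x \<in> fst ` set ws \<Longrightarrow>
       sum_list (map snd ws) \<ge> 0 \<Longrightarrow> word_op ws vac = 0"
    and "fst ` set (xs @ ys) \<subseteq> wt 2" "u \<in> wt 2" "x = u \<or> x \<in> fst ` set (xs @ ys)" "m \<ge> 0"
    and "m + sum_list (map snd (xs @ ys)) \<ge> 0"
  shows "word_op xs (M u (m + 1) (word_op ys vac)) = 0"
  using assms
proof (induction ys arbitrary: xs)
  case Nil
  then show ?case by (simp add: word_op_simps M_create_zero word_op_linear)
next
  case (Cons a ys)
  obtain v n where a: "a = (v, n)" by (cases a)
  have v: "v \<in> wt 2" and ys: "fst ` set ys \<subseteq> wt 2" and xs: "fst ` set xs \<subseteq> wt 2" using Cons.prems a by auto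
  note IH = Cons.prems(1)
  let ?Y = "word_op ys vac"
  have "word_op (xs @ [a]) (M u (m + 1) ?Y) = 0"
    using Cons.prems by (intro Cons.IH) auto
  then have 1: "word_op xs (M v (n + 1) (M u (m + 1) ?Y)) = 0" by (simp add: a word_op_simps)
  have 2: "word_op xs (M (M u 1 v) (m + n + 1) ?Y) = 0"
  proof (cases "x \<in> fst ` set (xs @ ys)")
    case True
    have "word_op (xs @ (M u 1 v, m + n) # ys) vac = 0"
      using Cons.prems True wt2_1[OF Cons.prems(3) v] a by (intro IH) auto
    then show ?thesis by (simp add: word_op_simps)
  next
    \<comment> \<open>Here \<open>x\<close> is one of the two letters being commuted. Their product
      is a multiple of \<open>x\<close> by \<open>ideal\<close>, so \<open>x\<close> survives in the
      shorter word; below, the scalar term vanishes by \<open>null\<close>.\<close>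
    case False
    then have "x = u \<or> x = v" using Cons.prems(4) a by auto
    then obtain s where s: "M u 1 v = s *v x"
      using ideal[OF v] ideal[OF Cons.prems(3)] product_commute[OF Cons.prems(3) v] by metis
    have "word_op (xs @ (x, m + n) # ys) vac = 0"
      using Cons.prems x a by (intro IH) auto
    then show ?thesis by (simp add: word_op_simps s M_linear word_op_linear)
  qed
  have 3: "word_op xs ((if m + n = 0 then of_int (m ^ 3 - m) / 6 * form u v else 0) *v ?Y) = 0"
  proof (cases "x \<in> fst ` set (xs @ ys)")
    case True
    have "word_op (xs @ ys) vac = 0" if "m + n = 0"
      using Cons.prems True a that by (intro IH) auto
    then show ?thesis by (simp add: word_op_simps word_op_linear)
  next
    case False
    then have "x = u \<or> x = v" using Cons.prems(4) a by auto
    then have "form u v = 0"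
      using null[OF v] null[OF Cons.prems(3)] form_sym[OF Cons.prems(3) v] by auto
    then show ?thesis by (simp add: word_op_linear)
  qed
  have "M u (m + 1) (M v (n + 1) ?Y) = M v (n + 1) (M u (m + 1) ?Y)
     + ((of_int (m - n) / 2) *v M (M u 1 v) (m + n + 1) ?Y
       + (if m + n = 0 then of_int (m ^ 3 - m) / 6 * form u v else 0) *v ?Y)"
    using commutator_wt2[OF Cons.prems(3) v word_op_in[OF ys], of m n] by (simp only: diff_eq_eq add.commute)
  then have "word_op xs (M u (m + 1) (M v (n + 1) ?Y)) = word_op xs (M v (n + 1) (M u (m + 1) ?Y))
     + (word_op xs ((of_int (m - n) / 2) *v M (M u 1 v) (m + n + 1) ?Y)
       + word_op xs ((if m + n = 0 then of_int (m ^ 3 - m) / 6 * form u v else 0) *v ?Y))"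
    by (simp only: word_op_linear(1))
  then have "word_op xs (M u (m + 1) (M v (n + 1) ?Y)) = 0"
    unfolding 1 3 word_op_linear(2)[of xs "of_int (m - n) / 2"] 2 by simp
  then show ?case by (simp add: a word_op_simps)
qed

lemma null_word:
  assumes "fst ` set ws \<subseteq> wt 2" "x \<in> fst ` set ws" "sum_list (map snd ws) \<ge> 0"
  shows "word_op ws vac = 0"
  using assms
proof (induction ws rule: length_induct)
  case (1 ws)
  obtain u m ys where ws: "ws = (u, m) # ys" using 1(3) by (cases ws) auto
  show ?case
  proof (cases "m < 0")
    \<comment> \<open>A first letter with negative index leaves a tail of positive index sum, that
      is, of negative weight.\<close>
    case True
    have "word_op ys vac \<in> wt (- sum_list (map snd ys))"
      using 1(2) ws by (intro word_op_wt) auto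
    moreover have "- sum_list (map snd ys) < 0" using 1(4) ws True by simp
    ultimately have "word_op ys vac = 0" using wt_neg by blast
    then show ?thesis by (simp add: ws word_op_simps M_linear)
  next
    case False
    have "word_op [] (M u (m + 1) (word_op ys vac)) = 0"
      using 1 ws False by (intro null_word_move) auto
    then show ?thesis by (simp add: ws word_op_simps)
  qed
qed

text \<open>The words containing \<open>x\<close> span a nonzero ideal: the stabilizer of their span
  contains \<open>wt 2\<close>, hence everything. Simplicity puts the vacuum into it, but all its
  spanning words of weight at most 0 vanish.\<close>

lemma null_contradiction: False
proof -
  define W where "W = {word_op ws vac | ws. fst ` set ws \<subseteq> wt 2 \<and> x \<in> fst ` set ws}"
  have WC: "span W \<subseteq> C"
    using word_op_in by (intro span_minimal C_subspace) (auto simp: W_def)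
  have "subalg {u \<in> C. \<forall>n. \<forall>w\<in>span W. M u n w \<in> span W}"
    by (rule subalg_stabilizer[OF subspace_span WC])
  moreover have "wt 2 \<subseteq> {u \<in> C. \<forall>n. \<forall>w\<in>span W. M u n w \<in> span W}"
  proof -
    have "M u n w \<in> span W" if u: "u \<in> wt 2" and w: "w \<in> span W" for u n w
      using w
    proof (induction rule: span_induct_alt)
      case base
      show ?case by (simp add: M_linear span_zero)
    next
      case (step s b y)
      then obtain ws where ws: "b = word_op ws vac" "fst ` set ws \<subseteq> wt 2" "x \<in> fst ` set ws"
        by (auto simp: W_def)
      have "M u n b = word_op ((u, n - 1) # ws) vac" by (simp add: ws word_op_simps)
      moreover have "\<dots> \<in> W"
        unfolding W_def by (intro CollectI exI[of _ "(u, n - 1) # ws"]) (use u ws in auto)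
      ultimately have "M u n b \<in> span W" using span_base by metis
      with step show ?case by (simp add: M_linear span_add span_scale)
    qed
    then show ?thesis using wt_in_C by blast
  qed
  ultimately have eq: "{u \<in> C. \<forall>n. \<forall>w\<in>span W. M u n w \<in> span W} = C" by (rule generated)
  have "span W = {0} \<or> span W = C"
    using eq by (intro simple[OF subspace_span WC]) blast
  moreover have "x \<in> span W"
  proof (rule span_base)
    have "x = word_op [(x, -2)] vac" using M_create[OF wt_in_C[OF x(1)]] by (simp add: word_op_simps)
    then show "x \<in> W" unfolding W_def by (intro CollectI exI[of _ "[(x, -2)]"]) (use x in auto)
  qed
  ultimately have "vac \<in> span W" using x vac_in_C by auto
  also have "span W \<subseteq> span (\<Union>n\<in>{1..}. wt n)"
  proof (rule span_minimal[OF _ subspace_span], rule subsetI)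
    fix v assume "v \<in> W"
    then obtain ws where ws: "v = word_op ws vac" "fst ` set ws \<subseteq> wt 2" "x \<in> fst ` set ws"
      by (auto simp: W_def)
    show "v \<in> span (\<Union>n\<in>{1..}. wt n)"
    proof (cases "sum_list (map snd ws) \<ge> 0")
      case True
      then show ?thesis using null_word ws by (simp add: span_zero)
    next
      case False
      then have "v \<in> wt (- sum_list (map snd ws))" "- sum_list (map snd ws) \<ge> 1"
        using word_op_wt ws by auto
      then show ?thesis by (intro span_base) auto
    qed
  qed
  finally show False using vac_notin_positive[OF vac_nz] by blast
qed

end

text \<open>Modulo \<open>om\<close> the second basis vector can be chosen with square a multiple
  \<open>k\<close> of \<open>om\<close>; the two outcomes are \<open>k = 0\<close> and
  \<open>k \<noteq> 0\<close>. In the second one a/2 and b/2 are orthogonal idempotents with sum the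
  identity om/2. In both, \<open>null_contradiction\<close> keeps the relevant values of the form
  away from 0.\<close>

lemma dichotomy:
  obtains (nilpotent) y where "y \<in> wt 2" "y \<noteq> 0" "M y 1 y = 0" "form y y = 0" "form om y = c / 2"
      "wt 2 = {s *v om + t *v y | s t. True}"
  | (idempotents) a b c1 c2 where "a \<in> wt 2" "b \<in> wt 2" "M a 1 a = 2 *v a" "M b 1 b = 2 *v b" "M a 1 b = 0"
      "M b 1 a = 0" "form a b = 0" "form a a = c1 / 2" "form b b = c2 / 2" "c1 \<noteq> 0" "c2 \<noteq> 0"
      "c1 + c2 = c" "om = a + b"
      "wt 2 = {s *v a + t *v b | s t. True}"
proof -
  obtain x where x: "wt 2 = {s *v om + t *v x | s t. True}" "\<And>s t. s *v om + t *v x = 0 \<Longrightarrow> s = 0 \<and> t = 0"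
    using basis_with_om by metis
  have shift: "wt 2 = {s *v om + t *v z | s t. True} \<and> (\<forall>s t. s *v om + t *v z = 0 \<longrightarrow> s = 0 \<and> t = 0)"
    if z: "z = p *v om + q *v x" and q: "q \<noteq> 0" for z p q
  proof (intro conjI allI impI equalityI subsetI)
    fix v assume "v \<in> wt 2"
    then obtain s t where "v = s *v om + t *v x" using x by blast
    then have "v = (s - t * p / q) *v om + (t / q) *v z"
      using q by (simp add: z scale_right_distrib scale_left_diff_distrib)
    then show "v \<in> {s *v om + t *v z | s t. True}" by blast
  next
    fix v assume "v \<in> {s *v om + t *v z | s t. True}"
    then obtain s t where "v = s *v om + t *v z" by blast
    then have "v = (s + t * p) *v om + (t * q) *v x"
      by (simp add: z scale_right_distrib scale_left_distrib)
    then show "v \<in> wt 2" using x by blast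
  next
    fix s t assume "s *v om + t *v z = 0"
    then have "(s + t * p) *v om + (t * q) *v x = 0"
      by (simp add: z scale_right_distrib scale_left_distrib add.assoc)
    from x(2)[OF this] q show "s = 0" "t = 0" by auto
  qed
  have "0 *v om + 1 *v x \<in> wt 2" unfolding x by blast
  then have x2: "x \<in> wt 2" by simp
  obtain p q where pq: "M x 1 x = p *v om + q *v x" using wt2_1[OF x2 x2] x by blast
  \<comment> \<open>Completing the square: as \<open>om\<close> acts as 2, the square of x - r om
    has x-coefficient q - 4 r.\<close>
  define r where "r = q / 4"
  define y where "y = (- r) *v om + 1 *v x"
  note y = shift[OF y_def, simplified]
  have "0 *v om + 1 *v y \<in> wt 2" using y by blast
  then have y2: "y \<in> wt 2" by simp
  have ynz: "y \<noteq> 0"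
  proof
    assume "y = 0"
    with y[THEN conjunct2, rule_format, of 0 1] show False by simp
  qed
  define k where "k = p + 2 * r ^ 2"
  have yy: "M y 1 y = k *v om"
  proof -
    have "M y 1 y = (r * r) *v M om 1 om - r *v M om 1 x - r *v M x 1 om + M x 1 x"
      by (simp add: y_def M_linear scale_right_distrib scale_right_diff_distrib algebra_simps)
    also have "\<dots> = (2 * r * r) *v om - (2 * r) *v x - (2 * r) *v x + (p *v om + q *v x)"
      using x2 by (simp add: om_product om_wt pq mult.commute mult.left_commute)
    also have "\<dots> = k *v om + (q - 4 * r) *v x"
      by (simp add: k_def power2_eq_square scale_left_distrib scale_left_diff_distrib algebra_simps)
        (simp add: scale_left_distrib[symmetric])
    finally show ?thesis by (simp add: r_def)
  qed
  show thesis
  proof (cases "k = 0")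
    case True
    have yy0: "M y 1 y = 0" using yy True by simp
    \<comment> \<open>Invariance gives 0 = (yy, om) = (y, y om) = 2 (y, y).\<close>
    have "form (M y 1 y) om = form y (M y 1 om)" by (rule form_invariant[OF y2 y2 om_wt])
    moreover have "form 0 om = 0" by (rule form_eqI) (simp add: M_linear)
    ultimately have fyy: "form y y = 0" using y2 by (simp add: yy0 om_product form_linear)
    have lin: "\<exists>s. M v 1 y = s *v y" if "v \<in> wt 2" for v
    proof -
      from that y obtain s t where "v = s *v om + t *v y" by blast
      then have "M v 1 y = (s * 2) *v y" using y2 by (simp add: M_linear om_product yy0)
      then show ?thesis by blast
    qed
    \<comment> \<open>Otherwise \<open>y\<close>, which spans an ideal, would be orthogonal to both
      basis vectors.\<close>
    have f0: "form om y \<noteq> 0"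
    proof
      assume "form om y = 0"
      then have "form v y = 0" if "v \<in> wt 2" for v
      proof -
        from that y obtain s t where "v = s *v om + t *v y" by blast
        with \<open>form om y = 0\<close> y2 fyy show ?thesis
          by (simp add: form_linear om_wt subspace_scale[OF subspace_wt])
      qed
      from null_contradiction[OF y2 ynz lin this] show False .
    qed
    \<comment> \<open>The scale at which [L_m, W_n] has the same central term as [L_m, L_n].\<close>
    define d where "d = c / 2 / form om y"
    define z where "z = d *v y"
    have dnz: "d \<noteq> 0" using c_nz f0 by (simp add: d_def)
    have zeq: "z = (- d * r) *v om + d *v x" by (simp add: z_def y_def scale_right_distrib scale_right_diff_distrib)
    note z = shift[OF zeq dnz]
    show thesis
    proof (rule nilpotent)
      show "z \<in> wt 2" using y2 by (simp add: z_def subspace_scale[OF subspace_wt])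
      show "z \<noteq> 0" using ynz dnz by (simp add: z_def)
      show "M z 1 z = 0" by (simp add: z_def M_linear yy0)
      show "form z z = 0" using y2 by (simp add: z_def form_linear fyy subspace_scale[OF subspace_wt])
      show "form om z = c / 2" using y2 f0 by (simp add: z_def form_linear om_wt d_def)
    qed (use z in auto)
  next
    case False
    \<comment> \<open>With this value the vector \<tau> y has square 2 om, so the squares of
      \<open>a\<close> and \<open>b\<close> below are 2 a and 2 b, and their product is 0.\<close>
    define \<tau> where "\<tau> = csqrt (2 / k)"
    have tk: "\<tau> * \<tau> * k = 2" using False power2_csqrt[of "2 / k"] by (simp add: \<tau>_def power2_eq_square)
    have tnz: "\<tau> \<noteq> 0" using tk by auto
    define a where "a = (1 / 2) *v om + (\<tau> / 2) *v y"
    define b where "b = (1 / 2) *v om - (\<tau> / 2) *v y"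
    have a2: "a \<in> wt 2" and b2: "b \<in> wt 2"
      using om_wt y2 by (simp_all add: a_def b_def subspace_add[OF subspace_wt] subspace_diff[OF subspace_wt]
          subspace_scale[OF subspace_wt])
    have half: "(1 / 2) *v v + (1 / 2) *v v = v" for v
      using scale_left_distrib[of "1/2" "1/2" v] by simp
    have omab: "om = a + b" by (simp add: a_def b_def half)
    have prod: "M (s *v om + t *v y) 1 (s' *v om + t' *v y)
       = (2 * s * s' + t * t' * k) *v om + (2 * s * t' + 2 * s' * t) *v y" for s t s' t'
      using y2 by (simp add: M_linear om_product om_wt yy scale_right_distrib scale_left_distrib algebra_simps)
    have a': "a = (1/2) *v om + (\<tau>/2) *v y" and b': "b = (1/2) *v om + (- (\<tau>/2)) *v y"
      by (simp_all add: a_def b_def)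
    have k': "\<tau> / 2 * (\<tau> / 2) * k = 1 / 2"
    proof -
      have "\<tau> / 2 * (\<tau> / 2) * k = (\<tau> * \<tau> * k) / 4" by simp
      then show ?thesis by (simp only: tk) simp
    qed
    have two: "2 *v ((1/2) *v om + s *v y) = 1 *v om + (2 * s) *v y" for s by (simp add: scale_right_distrib)
    have aa: "M a 1 a = 2 *v a" unfolding a' prod two k' by simp
    have bb: "M b 1 b = 2 *v b" unfolding b' prod two minus_mult_minus k' by simp
    have ab: "M a 1 b = 0" unfolding a' b' prod mult_minus_right mult_minus_left k' by simp
    have ba: "M b 1 a = 0" using product_commute[OF a2 b2] ab by simp
    have "form (M a 1 a) b = form a (M a 1 b)" by (rule form_invariant[OF a2 a2 b2])
    moreover have "form a 0 = 0" by (rule form_eqI) (simp add: M_linear)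
    ultimately have fab: "form a b = 0" using a2 b2 by (simp add: aa ab form_linear)
    have fba: "form b a = 0" using form_sym[OF a2 b2] fab by simp
    have sp: "wt 2 = {s *v a + t *v b | s t. True}"
    proof (intro equalityI subsetI)
      fix v assume "v \<in> wt 2"
      then obtain s t where v: "v = s *v om + t *v y" using y by blast
      \<comment> \<open>As om = a + b and \<tau> y = a - b, the term t y contributes t/\<tau> to the
        coefficient of \<open>a\<close> and its negative to that of \<open>b\<close>.\<close>
      define r' where "r' = t / \<tau>"
      have r': "r' * \<tau> = t" using tnz by (simp add: r'_def)
      have "(s + r') *v a + (s - r') *v b
         = ((s + r') * (1 / 2) + (s - r') * (1 / 2)) *v om + ((s + r') * (\<tau> / 2) - (s - r') * (\<tau> / 2)) *v y"
        by (simp only: a_def b_def scale_right_distrib scale_left_distrib scale_right_diff_distrib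
            scale_left_diff_distrib scale_scale) (simp only: add.assoc add.left_commute diff_conv_add_uminus minus_add_distrib minus_minus add.commute)
      moreover have "(s + r') * (1 / 2) + (s - r') * (1 / 2) = s" by (simp add: field_simps)
      moreover have "(s + r') * (\<tau> / 2) - (s - r') * (\<tau> / 2) = r' * \<tau>" by (simp add: field_simps)
      ultimately have "v = (s + r') *v a + (s - r') *v b" by (simp add: v r')
      then show "v \<in> {s *v a + t *v b | s t. True}" by blast
    qed (use a2 b2 in \<open>auto simp: subspace_add[OF subspace_wt] subspace_scale[OF subspace_wt]\<close>)
    have anz: "a \<noteq> 0" "b \<noteq> 0"
    proof -
      show "a \<noteq> 0" using y[THEN conjunct2, rule_format, of "1/2" "\<tau>/2"] by (auto simp: a')
      show "b \<noteq> 0" using y[THEN conjunct2, rule_format, of "1/2" "- (\<tau>/2)"] unfolding b' by auto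
    qed
    \<comment> \<open>\<open>a\<close> spans an ideal and is orthogonal to \<open>b\<close>, so an
      isotropic \<open>a\<close> would be in the radical.\<close>
    have fa: "form a a \<noteq> 0"
    proof
      assume 0: "form a a = 0"
      have "\<exists>s. M v 1 a = s *v a" "form v a = 0" if "v \<in> wt 2" for v
      proof -
        from that sp obtain s t where v: "v = s *v a + t *v b" by blast
        have "M v 1 a = (s * 2) *v a" by (simp add: v M_linear aa ba)
        then show "\<exists>s. M v 1 a = s *v a" by blast
        show "form v a = 0"
          using a2 b2 by (simp add: v form_linear 0 fba subspace_scale[OF subspace_wt])
      qed
      from null_contradiction[OF a2 anz(1) this] show False .
    qed
    have fb: "form b b \<noteq> 0"
    proof
      assume 0: "form b b = 0"
      have "\<exists>s. M v 1 b = s *v b" "form v b = 0" if "v \<in> wt 2" for v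
      proof -
        from that sp obtain s t where v: "v = s *v a + t *v b" by blast
        have "M v 1 b = (t * 2) *v b" by (simp add: v M_linear bb ab)
        then show "\<exists>s. M v 1 b = s *v b" by blast
        show "form v b = 0"
          using a2 b2 by (simp add: v form_linear 0 fab subspace_scale[OF subspace_wt])
      qed
      from null_contradiction[OF b2 anz(2) this] show False .
    qed
    have sum: "2 * form a a + 2 * form b b = c"
    proof -
      have "form (a + b) (a + b) = form a a + form b b"
        using a2 b2 by (simp add: form_linear subspace_add[OF subspace_wt] fab fba)
      then show ?thesis using form_om_om omab by (simp add: mult.commute)
    qed
    show thesis
      by (rule idempotents[of a b "2 * form a a" "2 * form b b"])
        (use a2 b2 aa bb ab ba fab fa fb sum omab sp in auto)
  qed
qed

end

section \<open>Copies of a vertex operator algebra\<close>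

text \<open>Used for V itself with \<open>om\<close> and for the vacuum orbit of one Virasoro
  algebra with its own conformal vector. That \<open>om'\<close> and \<open>om\<close> have the same
  modes 0 and 1 on \<open>E\<close> means that both induce the same translation operator and the
  same grading there, although the central charges may differ.\<close>

locale sub_model = voa_model +
  fixes E :: "'a set" and om' :: 'a and c' :: complex
  assumes E_subalg: "subalg E" and om'_in: "om' \<in> E"
    and om'_1: "v \<in> E \<Longrightarrow> M om' 1 v = M om 1 v"
    and om'_0: "v \<in> E \<Longrightarrow> M om' 0 v = M om 0 v"
    and om'_virasoro: "v \<in> E \<Longrightarrow> M om' (m + 1) (M om' (n + 1) v) - M om' (n + 1) (M om' (m + 1) v)
      = of_int (m - n) *v M om' (m + n + 1) v + (if m + n = 0 then of_int (m ^ 3 - m) / 12 * c' else 0) *v v"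
    and E_graded: "v \<in> E \<Longrightarrow> \<exists>S f. finite S \<and> (\<forall>n\<in>S. f n \<in> E \<inter> wt n) \<and> v = (\<Sum>n\<in>S. f n)"
    and wt_finite_dim: "\<exists>B. finite B \<and> wt n \<subseteq> span B"
    and wt_bounded: "\<exists>N. \<forall>n<N. wt n = {0}"
begin

lemma E_subspace: "subspace E" and E_sub: "E \<subseteq> C" and vac_in_E: "vac \<in> E"
  and M_in_E: "u \<in> E \<Longrightarrow> v \<in> E \<Longrightarrow> M u n v \<in> E"
  using E_subalg by (auto simp: subalg_def)

lemmas E_closed = subspace_0[OF E_subspace] subspace_add[OF E_subspace] subspace_scale[OF E_subspace]
  subspace_diff[OF E_subspace] subspace_neg[OF E_subspace] M_in_E vac_in_E om'_in

end

lemma complex_field_simps [simp]: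
  "carrier complex_field = UNIV" "x \<otimes>\<^bsub>complex_field\<^esub> y = x * y" "x \<oplus>\<^bsub>complex_field\<^esub> y = x + y"
  "\<one>\<^bsub>complex_field\<^esub> = 1" "\<zero>\<^bsub>complex_field\<^esub> = 0"
  by (simp_all add: ring_of_type_algebra_def)

lemma cring_complex_field: "cring complex_field" by (rule cring_from_type_algebra)

text \<open>Transport of structure along the bijection \<open>\<kappa>\<close>, so that the axioms
  are verified on a carrier set once, for an arbitrary copy of \<open>E\<close>.\<close>

locale voa_copy = sub_model +
  fixes U :: "('u, 'm) voa_scheme" and \<kappa> :: "'a \<Rightarrow> 'u"
  assumes inj: "inj_on \<kappa> E" and carrier_U: "carrier U = \<kappa> ` E" and zero_U: "\<zero>\<^bsub>U\<^esub> = \<kappa> 0"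
    and add_U: "v \<in> E \<Longrightarrow> w \<in> E \<Longrightarrow> \<kappa> v \<oplus>\<^bsub>U\<^esub> \<kappa> w = \<kappa> (v + w)"
    and smult_U: "v \<in> E \<Longrightarrow> s \<odot>\<^bsub>U\<^esub> \<kappa> v = \<kappa> (s *v v)"
    and mode_U: "u \<in> E \<Longrightarrow> v \<in> E \<Longrightarrow> mode U (\<kappa> u) n (\<kappa> v) = \<kappa> (M u n v)"
    and vacuum_U: "vacuum U = \<kappa> vac" and conformal_U: "conformal U = \<kappa> om'"
begin

lemma \<kappa>_eq: "v \<in> E \<Longrightarrow> w \<in> E \<Longrightarrow> \<kappa> v = \<kappa> w \<longleftrightarrow> v = w"
  using inj by (auto dest: inj_onD)

lemma abelian_group_U: "abelian_group U"
proof (rule abelian_groupI)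
  show "x \<oplus>\<^bsub>U\<^esub> y \<in> carrier U" if "x \<in> carrier U" "y \<in> carrier U" for x y
    using that by (auto simp: carrier_U add_U E_closed)
  show "\<zero>\<^bsub>U\<^esub> \<in> carrier U" by (simp add: zero_U carrier_U E_closed)
  show "x \<oplus>\<^bsub>U\<^esub> y \<oplus>\<^bsub>U\<^esub> z = x \<oplus>\<^bsub>U\<^esub> (y \<oplus>\<^bsub>U\<^esub> z)" if "x \<in> carrier U" "y \<in> carrier U" "z \<in> carrier U" for x y z
    using that by (auto simp: carrier_U add_U E_closed add.assoc)
  show "x \<oplus>\<^bsub>U\<^esub> y = y \<oplus>\<^bsub>U\<^esub> x" if "x \<in> carrier U" "y \<in> carrier U" for x y
    using that by (auto simp: carrier_U add_U E_closed add.commute)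
  show "\<zero>\<^bsub>U\<^esub> \<oplus>\<^bsub>U\<^esub> x = x" if "x \<in> carrier U" for x
    using that by (auto simp: carrier_U add_U zero_U E_closed)
  show "\<exists>y\<in>carrier U. y \<oplus>\<^bsub>U\<^esub> x = \<zero>\<^bsub>U\<^esub>" if x: "x \<in> carrier U" for x
  proof -
    obtain v where v: "v \<in> E" "x = \<kappa> v" using x by (auto simp: carrier_U)
    then have "\<kappa> (- v) \<oplus>\<^bsub>U\<^esub> x = \<zero>\<^bsub>U\<^esub>" "\<kappa> (- v) \<in> carrier U"
      by (simp_all add: add_U zero_U E_closed carrier_U)
    then show ?thesis by blast
  qed
qed

lemma module_U: "module complex_field U"
proof (intro module.intro module_axioms.intro cring_complex_field abelian_group_U)
qed (auto simp: carrier_U add_U smult_U E_closed scale_left_distrib scale_right_distrib)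

interpretation U: module complex_field U by (rule module_U)

lemma minus_U: "v \<in> E \<Longrightarrow> \<ominus>\<^bsub>U\<^esub> \<kappa> v = \<kappa> (- v)"
  by (rule U.minus_equality) (auto simp: add_U zero_U E_closed carrier_U)

lemma diff_U: "v \<in> E \<Longrightarrow> w \<in> E \<Longrightarrow> \<kappa> v \<ominus>\<^bsub>U\<^esub> \<kappa> w = \<kappa> (v - w)"
  by (simp add: a_minus_def minus_U add_U E_closed)

lemma finsum_U:
  "(\<And>i. i \<in> A \<Longrightarrow> f i \<in> E) \<Longrightarrow> finsum U (\<lambda>i. \<kappa> (f i)) A = \<kappa> (sum f A)"
proof (induction A rule: infinite_finite_induct)
  case (infinite A)
  then show ?case by (simp add: finsum_def finprod_def zero_U)
next
  case empty
  then show ?case by (simp add: zero_U)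
next
  case (insert i A)
  then have "sum f A \<in> E" using E_subspace by (intro subspace_sum) auto
  with insert show ?case by (subst U.finsum_insert) (auto simp: carrier_U add_U)
qed

lemma fsum_U:
  assumes "\<And>i. f i \<in> E" "\<And>i. i \<ge> N \<Longrightarrow> f i = 0"
  shows "fsum U (\<lambda>i. \<kappa> (f i)) = \<kappa> (\<Sum>i<N. f i)"
proof -
  have "fsum U (\<lambda>i. \<kappa> (f i)) = gfinprod (add_monoid U) (\<lambda>i. \<kappa> (f i)) {..<N}"
    using assms by (intro U.add.gfinprod_mono_neutral_cong_right) (auto simp: carrier_U zero_U)
  also have "\<dots> = finsum U (\<lambda>i. \<kappa> (f i)) {..<N}"
    using assms(1) by (intro U.add.gfinprod_eq_finprod) (auto simp: carrier_U)
  also have "\<dots> = \<kappa> (\<Sum>i<N. f i)" using assms by (intro finsum_U) auto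
  finally show ?thesis .
qed

lemma weight_space_U: "weight_space U n = \<kappa> ` (E \<inter> wt n)"
proof -
  have "vir_op U 0 (\<kappa> v) = of_int n \<odot>\<^bsub>U\<^esub> \<kappa> v \<longleftrightarrow> v \<in> wt n" if "v \<in> E" for v
  proof -
    have "M om 1 v \<in> E" using om'_1[OF that] E_closed(6)[OF om'_in that] by metis
    then show ?thesis
      using that E_sub by (auto simp: vir_op_def conformal_U mode_U smult_U E_closed \<kappa>_eq om'_1 wt_def)
  qed
  then show ?thesis by (auto simp: weight_space_def carrier_U)
qed

lemma vsubspace_U: "subspace W \<Longrightarrow> W \<subseteq> E \<Longrightarrow> vsubspace U (\<kappa> ` W)"
proof (rule U.submoduleI)
  assume W: "subspace W" "W \<subseteq> E"
  show "\<kappa> ` W \<subseteq> carrier U" using W by (auto simp: carrier_U)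
  show "\<zero>\<^bsub>U\<^esub> \<in> \<kappa> ` W" using W by (auto simp: zero_U subspace_0)
  show "\<ominus>\<^bsub>U\<^esub> a \<in> \<kappa> ` W" if "a \<in> \<kappa> ` W" for a
  proof -
    obtain v where v: "v \<in> W" "a = \<kappa> v" using \<open>a \<in> \<kappa> ` W\<close> by blast
    then have "\<ominus>\<^bsub>U\<^esub> a = \<kappa> (- v)" "- v \<in> W" using minus_U W subspace_neg[OF W(1)] by auto
    then show ?thesis by blast
  qed
  show "a \<oplus>\<^bsub>U\<^esub> b \<in> \<kappa> ` W" if a: "a \<in> \<kappa> ` W" and b: "b \<in> \<kappa> ` W" for a b
  proof -
    obtain v w where v: "v \<in> W" "a = \<kappa> v" "w \<in> W" "b = \<kappa> w" using a b by blast
    then have "a \<oplus>\<^bsub>U\<^esub> b = \<kappa> (v + w)" "v + w \<in> W" using add_U W subspace_add[OF W(1)] by auto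
    then show ?thesis by blast
  qed
  show "s \<odot>\<^bsub>U\<^esub> a \<in> \<kappa> ` W" if a: "a \<in> \<kappa> ` W" for s a
  proof -
    obtain v where v: "v \<in> W" "a = \<kappa> v" using a by blast
    then have "s \<odot>\<^bsub>U\<^esub> a = \<kappa> (s *v v)" "s *v v \<in> W" using smult_U W subspace_scale[OF W(1)] by auto
    then show ?thesis by blast
  qed
qed

lemma has_dim_U:
  assumes W: "subspace W" "W \<subseteq> E" and B: "finite B" "W \<subseteq> span B"
  shows "\<exists>d. has_dim U (\<kappa> ` W) d"
proof -
  obtain A where A: "A \<subseteq> W" "independent A" "W \<subseteq> span A"
    using maximal_independent_subset[of W] by blast
  have finA: "finite A" using independent_span_bound[OF B(1) A(2)] A(1) B(2) by auto
  have AE: "A \<subseteq> E" using A W by blast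
  then have injA: "inj_on \<kappa> A" using inj by (rule inj_on_subset[rotated])
  have comb: "(\<Oplus>\<^bsub>U\<^esub>b\<in>\<kappa> ` A. f b \<odot>\<^bsub>U\<^esub> b) = \<kappa> (\<Sum>a\<in>A. f (\<kappa> a) *v a)" for f
  proof -
    have "(\<Oplus>\<^bsub>U\<^esub>b\<in>\<kappa> ` A. f b \<odot>\<^bsub>U\<^esub> b) = (\<Oplus>\<^bsub>U\<^esub>a\<in>A. f (\<kappa> a) \<odot>\<^bsub>U\<^esub> \<kappa> a)"
      using AE injA by (intro U.finsum_reindex) (auto simp: carrier_U smult_U E_closed)
    also have "\<dots> = (\<Oplus>\<^bsub>U\<^esub>a\<in>A. \<kappa> (f (\<kappa> a) *v a))"
      using AE by (intro U.finsum_cong') (auto simp: carrier_U smult_U E_closed subset_iff)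
    also have "\<dots> = \<kappa> (\<Sum>a\<in>A. f (\<kappa> a) *v a)" using AE by (intro finsum_U) (auto intro: E_closed)
    finally show ?thesis .
  qed
  have sumE: "(\<Sum>a\<in>A. g a *v a) \<in> E" for g
    using AE by (intro subspace_sum[OF E_subspace]) (auto intro: E_closed)
  have "is_basis U (\<kappa> ` W) (\<kappa> ` A)"
    unfolding is_basis_def
  proof (intro conjI ballI)
    show "\<kappa> ` A \<subseteq> \<kappa> ` W" using A by blast
    show "finite (\<kappa> ` A)" using finA by blast
    fix x assume "x \<in> \<kappa> ` W"
    then obtain w where w: "w \<in> W" "x = \<kappa> w" by blast
    then obtain g where g: "w = (\<Sum>a\<in>A. g a *v a)"
      using A(3) by (auto simp: span_finite[OF finA])
    define f where "f = restrict (\<lambda>b. g (inv_into A \<kappa> b)) (\<kappa> ` A)"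
    \<comment> \<open>The restriction in the definition of \<open>f\<close> is there because
      \<open>is_basis\<close> asks for uniqueness among extensional functions.\<close>
    have f: "f (\<kappa> a) = g a" if "a \<in> A" for a using that injA by (simp add: f_def)
    show "\<exists>!f. f \<in> \<kappa> ` A \<rightarrow>\<^sub>E UNIV \<and> x = (\<Oplus>\<^bsub>U\<^esub>b\<in>\<kappa> ` A. f b \<odot>\<^bsub>U\<^esub> b)"
    proof (rule ex1I[of _ f])
      show "f \<in> \<kappa> ` A \<rightarrow>\<^sub>E UNIV \<and> x = (\<Oplus>\<^bsub>U\<^esub>b\<in>\<kappa> ` A. f b \<odot>\<^bsub>U\<^esub> b)"
        unfolding comb w(2) g by (auto simp: f_def injA intro!: arg_cong[of _ _ \<kappa>] sum.cong)
      fix h assume h: "h \<in> \<kappa> ` A \<rightarrow>\<^sub>E UNIV \<and> x = (\<Oplus>\<^bsub>U\<^esub>b\<in>\<kappa> ` A. h b \<odot>\<^bsub>U\<^esub> b)"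
      then have "\<kappa> (\<Sum>a\<in>A. h (\<kappa> a) *v a) = \<kappa> (\<Sum>a\<in>A. g a *v a)"
        unfolding comb w(2) g by (elim conjE) (rule sym)
      then have "(\<Sum>a\<in>A. h (\<kappa> a) *v a) = (\<Sum>a\<in>A. g a *v a)"
        by (rule iffD1[OF \<kappa>_eq[OF sumE sumE]])
      then have z: "(\<Sum>a\<in>A. (h (\<kappa> a) - g a) *v a) = 0"
        by (simp add: scale_left_diff_distrib sum_subtractf)
      have "h (\<kappa> a) - g a = 0" if "a \<in> A" for a
        by (rule independentD[OF A(2) finA subset_refl z that])
      then have "h b = f b" if "b \<in> \<kappa> ` A" for b using that f by auto
      then show "h = f" using h by (intro PiE_ext[of h "\<kappa> ` A" "\<lambda>_. UNIV" f]) (auto simp: f_def)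
    qed
  qed
  moreover have "vsubspace U (\<kappa> ` W)" by (rule vsubspace_U[OF W])
  ultimately show ?thesis unfolding has_dim_def by blast
qed

lemma M_eventually_zero: "\<exists>N. \<forall>i\<ge>N. M u (n + int i) v = 0"
proof -
  obtain N where "\<forall>k\<ge>N. M u k v = 0" using M_truncation by blast
  then have "\<forall>i\<ge>nat (N - n). M u (n + int i) v = 0" by auto
  then show ?thesis by blast
qed

lemma voa_U: "vertex_operator_algebra U c'"
proof (intro vertex_operator_algebra.intro module_U vertex_operator_algebra_axioms.intro)
  fix u v w and n m l :: int
  assume "u \<in> carrier U" "v \<in> carrier U" "w \<in> carrier U"
  then obtain u' v' w' where uvw: "u' \<in> E" "u = \<kappa> u'" "v' \<in> E" "v = \<kappa> v'" "w' \<in> E" "w = \<kappa> w'"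
    by (auto simp: carrier_U)
  let ?f = "\<lambda>i. (of_int m gchoose i) *v M (M u' (l + int i) v') (m + n - int i) w'"
  let ?g = "\<lambda>i. ((-1) ^ i * (of_int l gchoose i)) *v
            (M u' (m + l - int i) (M v' (n + int i) w')
             - ((-1) powi l) *v M v' (n + l - int i) (M u' (m + int i) w'))"
  have f: "(\<lambda>i. (of_int m gchoose i) \<odot>\<^bsub>U\<^esub> mode U (mode U u (l + int i) v) (m + n - int i) w) = (\<lambda>i. \<kappa> (?f i))"
    using uvw by (simp add: mode_U smult_U E_closed)
  have g: "(\<lambda>i. ((-1) ^ i * (of_int l gchoose i)) \<odot>\<^bsub>U\<^esub>
            (mode U u (m + l - int i) (mode U v (n + int i) w)
             \<ominus>\<^bsub>U\<^esub> ((-1) powi l) \<odot>\<^bsub>U\<^esub> mode U v (n + l - int i) (mode U u (m + int i) w))) = (\<lambda>i. \<kappa> (?g i))"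
    using uvw by (simp add: mode_U smult_U diff_U E_closed)
  obtain N1 where N1: "\<forall>i\<ge>N1. M u' (l + int i) v' = 0" using M_eventually_zero by blast
  obtain N2 where N2: "\<forall>i\<ge>N2. M v' (n + int i) w' = 0" using M_eventually_zero by blast
  obtain N3 where N3: "\<forall>i\<ge>N3. M u' (m + int i) w' = 0" using M_eventually_zero by blast
  obtain N4 where N4: "\<forall>K\<ge>N4. sum ?f {..<K} = sum ?g {..<K}" using M_borcherds by blast
  \<comment> \<open>Past the first three bounds all terms of both sums vanish, and from
    \<open>N4\<close> on the partial sums agree.\<close>
  define N where "N = max (max N1 N2) (max N3 N4)"
  have "fsum U (\<lambda>i. \<kappa> (?f i)) = \<kappa> (sum ?f {..<N})"
    using uvw N1 by (intro fsum_U) (auto intro!: E_closed simp: N_def M_linear)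
  also have "sum ?f {..<N} = sum ?g {..<N}" using N4 by (simp add: N_def)
  also have "\<kappa> (sum ?g {..<N}) = fsum U (\<lambda>i. \<kappa> (?g i))"
    using uvw N2 N3 by (intro fsum_U[symmetric]) (auto intro!: E_closed simp: N_def M_linear)
  finally show "fsum U (\<lambda>i. (of_int m gchoose i) \<odot>\<^bsub>U\<^esub> mode U (mode U u (l + int i) v) (m + n - int i) w)
      = fsum U (\<lambda>i. ((-1) ^ i * (of_int l gchoose i)) \<odot>\<^bsub>U\<^esub>
            (mode U u (m + l - int i) (mode U v (n + int i) w)
             \<ominus>\<^bsub>U\<^esub> ((-1) powi l) \<odot>\<^bsub>U\<^esub> mode U v (n + l - int i) (mode U u (m + int i) w)))"
    unfolding f g .
next
  fix u v assume uv: "u \<in> carrier U" "v \<in> carrier U"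
  then obtain u' v' where uv': "u' \<in> E" "u = \<kappa> u'" "v' \<in> E" "v = \<kappa> v'"
    by (auto simp: carrier_U)
  obtain N where "\<forall>n\<ge>N. M u' n v' = 0" using M_truncation by blast
  then have "\<forall>n\<ge>N. mode U u n v = \<zero>\<^bsub>U\<^esub>" using uv' by (simp add: mode_U zero_U)
  then show "\<exists>N. \<forall>n\<ge>N. mode U u n v = \<zero>\<^bsub>U\<^esub>" by blast
  show "mode U (vir_op U (-1) u) n v = (- of_int n) \<odot>\<^bsub>U\<^esub> mode U u (n - 1) v" for n
  proof -
    have "M (M om' 0 u') n v' = (- of_int n) *v M u' (n - 1) v'"
      by (simp only: om'_0[OF uv'(1)] M_translation)
    with uv' show ?thesis by (simp add: vir_op_def conformal_U mode_U smult_U E_closed)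
  qed
next
  fix v assume "v \<in> carrier U"
  then obtain v' where v: "v' \<in> E" "v = \<kappa> v'" by (auto simp: carrier_U)
  then have vC: "v' \<in> C" using E_sub by blast
  show "mode U (vacuum U) n v = (if n = -1 then v else \<zero>\<^bsub>U\<^esub>)" for n
    using v vC by (simp add: vacuum_U mode_U E_closed M_vac zero_U)
  show "mode U v (-1) (vacuum U) = v"
    using v vC by (simp add: vacuum_U mode_U E_closed M_create)
  show "mode U v n (vacuum U) = \<zero>\<^bsub>U\<^esub>" if "n \<ge> 0" for n
    using v that by (simp add: vacuum_U mode_U E_closed M_create_zero zero_U)
  show "vir_op U m (vir_op U n v) \<ominus>\<^bsub>U\<^esub> vir_op U n (vir_op U m v)
        = of_int (m - n) \<odot>\<^bsub>U\<^esub> vir_op U (m + n) v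
          \<oplus>\<^bsub>U\<^esub> (if m + n = 0 then of_int (m ^ 3 - m) / 12 * c' else 0) \<odot>\<^bsub>U\<^esub> v" for m n
    using v om'_virasoro[OF v(1), of m n]
    by (simp only: vir_op_def conformal_U mode_U smult_U diff_U add_U E_closed)
  obtain S f where S: "finite S" "\<forall>n\<in>S. f n \<in> E \<inter> wt n" "v' = (\<Sum>n\<in>S. f n)"
    using E_graded[OF v(1)] by blast
  have "finsum U (\<lambda>n. \<kappa> (f n)) S = \<kappa> (sum f S)" using S by (intro finsum_U) auto
  then show "\<exists>S f. finite S \<and> (\<forall>n\<in>S. f n \<in> weight_space U n) \<and> v = (\<Oplus>\<^bsub>U\<^esub>n\<in>S. f n)"
    using S v by (intro exI[of _ S] exI[of _ "\<lambda>n. \<kappa> (f n)"]) (auto simp: weight_space_U)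
next
  show "\<exists>d. has_dim U (weight_space U n) d" for n
  proof -
    obtain B where "finite B" "wt n \<subseteq> span B" using wt_finite_dim by blast
    then show ?thesis unfolding weight_space_U
      by (intro has_dim_U subspace_inter E_subspace subspace_wt) auto
  qed
  obtain N where "\<forall>n<N. wt n = {0}" using wt_bounded by blast
  then have "\<forall>n<N. weight_space U n = {\<zero>\<^bsub>U\<^esub>}"
    using subspace_0[OF E_subspace] by (simp add: weight_space_U zero_U)
  then show "\<exists>N. \<forall>n<N. weight_space U n = {\<zero>\<^bsub>U\<^esub>}" by blast
qed (auto simp: carrier_U mode_U add_U smult_U E_closed M_linear vacuum_U conformal_U)

end

section \<open>Irreducible highest weight modules\<close>

context voa_copy begin

lemma subspace_vimage_U:
  assumes "vsubspace U A"
  shows "subspace {v \<in> E. \<kappa> v \<in> A}"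
proof -
  interpret U: module complex_field U by (rule module_U)
  interpret A: submodule A complex_field U by fact
  have 0: "\<kappa> 0 \<in> A" using A.one_closed by (simp add: zero_U)
  have add: "\<kappa> (v + w) \<in> A" if "v \<in> E" "w \<in> E" "\<kappa> v \<in> A" "\<kappa> w \<in> A" for v w
    using A.m_closed[of "\<kappa> v" "\<kappa> w"] that by (simp add: add_U)
  have scale: "\<kappa> (s *v v) \<in> A" if "v \<in> E" "\<kappa> v \<in> A" for s v
    using A.smult_closed[of s "\<kappa> v"] that by (simp add: smult_U)
  show ?thesis unfolding subspace_def using 0 add scale by (auto simp: E_closed)
qed

lemma generated_by_U:
  assumes "W \<subseteq> E" and gen: "\<And>A. subalg A \<Longrightarrow> W \<subseteq> A \<Longrightarrow> A \<subseteq> E \<Longrightarrow> A = E"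
  shows "generated_by U (\<kappa> ` W)"
  unfolding generated_by_def
proof (intro conjI allI impI)
  show "\<kappa> ` W \<subseteq> carrier U" using assms by (auto simp: carrier_U)
  fix A assume A: "vertex_subalgebra U A \<and> \<kappa> ` W \<subseteq> A"
  have cl: "mode U u n v \<in> A" if "u \<in> A" "v \<in> A" for u v n
    using A that by (simp add: vertex_subalgebra_def)
  have "subalg {v \<in> E. \<kappa> v \<in> A}"
    unfolding subalg_def
  proof (intro conjI ballI allI)
    show "subspace {v \<in> E. \<kappa> v \<in> A}"
      using A by (intro subspace_vimage_U) (simp add: vertex_subalgebra_def)
    show "{v \<in> E. \<kappa> v \<in> A} \<subseteq> C" using E_sub by blast
    show "vac \<in> {v \<in> E. \<kappa> v \<in> A}" using A by (simp add: vertex_subalgebra_def E_closed vacuum_U)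
    show "M u n v \<in> {v \<in> E. \<kappa> v \<in> A}" if "u \<in> {v \<in> E. \<kappa> v \<in> A}" "v \<in> {v \<in> E. \<kappa> v \<in> A}" for u v n
      using that cl[of "\<kappa> u" "\<kappa> v" n] by (simp add: E_closed mode_U)
  qed
  then have "{v \<in> E. \<kappa> v \<in> A} = E" using A assms(1) by (intro gen) auto
  then have "\<kappa> ` E \<subseteq> A" by blast
  moreover have "A \<subseteq> carrier U"
    using A subgroup.subset[of A "add_monoid U"] by (simp add: vertex_subalgebra_def submodule_def)
  ultimately show "A = carrier U" by (simp add: carrier_U)
qed

end

text \<open>Two descriptions of one space: as a vertex subalgebra \<open>E\<close> and as the vacuum
  orbit of the operators \<open>op\<close>. The assumption \<open>irr\<close> says that the second
  is the irreducible quotient.\<close>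

locale irr_model =
  sub_model scale M C vac om c E om' c' + hw_rep scale op br S deg d0 D vac
  for scale :: "complex \<Rightarrow> 'a::ab_group_add \<Rightarrow> 'a" (infixr "*v" 75) and M C vac om c E om' c'
    and op :: "'g \<Rightarrow> 'a \<Rightarrow> 'a" and br :: "'g \<Rightarrow> 'g \<Rightarrow> ('g \<Rightarrow>\<^sub>0 complex)" and S deg d0 D +
  assumes E_eq: "E = range (\<lambda>p. act p vac)"
    and irr: "irr_ideal br S = {p. act p vac = 0}"
begin

definition fib :: "'a \<Rightarrow> 'g free_alg set" where "fib v = {p. act p vac = v}"

definition ev :: "'g free_alg set \<Rightarrow> 'a" where "ev A = act (SOME p. p \<in> A) vac"

text \<open>An extension of \<open>irr_module\<close> itself, because \<open>is_Vir_voa\<close> and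
  \<open>is_W22_voa\<close> require its truncation to be equal, not just isomorphic, to that
  module.\<close>

definition irr_voa :: "'g free_alg set voa" where
  "irr_voa = module.extend (irr_module br S)
     (voa.fields (\<lambda>A n B. fib (M (ev A) n (ev B))) (fib vac) (fib om'))"

lemma coset_eq: "coset (irr_ideal br S) p = fib (act p vac)"
proof -
  have "q \<in> coset (irr_ideal br S) p" if "q \<in> fib (act p vac)" for q
    unfolding coset_def irr
    by (intro CollectI exI[of _ "q - p"]) (use that in \<open>simp add: act_diff fib_def\<close>)
  then show ?thesis by (auto simp: coset_def irr act_add fib_def)
qed

lemma fib_nonempty: "v \<in> E \<Longrightarrow> \<exists>p. p \<in> fib v \<and> act p vac = v"
  by (auto simp: E_eq fib_def)

lemma act_fib: "p \<in> fib v \<Longrightarrow> act p vac = v"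
  by (simp add: fib_def)

lemma ev_fib: "v \<in> E \<Longrightarrow> ev (fib v) = v"
  unfolding ev_def by (rule act_fib, rule someI_ex) (use fib_nonempty in blast)

text \<open>The operations on \<open>quot_space\<close> are unions over representatives; such a
  union of equal sets is their common value only because the class is nonempty.\<close>

lemma Union_fib: "v \<in> E \<Longrightarrow> (\<And>p. p \<in> fib v \<Longrightarrow> F p = B) \<Longrightarrow> (\<Union>p\<in>fib v. F p) = B"
  using fib_nonempty by fastforce

lemma irr_class_eq: "irr_class br S p = fib (act p vac)"
  by (simp add: irr_class_def coset_eq)

lemma irr_action_eq: "v \<in> E \<Longrightarrow> irr_action br S g (fib v) = fib (op g v)"
  unfolding irr_action_def by (rule Union_fib) (auto simp: irr_class_eq act_mult act_gen fib_def)

lemma truncate_irr_voa: "module.truncate irr_voa = irr_module br S"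
  by (simp add: irr_voa_def module.defs voa.defs irr_module_def quot_space_def)

lemma irr_voa_simps:
  "carrier irr_voa = fib ` E" "\<zero>\<^bsub>irr_voa\<^esub> = fib 0" "vacuum irr_voa = fib vac" "conformal irr_voa = fib om'"
  "mode irr_voa A n B = fib (M (ev A) n (ev B))"
  by (simp_all add: irr_voa_def module.defs voa.defs irr_module_def quot_space_def coset_eq E_eq image_image)
    (simp add: irr fib_def)

lemma irr_voa_add: "v \<in> E \<Longrightarrow> w \<in> E \<Longrightarrow> fib v \<oplus>\<^bsub>irr_voa\<^esub> fib w = fib (v + w)"
  by (simp add: irr_voa_def module.defs voa.defs irr_module_def quot_space_def coset_eq)
    (intro Union_fib, auto simp: act_add fib_def)

lemma irr_voa_smult: "v \<in> E \<Longrightarrow> s \<odot>\<^bsub>irr_voa\<^esub> fib v = fib (s *v v)"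
  by (simp add: irr_voa_def module.defs voa.defs irr_module_def quot_space_def coset_eq)
    (intro Union_fib, auto simp: act_pscale fib_def)

sublocale irr: voa_copy scale M C vac om c E om' c' irr_voa fib
proof unfold_locales
  show "inj_on fib E" using ev_fib by (metis inj_on_inverseI)
qed (auto simp: irr_voa_simps irr_voa_add irr_voa_smult ev_fib)

text \<open>\<open>l\<close> stands for the constructor of the generators L_n, so that Virasoro and
  W(2,2) are served alike.\<close>

lemma irr_voa_conformal:
  assumes "\<And>n v. op (l n) v = M om' (n + 1) v"
  shows "conformal irr_voa = irr_action br S (l (-2)) (vacuum irr_voa)"
    and "v \<in> carrier irr_voa \<Longrightarrow> mode irr_voa (conformal irr_voa) (n + 1) v = irr_action br S (l n) v"
  using E_sub om'_in
  by (auto simp: irr_voa_simps irr_action_eq vac_in_E assms M_create ev_fib om'_in subset_iff)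

lemma irr_voa_vacuum: "vacuum irr_voa = irr_class br S 1"
  by (simp add: irr_voa_simps irr_class_eq act_one)

end

section \<open>The two graded Lie algebras and their operators on V\<close>

fun deg_vir :: "vir \<Rightarrow> int" where
  "deg_vir (VirL n) = - n" | "deg_vir VirC = 0"

fun deg_w22 :: "w22 \<Rightarrow> int" where
  "deg_w22 (W22L n) = - n" | "deg_w22 (W22W n) = - n" | "deg_w22 W22C = 0"

lemma graded_lie_vir: "graded_lie vir_bracket (vir_hw k) deg_vir (VirL 0)"
proof
  show "deg_vir h = deg_vir x + deg_vir y" if "h \<in> Poly_Mapping.keys (vir_bracket x y)" for h x y
    using that by (cases x; cases y) (auto dest!: subsetD[OF keys_add] split: if_splits)
  show "gen g \<in> vir_hw k" if "deg_vir g < 0" for g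
    using that by (cases g) (auto simp: vir_hw_def)
  show "\<exists>s. gen g - const_alg s \<in> vir_hw k" if "deg_vir g = 0" for g
  proof (cases g)
    case (VirL n)
    then show ?thesis using that by (intro exI[of _ 0]) (auto simp: vir_hw_def const_alg_simps(1))
  next
    case VirC
    then show ?thesis by (intro exI[of _ k]) (auto simp: vir_hw_def)
  qed
  show "gen (VirL 0) \<in> vir_hw k" by (auto simp: vir_hw_def)
  show "vir_bracket (VirL 0) g = Poly_Mapping.single g (of_int (deg_vir g))" for g
    by (cases g) auto
qed

lemma graded_lie_w22: "graded_lie w22_bracket (w22_hw k) deg_w22 (W22L 0)"
proof
  show "deg_w22 h = deg_w22 x + deg_w22 y" if "h \<in> Poly_Mapping.keys (w22_bracket x y)" for h x y
    using that by (cases x; cases y)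
      (auto simp: in_keys_iff lookup_add lookup_minus lookup_single when_def split: if_splits)
  show "gen g \<in> w22_hw k" if "deg_w22 g < 0" for g
    using that by (cases g) (auto simp: w22_hw_def)
  show "\<exists>s. gen g - const_alg s \<in> w22_hw k" if "deg_w22 g = 0" for g
  proof (cases g)
    case (W22L n)
    then show ?thesis using that by (intro exI[of _ 0]) (auto simp: w22_hw_def const_alg_simps(1))
  next
    case (W22W n)
    then show ?thesis using that by (intro exI[of _ 0]) (auto simp: w22_hw_def const_alg_simps(1))
  next
    case W22C
    then show ?thesis by (intro exI[of _ k]) (auto simp: w22_hw_def)
  qed
  show "gen (W22L 0) \<in> w22_hw k" by (auto simp: w22_hw_def)
  show "w22_bracket (W22L 0) g = Poly_Mapping.single g (of_int (deg_w22 g))" for g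
    by (cases g) auto
qed

lemma (in linear_ops) act_embed_lie:
  "act (embed_lie (x + y)) v = act (embed_lie x) v + act (embed_lie y) v"
  "act (embed_lie (- x)) v = - act (embed_lie x) v" "act (embed_lie 0) v = 0"
  "act (embed_lie (Poly_Mapping.single g s)) v = s *v op g v"
  by (simp_all add: embed_lie_add embed_lie_minus embed_lie_zero embed_lie_single act_add act_minus act_zero
      act_const_mult act_gen)

lemma (in linear_ops) subspace_orbit: "subspace (range (\<lambda>p. act p v))"
proof -
  have "act p v + act q v \<in> range (\<lambda>p. act p v)" "s *v act p v \<in> range (\<lambda>p. act p v)" "0 \<in> range (\<lambda>p. act p v)" for p q s
    by (metis act_add rangeI, metis act_pscale rangeI, metis act_zero rangeI)
  then show ?thesis unfolding subspace_def by auto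
qed

lemma (in linear_ops) op_orbit: "w \<in> range (\<lambda>p. act p v) \<Longrightarrow> op g w \<in> range (\<lambda>p. act p v)"
  by (auto simp flip: act_gen act_mult)

context moonshine_model begin

fun vop :: "'a \<Rightarrow> complex \<Rightarrow> vir \<Rightarrow> 'a \<Rightarrow> 'a" where
  "vop a k (VirL n) v = M a (n + 1) v"
| "vop a k VirC v = k *v v"

fun wop :: "'a \<Rightarrow> w22 \<Rightarrow> 'a \<Rightarrow> 'a" where
  "wop y (W22L n) v = M om (n + 1) v"
| "wop y (W22W n) v = M y (n + 1) v"
| "wop y W22C v = c *v v"

lemma linear_ops_vop: "linear_ops scale (vop a k)"
proof
  show "vop a k g (v + w) = vop a k g v + vop a k g w" for g v w
    by (cases g) (auto simp: M_linear scale_right_distrib)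
  show "vop a k g (s *v v) = s *v vop a k g v" for g s v
    by (cases g) (auto simp: M_linear mult.commute)
qed

lemma linear_ops_wop: "linear_ops scale (wop y)"
proof
  show "wop y g (v + w) = wop y g v + wop y g w" for g v w
    by (cases g) (auto simp: M_linear scale_right_distrib)
  show "wop y g (s *v v) = s *v wop y g v" for g s v
    by (cases g) (auto simp: M_linear mult.commute)
qed

lemma virasoro_wt2:
  assumes "a \<in> wt 2" "M a 1 a = 2 *v a" "form a a = k / 2" "v \<in> C"
  shows "M a (m + 1) (M a (n + 1) v) - M a (n + 1) (M a (m + 1) v)
     = of_int (m - n) *v M a (m + n + 1) v + (if m + n = 0 then of_int (m ^ 3 - m) / 12 * k else 0) *v v"
proof -
  have coeff: "(if m + n = 0 then of_int (m ^ 3 - m) / 6 * (k / 2) else 0)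
     = (if m + n = 0 then of_int (m ^ 3 - m) / 12 * k else 0)" by simp
  show ?thesis
    unfolding commutator_wt2[OF assms(1,1,4)] assms(2,3) coeff M_scale_left by simp
qed

lemma hw_rep_vop:
  assumes a: "a \<in> wt 2" "M a 1 a = 2 *v a" "form a a = k / 2"
  shows "hw_rep scale (vop a k) vir_bracket (vir_hw k) deg_vir (VirL 0) C vac"
proof -
  interpret linear_ops scale "vop a k" by (rule linear_ops_vop)
  interpret graded_lie vir_bracket "vir_hw k" deg_vir "VirL 0" by (rule graded_lie_vir)
  show ?thesis
  proof
    show "vop a k g v \<in> C" if "v \<in> C" for g v
      using that C_subspace by (cases g) (auto simp: M_in subspace_scale)
    show "vop a k x (vop a k y v) - vop a k y (vop a k x v) = act (embed_lie (vir_bracket x y)) v"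
      if "v \<in> C" for x y v
      using virasoro_wt2[OF a that] by (cases x; cases y) (simp_all add: act_embed_lie M_linear)
    show "act s vac = 0" if "s \<in> vir_hw k" for s
      using that by (auto simp: vir_hw_def act_gen act_diff act_const M_create_zero)
  qed (auto simp: C_subspace vac_in_C)
qed

text \<open>The vanishing of the square of \<open>y\<close> and of \<open>form y y\<close> makes the
  W_n commute, and \<open>form om y = c / 2\<close> lets the central element act by \<open>c\<close>
  in [L_m, W_n] as it does in [L_m, L_n].\<close>

lemma hw_rep_wop:
  assumes y: "y \<in> wt 2" "M y 1 y = 0" "form y y = 0" "form om y = c / 2"
  shows "hw_rep scale (wop y) w22_bracket (w22_hw c) deg_w22 (W22L 0) C vac"
proof -
  interpret linear_ops scale "wop y" by (rule linear_ops_wop)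
  interpret graded_lie w22_bracket "w22_hw c" deg_w22 "W22L 0" by (rule graded_lie_w22)
  have coeff: "(if m + n = 0 then of_int (m ^ 3 - m) / 6 * (c / 2) else 0)
     = (if m + n = 0 then of_int (m ^ 3 - m) / 12 * c else 0)" for m n :: int by simp
  have cs: "(if P then q else 0) *v c *v v = (if P then q * c else 0) *v v" for P q v by simp
  have half: "(of_int (m - n) / 2) *v (2 *v v) = of_int (m - n) *v v" for m n v by simp
  have yy: "M y (m + 1) (M y (n + 1) v) - M y (n + 1) (M y (m + 1) v) = 0" if "v \<in> C" for m n v
    using commutator_wt2[OF y(1,1) that, of m n] by (simp only: y M_zero_left) simp
  have oy: "M om (m + 1) (M y (n + 1) v) - M y (n + 1) (M om (m + 1) v) = of_int (m - n) *v M y (m + n + 1) v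
      + (if m + n = 0 then of_int (m ^ 3 - m) / 12 * c else 0) *v v" if "v \<in> C" for m n v
    unfolding commutator_wt2[OF om_wt y(1) that] om_product(1)[OF y(1)] y coeff M_scale_left half ..
  have oy': "M y (n + 1) (M om (m + 1) v) - M om (m + 1) (M y (n + 1) v) = - (of_int (m - n) *v M y (m + n + 1) v
      + (if m + n = 0 then of_int (m ^ 3 - m) / 12 * c else 0) *v v)" if "v \<in> C" for m n v
    unfolding oy[OF that, symmetric] by simp
  show ?thesis
  proof
    show "wop y g v \<in> C" if "v \<in> C" for g v
      using that C_subspace by (cases g) (auto simp: M_in subspace_scale)
    show "wop y g (wop y h v) - wop y h (wop y g v) = act (embed_lie (w22_bracket g h)) v"
      if "v \<in> C" for g h v
      using M_virasoro[OF that] yy[OF that] oy[OF that] oy'[OF that]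
      by (cases g; cases h) (simp_all only: w22_bracket.simps wop.simps act_embed_lie M_linear diff_self cs)
    show "act s vac = 0" if "s \<in> w22_hw c" for s
      using that by (auto simp: w22_hw_def act_gen act_diff act_const M_create_zero)
  qed (auto simp: C_subspace vac_in_C)
qed

end

section \<open>The two cases\<close>

context moonshine_model begin

lemma orbit_graded:
  fixes op :: "'g \<Rightarrow> 'a \<Rightarrow> 'a" and deg :: "'g \<Rightarrow> int"
  assumes "hw_rep scale op br S deg d0 C vac"
    and op: "\<And>g k v. v \<in> wt k \<Longrightarrow> op g v \<in> wt (k + deg g)"
    and "v \<in> range (\<lambda>p. linear_ops.act scale op p vac)"
  shows "\<exists>S f. finite S \<and> (\<forall>n\<in>S. f n \<in> range (\<lambda>p. linear_ops.act scale op p vac) \<inter> wt n) \<and> v = (\<Sum>n\<in>S. f n)"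
proof -
  interpret R: hw_rep scale op br S deg d0 C vac by fact
  let ?E = "range (\<lambda>p. R.act p vac)"
  note closed = subspace_0[OF R.subspace_orbit] subspace_add[OF R.subspace_orbit] subspace_scale[OF R.subspace_orbit]
    subspace_0[OF subspace_wt] subspace_add[OF subspace_wt] subspace_scale[OF subspace_wt]
  \<comment> \<open>The components are required to be homogeneous at every n and zero off
    \<open>S\<close>, so that families for two elements can be added over the union of their
    supports.\<close>
  have "\<exists>S f. finite S \<and> (\<forall>n. f n \<in> ?E \<inter> wt n) \<and> (\<forall>n. n \<notin> S \<longrightarrow> f n = 0) \<and> R.act p vac = (\<Sum>n\<in>S. f n)" for p
  proof (induction p rule: free_alg_induct)
    case (1 xs)
    have "foldr op xs vac \<in> wt (R.mdeg xs)"
    proof (induction xs)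
      case (Cons g xs)
      then show ?case using op[of "foldr op xs vac" "R.mdeg xs" g] by (simp add: add.commute)
    qed (simp add: vac_wt)
    then have "R.act (wrd xs) vac \<in> wt (R.mdeg xs)" by (simp add: R.act_wrd)
    then show ?case
      by (intro exI[of _ "{R.mdeg xs}"] exI[of _ "\<lambda>n. if n = R.mdeg xs then R.act (wrd xs) vac else 0"])
        (auto simp: closed)
  next
    case (2 s p)
    then obtain T f where T: "finite T" "\<forall>n. f n \<in> ?E \<inter> wt n" "\<forall>n. n \<notin> T \<longrightarrow> f n = 0"
      "R.act p vac = (\<Sum>n\<in>T. f n)" by blast
    then show ?case
      by (intro exI[of _ T] exI[of _ "\<lambda>n. s *v f n"])
        (auto simp: R.act_const_mult scale_sum_right closed simp del: image_iff intro!: closed)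
  next
    case (3 p q)
    then obtain T f T' f' where T: "finite T" "\<forall>n. f n \<in> ?E \<inter> wt n" "\<forall>n. n \<notin> T \<longrightarrow> f n = 0"
      "R.act p vac = (\<Sum>n\<in>T. f n)" "finite T'" "\<forall>n. f' n \<in> ?E \<inter> wt n" "\<forall>n. n \<notin> T' \<longrightarrow> f' n = 0"
      "R.act q vac = (\<Sum>n\<in>T'. f' n)" by metis
    have "(\<Sum>n\<in>T. f n) = (\<Sum>n\<in>T \<union> T'. f n)" "(\<Sum>n\<in>T'. f' n) = (\<Sum>n\<in>T \<union> T'. f' n)"
      using T by (auto intro!: sum.mono_neutral_left)
    then have "R.act (p + q) vac = (\<Sum>n\<in>T \<union> T'. f n + f' n)"
      using T by (simp add: R.act_add sum.distrib)
    moreover have "\<forall>n. f n + f' n \<in> ?E \<inter> wt n" using T by (auto intro!: closed)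
    ultimately show ?case
      using T by (intro exI[of _ "T \<union> T'"] exI[of _ "\<lambda>n. f n + f' n"]) auto
  qed
  moreover obtain p where "v = R.act p vac" using assms(3) by (rule rangeE)
  ultimately obtain T f where "finite T" "\<forall>n. f n \<in> ?E \<inter> wt n" "v = (\<Sum>n\<in>T. f n)"
    by metis
  then show ?thesis by (intro exI[of _ T] exI[of _ f]) simp
qed

text \<open>The stabilizer of \<open>W\<close> contains \<open>wt 2\<close>, hence is all of
  \<open>C\<close>, and \<open>W\<close> is an ideal. Simplicity enters the irreducibility arguments
  in this form.\<close>

lemma invariant_subspace:
  assumes W: "subspace W" "W \<subseteq> C" and S: "S \<subseteq> C" "\<And>u n w. u \<in> S \<Longrightarrow> w \<in> W \<Longrightarrow> M u n w \<in> W"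
    and sp: "wt 2 \<subseteq> span S" and nz: "w \<in> W" "w \<noteq> 0"
  shows "W = C"
proof -
  let ?Z = "{u \<in> C. \<forall>n. \<forall>w\<in>W. M u n w \<in> W}"
  have Z: "subalg ?Z" by (rule subalg_stabilizer[OF W])
  have "S \<subseteq> ?Z" using S by blast
  then have "span S \<subseteq> ?Z" using Z by (intro span_minimal) (auto simp: subalg_def)
  then have "?Z = C" using sp by (intro generated[OF Z]) blast
  then have "W = {0} \<or> W = C" by (intro simple[OF W]) blast
  then show ?thesis using nz by blast
qed

lemma vop_wt: "a \<in> wt 2 \<Longrightarrow> v \<in> wt k \<Longrightarrow> vop a s g v \<in> wt (k + deg_vir g)"
  using M_wt2[of a v k "n + 1" for n] subspace_scale[OF subspace_wt] by (cases g) auto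

lemma wop_wt: "y \<in> wt 2 \<Longrightarrow> v \<in> wt k \<Longrightarrow> wop y g v \<in> wt (k + deg_w22 g)"
  using M_wt2[of y v k "n + 1" for n] M_wt2[OF om_wt, of v k "n + 1" for n] subspace_scale[OF subspace_wt]
  by (cases g) auto

lemma wt_bounded: "\<exists>N. \<forall>n<N. wt n = {0}"
  using wt_neg by blast

lemma nilpotent_case:
  assumes y: "y \<in> wt 2" "M y 1 y = 0" "form y y = 0" "form om y = c / 2"
    and sp: "wt 2 = {s *v om + t *v y | s t. True}"
  shows "\<exists>U \<kappa>. is_W22_voa c U \<and> voa_copy scale M C vac om c C om c U \<kappa>"
proof -
  interpret R: hw_rep scale "wop y" w22_bracket "w22_hw c" deg_w22 "W22L 0" C vac
    by (rule hw_rep_wop[OF y])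
  have SC: "{om, y} \<subseteq> C" using y om_wt wt_in_C by blast
  have sp': "wt 2 \<subseteq> span {om, y}"
    unfolding sp by (auto intro!: span_add span_scale intro: span_base)
  have orbit_inv: "M u n w \<in> range (\<lambda>p. R.act p v)" if "u \<in> {om, y}" "w \<in> range (\<lambda>p. R.act p v)" for u n w v
    using that R.op_orbit[OF that(2), of "W22L (n - 1)"] R.op_orbit[OF that(2), of "W22W (n - 1)"] by auto
  have orbit_C: "range (\<lambda>p. R.act p v) \<subseteq> C" if "v \<in> C" for v
    using R.act_in_D[OF that] by blast
  have self: "v \<in> range (\<lambda>p. R.act p v)" for v
    by (rule range_eqI[of _ _ 1]) (simp add: R.act_one)
  \<comment> \<open>\<open>om\<close> and \<open>y\<close> span \<open>wt 2\<close>, so the orbit of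
    a nonzero vector is an invariant subspace. This yields both irreducibility and that the vacuum
    generates all of \<open>C\<close>.\<close>
  have full: "range (\<lambda>p. R.act p v) = C" if "v \<in> C" "v \<noteq> 0" for v
    by (rule invariant_subspace[OF R.subspace_orbit orbit_C[OF that(1)] SC orbit_inv sp' self that(2)])
  have irr: "irr_ideal w22_bracket (w22_hw c) = {p. R.act p vac = 0}"
  proof (rule R.irr_ideal_eq_annihilator[OF vac_nz])
    fix p assume "R.act p vac \<noteq> 0"
    then have "vac \<in> range (\<lambda>r. R.act r (R.act p vac))"
      using full[of "R.act p vac"] R.act_in_D[OF vac_in_C] vac_in_C by auto
    then show "\<exists>r. R.act r (R.act p vac) = vac" by (metis imageE)
  qed
  have E: "C = range (\<lambda>p. R.act p vac)" using full[OF vac_in_C vac_nz] by simp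
  interpret sub_model scale M C vac om c C om c
  proof
    show "subalg C" by (simp add: subalg_def C_subspace vac_in_C M_in)
    show "\<exists>S f. finite S \<and> (\<forall>n\<in>S. f n \<in> C \<inter> wt n) \<and> v = (\<Sum>n\<in>S. f n)" if "v \<in> C" for v
      using orbit_graded[OF R.hw_rep_axioms wop_wt[OF y(1)], of v] that E by simp
  qed (use om_in_C M_virasoro wt_finite_dim wt_bounded in auto)
  interpret I: irr_model scale M C vac om c C om c "wop y" w22_bracket "w22_hw c" deg_w22 "W22L 0" C
    by unfold_locales (use E irr in auto)
  have yC: "y \<in> C" using y wt_in_C by blast
  have fib_y: "irr_action w22_bracket (w22_hw c) (W22W (-2)) (vacuum I.irr_voa) = I.fib y"
    using yC by (simp add: I.irr_voa_simps I.irr_action_eq vac_in_C M_create)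
  have "is_W22_voa c I.irr_voa"
    unfolding is_W22_voa_def Let_def fib_y
  proof (intro conjI allI ballI)
    show "vertex_operator_algebra I.irr_voa c" by (rule I.irr.voa_U)
    show "module.truncate I.irr_voa = irr_module w22_bracket (w22_hw c)" by (rule I.truncate_irr_voa)
    show "vacuum I.irr_voa = irr_class w22_bracket (w22_hw c) 1" by (rule I.irr_voa_vacuum)
    show "conformal I.irr_voa = irr_action w22_bracket (w22_hw c) (W22L (-2)) (vacuum I.irr_voa)"
      by (rule I.irr_voa_conformal(1)) simp
    show "mode I.irr_voa (conformal I.irr_voa) (n + 1) v = irr_action w22_bracket (w22_hw c) (W22L n) v"
      if "v \<in> carrier I.irr_voa" for n v
      by (rule I.irr_voa_conformal(2)[OF _ that]) simp
    show "mode I.irr_voa (I.fib y) (n + 1) v = irr_action w22_bracket (w22_hw c) (W22W n) v"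
      if "v \<in> carrier I.irr_voa" for n v
      using that yC by (auto simp: I.irr_voa_simps I.irr_action_eq I.ev_fib)
    have "A = C" if "subalg A" "{om, y} \<subseteq> A" for A
    proof -
      have "span {om, y} \<subseteq> A" using that by (intro span_minimal) (auto simp: subalg_def)
      with sp' show ?thesis by (intro generated that) blast
    qed
    then have "generated_by I.irr_voa (I.fib ` {om, y})"
      using SC by (intro I.irr.generated_by_U) auto
    then show "generated_by I.irr_voa {conformal I.irr_voa, I.fib y}"
      by (simp add: I.irr_voa_simps)
  qed
  with I.irr.voa_copy_axioms show ?thesis by (intro exI conjI)
qed

end

section \<open>The semisimple case: two commuting Virasoro algebras\<close>

locale vir_pair = moonshine_model +
  fixes a b :: 'a and c1 c2 :: complex
  assumes a: "a \<in> wt 2" "M a 1 a = 2 *v a" "form a a = c1 / 2"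
    and b: "b \<in> wt 2" "M b 1 b = 2 *v b" "form b b = c2 / 2"
    and ab: "M a 1 b = 0" "form a b = 0"
    and om_ab: "om = a + b"
    and wt2_span: "wt 2 = {s *v a + t *v b | s t. True}"
begin

text \<open>Supplies the mirror image, for \<open>b\<close> and \<open>EB\<close>, of each statement
  about \<open>a\<close> and \<open>EA\<close>.\<close>

lemma swap: "vir_pair scale M C vac om c b a c2 c1"
proof unfold_locales
  show "wt 2 = {s *v b + t *v a | s t. True}"
    unfolding wt2_span by (rule Collect_cong) (metis add.commute)
qed (use a b ab om_ab product_commute[OF a(1) b(1)] form_sym[OF a(1) b(1)] in \<open>auto simp: add.commute\<close>)

sublocale A: hw_rep scale "vop a c1" vir_bracket "vir_hw c1" deg_vir "VirL 0" C vac
  by (rule hw_rep_vop[OF a])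

sublocale B: hw_rep scale "vop b c2" vir_bracket "vir_hw c2" deg_vir "VirL 0" C vac
  by (rule hw_rep_vop[OF b])

abbreviation "EA \<equiv> range (\<lambda>p. A.act p vac)"
abbreviation "EB \<equiv> range (\<lambda>p. B.act p vac)"

lemma modes_commute: "v \<in> C \<Longrightarrow> M a m (M b n v) = M b n (M a m v)"
  using commutator_wt2[OF a(1) b(1), of v "m - 1" "n - 1"] by (simp add: ab M_linear split: if_splits)

lemma a_in_C: "a \<in> C" and b_in_C: "b \<in> C" using a b wt_in_C by auto

lemma wt2_span': "wt 2 \<subseteq> span {a, b}"
  unfolding wt2_span by (auto intro!: span_add span_scale intro: span_base)

lemma EA_C: "EA \<subseteq> C"
  using A.act_in_D[OF vac_in_C] by blast

lemma M_b_act: "v \<in> C \<Longrightarrow> M b n (A.act p v) = A.act p (M b n v)"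
proof (rule A.act_commute[where F = "M b n" and D = C])
  show "M b n (vop a c1 g w) = vop a c1 g (M b n w)" if "w \<in> C" for g w
    using that by (cases g) (auto simp: modes_commute M_linear)
qed (auto simp: C_subspace A.op_in M_linear)

lemma vop_b_act: "v \<in> C \<Longrightarrow> vop b c2 g (A.act p v) = A.act p (vop b c2 g v)"
  by (cases g) (auto simp: M_b_act A.act_scale_right)

lemma acts_commute: "v \<in> C \<Longrightarrow> B.act q (A.act p v) = A.act p (B.act q v)"
proof (rule B.act_commute[where F = "A.act p" and D = C, symmetric])
  show "A.act p (vop b c2 g w) = vop b c2 g (A.act p w)" if "w \<in> C" for g w
    using that by (simp add: vop_b_act)
qed (auto simp: C_subspace B.op_in A.act_add_right A.act_scale_right)

lemma M_a_act: "M a n (A.act p v) = A.act (gen (VirL (n - 1)) * p) v"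
  by (simp add: A.act_mult A.act_gen)

lemma M_b_B_act: "M b n (B.act p v) = B.act (gen (VirL (n - 1)) * p) v"
  by (simp add: B.act_mult B.act_gen)

lemma b_kills_EA: "v \<in> EA \<Longrightarrow> n \<ge> 0 \<Longrightarrow> M b n v = 0"
  by (auto simp: M_b_act vac_in_C M_create_zero A.act_zero_right)

text \<open>For the second algebra every vector of \<open>EA\<close> behaves like the vacuum: the
  nonnegative modes of \<open>b\<close> commute past the modes of \<open>a\<close> and kill the
  vacuum.\<close>

lemma vir_hw_b_kills_EA: "v \<in> EA \<Longrightarrow> s \<in> vir_hw c2 \<Longrightarrow> B.act s v = 0"
  by (auto simp: vir_hw_def B.act_gen B.act_diff B.act_const b_kills_EA simp del: image_iff)

lemma subalg_EA: "subalg EA"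
proof (rule subalg_of_orbit[of _ "{a}"])
  show "vac \<in> EA" by (rule range_eqI[of _ _ 1]) (simp add: A.act_one)
  show "M u n w \<in> EA" if "u \<in> {a}" "w \<in> EA" for u n w
    using that by (auto simp: M_a_act)
  show "EA \<subseteq> Z" if Z: "subspace Z" "vac \<in> Z" "\<And>u n w. u \<in> {a} \<Longrightarrow> w \<in> Z \<Longrightarrow> M u n w \<in> Z" for Z
  proof -
    have "vop a c1 g v \<in> Z" if "v \<in> Z" for g v
      using Z that by (cases g) (auto simp: subspace_scale)
    then show ?thesis using A.act_in[OF Z(1) _ Z(2)] by blast
  qed
qed (use a_in_C EA_C A.subspace_orbit in auto)

lemma a_in_EA: "a \<in> EA"
  by (rule range_eqI[of _ _ "gen (VirL (-2))"]) (simp add: A.act_gen M_create a_in_C)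

text \<open>The modes of \<open>a\<close> extend \<open>p\<close>, those of \<open>b\<close> pass
  \<open>p\<close> and extend \<open>q\<close>; hence the span is invariant under both.\<close>

lemma acts_span_C:
  assumes "v \<in> C" "v \<noteq> 0"
  shows "span {A.act p (B.act q v) | p q. True} = C"
proof (rule invariant_subspace[where S = "{a, b}"])
  let ?G = "{A.act p (B.act q v) | p q. True}"
  have GC: "?G \<subseteq> C" using A.act_in_D B.act_in_D assms by auto
  then show "span ?G \<subseteq> C" by (intro span_minimal C_subspace)
  show "subspace (span ?G)" by simp
  show "M u n w \<in> span ?G" if "u \<in> {a, b}" "w \<in> span ?G" for u n w
    using that(2)
  proof (induction rule: span_induct_alt)
    case base
    show ?case by (simp add: M_linear span_zero)
  next
    case (step s x z)
    then obtain p q where x: "x = A.act p (B.act q v)" by blast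
    have "M u n x \<in> ?G"
    proof (cases "u = a")
      case True
      show ?thesis unfolding x True M_a_act[of n p] by blast
    next
      case False
      then have "u = b" using that by blast
      have "M b n x = A.act p (B.act (gen (VirL (n - 1)) * q) v)"
        unfolding x M_b_act[OF B.act_in_D[OF assms(1)]] M_b_B_act ..
      with \<open>u = b\<close> show ?thesis by blast
    qed
    then have "M u n x \<in> span ?G" by (rule span_base)
    with step show ?case by (simp add: M_linear span_add span_scale)
  qed
  have "v = A.act 1 (B.act 1 v)" by (simp add: A.act_one B.act_one)
  then show "v \<in> span ?G" by (intro span_base) blast
qed (use a_in_C b_in_C wt2_span' assms in auto)

text \<open>The projection to the vacuum of the second factor turns an element of the orbit of \<open>v\<close> under both
  Virasoro algebras into one of the orbit under the first.\<close>

lemma EA_irreducible: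
  assumes v: "v \<in> EA" "v \<noteq> 0"
  shows "\<exists>p. A.act p v = vac"
proof -
  define R where "R t \<longleftrightarrow> (\<exists>N. \<forall>n\<ge>N. \<exists>p. B.act (B.vac_proj n) t = A.act p v)" for t
  have vC: "v \<in> C" using v EA_C by blast
  have base: "R (A.act p (B.act q v))" for p q
  proof -
    obtain N where N: "\<forall>n\<ge>N. \<exists>s. B.vac_proj n * q - const_alg s \<in> B.I"
      using B.vac_proj_eventually by blast
    have "\<exists>r. B.act (B.vac_proj n) (A.act p (B.act q v)) = A.act r v" if n: "n \<ge> N" for n
    proof -
      from N n obtain s where s: "B.vac_proj n * q - const_alg s \<in> B.I" by blast
      \<comment> \<open>The congruence modulo \<open>B.I\<close> may be applied at \<open>v\<close>,
        which is a highest weight vector for the second algebra. So the projection replaces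
        \<open>q\<close> by a scalar.\<close>
      have "B.act (B.vac_proj n * q - const_alg s) v = 0"
        using vir_hw_b_kills_EA[OF v(1)] by (rule B.I_annihilates[OF vC _ s])
      then have "B.act (B.vac_proj n) (B.act q v) = s *v v"
        by (simp add: B.act_diff B.act_mult B.act_const)
      then have "B.act (B.vac_proj n) (A.act p (B.act q v)) = A.act (pscale s p) v"
        by (simp add: acts_commute B.act_in_D vC A.act_scale_right A.act_pscale)
      then show ?thesis by blast
    qed
    then show ?thesis unfolding R_def by blast
  qed
  have step: "R (s *v t + t')" if R: "R t" "R t'" for s t t'
  proof -
    obtain N N' where N: "\<forall>n\<ge>N. \<exists>p. B.act (B.vac_proj n) t = A.act p v"
      "\<forall>n\<ge>N'. \<exists>p. B.act (B.vac_proj n) t' = A.act p v" using R unfolding R_def by blast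
    have "\<exists>p. B.act (B.vac_proj n) (s *v t + t') = A.act p v" if n: "n \<ge> max N N'" for n
    proof -
      obtain p p' where "B.act (B.vac_proj n) t = A.act p v" "B.act (B.vac_proj n) t' = A.act p' v"
        using N n by (meson max.boundedE)
      then have "B.act (B.vac_proj n) (s *v t + t') = A.act (pscale s p + p') v"
        by (simp add: B.act_add_right B.act_scale_right A.act_add A.act_pscale)
      then show ?thesis by blast
    qed
    then show ?thesis unfolding R_def by blast
  qed
  have "vac \<in> span {A.act p (B.act q v) | p q. True}"
    using vac_in_C acts_span_C[OF vC v(2)] by blast
  then have "R vac"
  proof (induction rule: span_induct_alt)
    case base
    have "B.act (B.vac_proj n) 0 = A.act 0 v" for n by (simp add: B.act_zero_right A.act_zero)
    then show ?case unfolding R_def by blast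
  next
    case (step s x y)
    then show ?case using base \<open>\<And>s t t'. R t \<Longrightarrow> R t' \<Longrightarrow> R (s *v t + t')\<close> by blast
  qed
  \<comment> \<open>The projections fix the vacuum, so \<open>R vac\<close> places the vacuum itself
    in the orbit of \<open>v\<close> under the first algebra.\<close>
  then show ?thesis using B.vac_proj_vac unfolding R_def by auto
qed

lemma irr_A: "irr_ideal vir_bracket (vir_hw c1) = {p. A.act p vac = 0}"
  by (rule A.irr_ideal_eq_annihilator[OF vac_nz]) (rule EA_irreducible, auto)

lemma irr_model_A: "irr_model scale M C vac om c EA a c1 (vop a c1) vir_bracket (vir_hw c1) deg_vir (VirL 0) C"
proof unfold_locales
  \<comment> \<open>On \<open>EA\<close> the nonnegative modes of \<open>b\<close> vanish, so those
    of \<open>a\<close> and \<open>om\<close> agree.\<close>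
  have om_b: "M a n v = M om n v - M b n v" for n v
    by (simp add: om_ab M_linear)
  show "M a 1 v = M om 1 v" "M a 0 v = M om 0 v" if "v \<in> EA" for v
    unfolding om_b using b_kills_EA[OF that] by simp_all
  show "\<exists>S f. finite S \<and> (\<forall>n\<in>S. f n \<in> EA \<inter> wt n) \<and> v = (\<Sum>n\<in>S. f n)" if "v \<in> EA" for v
    by (rule orbit_graded[OF A.hw_rep_axioms vop_wt[OF a(1)] that])
  show "M a (m + 1) (M a (n + 1) v) - M a (n + 1) (M a (m + 1) v)
      = of_int (m - n) *v M a (m + n + 1) v + (if m + n = 0 then of_int (m ^ 3 - m) / 12 * c1 else 0) *v v"
    if "v \<in> EA" for m n v
    using that EA_C by (intro virasoro_wt2 a) blast
qed (use subalg_EA a_in_EA wt_finite_dim wt_bounded irr_A in auto)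

lemma Vir_voa_A: "\<exists>U \<kappa>. is_Vir_voa c1 U \<and> voa_copy scale M C vac om c EA a c1 U \<kappa>"
proof -
  interpret I: irr_model scale M C vac om c EA a c1 "vop a c1" vir_bracket "vir_hw c1" deg_vir "VirL 0" C
    by (rule irr_model_A)
  have "is_Vir_voa c1 I.irr_voa"
    unfolding is_Vir_voa_def
  proof (intro conjI allI ballI)
    show "vertex_operator_algebra I.irr_voa c1" by (rule I.irr.voa_U)
    show "module.truncate I.irr_voa = irr_module vir_bracket (vir_hw c1)" by (rule I.truncate_irr_voa)
    show "vacuum I.irr_voa = irr_class vir_bracket (vir_hw c1) 1" by (rule I.irr_voa_vacuum)
    show "conformal I.irr_voa = irr_action vir_bracket (vir_hw c1) (VirL (-2)) (vacuum I.irr_voa)"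
      by (rule I.irr_voa_conformal(1)) simp
    show "mode I.irr_voa (conformal I.irr_voa) (n + 1) v = irr_action vir_bracket (vir_hw c1) (VirL n) v"
      if "v \<in> carrier I.irr_voa" for n v
      by (rule I.irr_voa_conformal(2)[OF _ that]) simp
  qed
  with I.irr.voa_copy_axioms show ?thesis by (intro exI conjI)
qed

end

section \<open>Products of the two Virasoro subalgebras\<close>

context vir_pair begin

interpretation S: vir_pair scale M C vac om c b a c2 c1 by (rule swap)

lemma EB_C: "EB \<subseteq> C" and EB_subspace: "subspace EB"
  using S.EA_C B.subspace_orbit by auto

lemma EA_least:
  assumes "subalg Z" "a \<in> Z" shows "EA \<subseteq> Z"
proof -
  have Z: "subspace Z" "vac \<in> Z" using assms by (auto simp: subalg_def)
  have "vop a c1 g v \<in> Z" if "v \<in> Z" for g v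
    using Z that assms by (cases g) (auto simp: subspace_scale subalg_def)
  then show ?thesis using A.act_in[OF Z(1) _ Z(2)] by blast
qed

lemma EA_commutes_b:
  assumes "u \<in> EA" "w \<in> C" shows "M b n (M u m w) = M u m (M b n w)"
proof -
  let ?Z = "{u \<in> C. \<forall>m. \<forall>w\<in>C. M b n (M u m w) = M u m (M b n w)}"
  have "EA \<subseteq> ?Z"
    by (rule EA_least, rule subalg_centralizer) (auto simp: M_linear M_in a_in_C modes_commute)
  with assms show ?thesis by blast
qed

end

context vir_pair begin

interpretation S: vir_pair scale M C vac om c b a c2 c1 by (rule swap)

text \<open>The second of two centralizer arguments. In \<open>EA_commutes_b\<close> the vector
  \<open>b\<close> is fixed and the centralizer of its modes contains \<open>a\<close>, hence
  \<open>EA\<close>; here \<open>u\<close> is fixed and the centralizer of its modes contains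
  \<open>b\<close>, hence \<open>EB\<close>.\<close>

lemma EA_EB_commute:
  assumes "u \<in> EA" "v \<in> EB" "w \<in> C" shows "M u m (M v n w) = M v n (M u m w)"
proof -
  let ?Z = "{v \<in> C. \<forall>n. \<forall>w\<in>C. M u m (M v n w) = M v n (M u m w)}"
  have "EB \<subseteq> ?Z"
    by (rule S.EA_least, rule subalg_centralizer)
      (use assms(1) in \<open>auto simp: M_linear M_in b_in_C EA_commutes_b simp del: image_iff\<close>)
  with assms show ?thesis by blast
qed

lemma product_swap:
  assumes "u \<in> EA" "v \<in> EB" shows "M v (-1) u = M u (-1) v"
  using EA_EB_commute[OF assms vac_in_C, of "-1" "-1"] assms EA_C EB_C M_create by (metis subsetD)

lemma M_EA_product:
  assumes "u \<in> EA" "u' \<in> EA" "v \<in> EB"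
  shows "M u i (M u' (-1) v) = M (M u i u') (-1) v"
proof -
  have "M u i (M u' (-1) v) = M u i (M v (-1) u')" using product_swap assms by metis
  also have "\<dots> = M v (-1) (M u i u')" using assms EA_C by (intro EA_EB_commute) auto
  also have "\<dots> = M (M u i u') (-1) v"
    using subalg_EA assms by (intro product_swap) (auto simp: subalg_def simp del: image_iff)
  finally show ?thesis .
qed

lemma M_EB_product:
  assumes "u' \<in> EA" "v \<in> EB" "v' \<in> EB"
  shows "M v j (M u' (-1) v') = M u' (-1) (M v j v')"
  using EA_EB_commute[of u' v v' "-1" j] assms EB_C by auto

text \<open>The Borcherds identity with m = 0 and l = -1. All its coefficients become 1, and since
  modes of \<open>u\<close> and \<open>v\<close> commute, its two halves give the terms with k = -1
  - i and k = i: together every integer k occurs once. This is the formula defining the modes of a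
  tensor product.\<close>

lemma product_mode_sum:
  assumes u: "u \<in> EA" "u' \<in> EA" and v: "v \<in> EB" "v' \<in> EB"
  shows "finite {i. M u i u' \<noteq> 0 \<and> M v (n - 1 - i) v' \<noteq> 0}" (is "finite ?I")
    and "M (M u (-1) v) n (M u' (-1) v')
      = (\<Sum>i\<in>{i. M u i u' \<noteq> 0 \<and> M v (n - 1 - i) v' \<noteq> 0}. M (M u i u') (-1) (M v (n - 1 - i) v'))"
proof -
  define T where "T k = M (M u k u') (-1) (M v (n - 1 - k) v')" for k
  have vC: "M v j v' \<in> EB" for j using S.subalg_EA v by (auto simp: subalg_def simp del: image_iff)
  let ?w = "M u' (-1) v'"
  have T1: "M u k (M v (n - 1 - k) ?w) = T k" for k
    unfolding M_EB_product[OF u(2) v] M_EA_product[OF u vC] T_def ..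
  have T2: "M v (n - 1 - k) (M u k ?w) = T k" for k
    using EA_EB_commute[OF u(1) v(1) M_in, of k "n - 1 - k"] T1 by metis
  have gb: "(-1) ^ i * ((-1::complex) gchoose i) = 1" for i
    by (simp add: gbinomial_minus binomial_gbinomial[symmetric] flip: power_mult_distrib)
  obtain N where N: "\<And>K. K \<ge> N \<Longrightarrow>
      (\<Sum>i<K. (0 gchoose i) *v M (M u (-1 + int i) v) (n - int i) ?w)
      = (\<Sum>i<K. ((-1) ^ i * ((-1) gchoose i)) *v
          (M u (- 1 - int i) (M v (n + int i) ?w) - ((-1) powi (-1)) *v M v (n - 1 - int i) (M u (int i) ?w)))"
    using M_borcherds[of 0 u "-1" v n ?w] by auto
  obtain N1 where N1: "\<forall>k\<ge>N1. M u k u' = 0" using M_truncation by blast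
  obtain N2 where N2: "\<forall>k\<ge>N2. M v k v' = 0" using M_truncation by blast
  \<comment> \<open>Large enough that every nonzero term has k in the interval from -K to K - 1:
    above it the \<open>u\<close> factor vanishes, below it the \<open>v\<close> factor. The
    successor makes the term i = 0 available.\<close>
  define K where "K = Suc (N + nat \<bar>N1\<bar> + nat \<bar>N2\<bar> + nat \<bar>n\<bar>)"
  have K: "K \<ge> N" "int K \<ge> N1" "- int K \<le> n - 1 - N2 " "K \<ge> 1" by (auto simp: K_def)
  have sub: "?I \<subseteq> {- int K..<int K}"
  proof
    fix k assume k: "k \<in> ?I"
    from k have nz: "M u k u' \<noteq> 0" "M v (n - 1 - k) v' \<noteq> 0" by simp_all
    have "\<not> N1 \<le> k" using N1[rule_format, of k] nz(1) by blast
    moreover have "\<not> N2 \<le> n - 1 - k" using N2[rule_format, of "n - 1 - k"] nz(2) by blast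
    ultimately show "k \<in> {- int K..<int K}" using K by auto
  qed
  then show fin: "finite ?I" by (rule finite_subset) simp
  obtain K' where K': "K = Suc K'" using K(4) by (cases K) auto
  have "M (M u (-1) v) n ?w = (\<Sum>i<K. (0 gchoose i) *v M (M u (-1 + int i) v) (n - int i) ?w)"
    unfolding K' by (subst sum.lessThan_Suc_shift) simp
  also have "\<dots> = (\<Sum>i<K. ((-1) ^ i * ((-1) gchoose i)) *v
          (M u (- 1 - int i) (M v (n + int i) ?w) - ((-1) powi (-1)) *v M v (n - 1 - int i) (M u (int i) ?w)))"
    by (rule N[OF K(1)])
  also have "\<dots> = (\<Sum>i<K. T (-1 - int i) + T (int i))"
  proof (rule sum.cong[OF refl])
    fix i
    have "M u (-1 - int i) (M v (n + int i) ?w) = T (-1 - int i)"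
      using T1[of "-1 - int i"] by simp
    then show "((-1) ^ i * ((-1) gchoose i)) *v
          (M u (- 1 - int i) (M v (n + int i) ?w) - ((-1) powi (-1)) *v M v (n - 1 - int i) (M u (int i) ?w))
       = T (-1 - int i) + T (int i)"
      unfolding gb T2 by simp
  qed
  also have "\<dots> = (\<Sum>i<K. T (-1 - int i)) + (\<Sum>i<K. T (int i))" by (rule sum.distrib)
  also have "(\<Sum>i<K. T (-1 - int i)) = sum T {- int K..<0}"
    by (rule sum.reindex_bij_witness[of _ "\<lambda>k. nat (-1 - k)" "\<lambda>i. -1 - int i"]) auto
  also have "(\<Sum>i<K. T (int i)) = sum T {0..<int K}"
    by (rule sum.reindex_bij_witness[of _ nat int]) auto
  also have "sum T {- int K..<0} + sum T {0..<int K} = sum T {- int K..<int K}"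
    by (subst sum.union_disjoint[symmetric]) (auto intro!: sum.cong)
  also have "\<dots> = sum T ?I"
    using sub by (intro sum.mono_neutral_right) (auto simp: T_def M_linear)
  finally show "M (M u (-1) v) n ?w = (\<Sum>i\<in>?I. M (M u i u') (-1) (M v (n - 1 - i) v'))"
    by (simp add: T_def)
qed

text \<open>The modes of \<open>a\<close> commute with those of \<open>v\<close>, so after writing
  the product as \<open>M v (-1) u\<close> they reach \<open>u\<close> directly.\<close>

lemma A_act_product:
  assumes "u \<in> EA" "v \<in> EB" shows "A.act p (M u (-1) v) = M (A.act p u) (-1) v"
proof -
  have "M v (-1) (A.act p u) = A.act p (M v (-1) u)"
  proof (rule A.act_commute[where F = "M v (-1)" and D = C])
    show "M v (-1) (vop a c1 g w) = vop a c1 g (M v (-1) w)" if "w \<in> C" for g w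
      using that EA_EB_commute[OF a_in_EA assms(2)] by (cases g) (auto simp: M_linear)
  qed (use assms EA_C in \<open>auto simp: C_subspace A.op_in M_linear\<close>)
  moreover have "A.act p u \<in> EA" using assms(1) by (auto simp flip: A.act_mult)
  ultimately show ?thesis using product_swap assms by metis
qed

lemma products_span: "span {M u (-1) v | u v. u \<in> EA \<and> v \<in> EB} = C"
proof
  show "span {M u (-1) v | u v. u \<in> EA \<and> v \<in> EB} \<subseteq> C"
    by (intro span_minimal C_subspace) (auto simp: M_in)
  have "A.act p (B.act q vac) = M (A.act p vac) (-1) (B.act q vac)" for p q
  proof -
    have "vac \<in> EA" using subalg_EA by (simp add: subalg_def)
    then have "A.act p (M vac (-1) (B.act q vac)) = M (A.act p vac) (-1) (B.act q vac)"
      by (intro A_act_product) auto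
    then show ?thesis using B.act_in_D[OF vac_in_C] by (simp add: M_vac)
  qed
  then have "{A.act p (B.act q vac) | p q. True} \<subseteq> {M u (-1) v | u v. u \<in> EA \<and> v \<in> EB}"
    by auto
  then show "C \<subseteq> span {M u (-1) v | u v. u \<in> EA \<and> v \<in> EB}"
    using acts_span_C[OF vac_in_C vac_nz] span_mono by blast
qed

text \<open>Apply an element of the first enveloping algebra taking \<open>g b0\<close> to the vacuum, and then the
  projection to the vacuum of the first factor: this leaves a linear relation between the \<open>b\<close>.\<close>

lemma product_independent:
  assumes B: "finite B" "independent B" "B \<subseteq> EB" and g: "\<And>b. b \<in> B \<Longrightarrow> g b \<in> EA"
    and zero: "(\<Sum>b\<in>B. M (g b) (-1) b) = 0" and b0: "b0 \<in> B"
  shows "g b0 = 0"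
proof (rule ccontr)
  assume "g b0 \<noteq> 0"
  then obtain p where p: "A.act p (g b0) = vac" using EA_irreducible g b0 by blast
  have "\<forall>b\<in>B. \<exists>N. \<forall>n\<ge>N. \<exists>s. A.act (A.vac_proj n) (A.act p (g b)) = s *v vac"
  proof
    fix b assume "b \<in> B"
    then obtain q where "g b = A.act q vac" using g by blast
    then show "\<exists>N. \<forall>n\<ge>N. \<exists>s. A.act (A.vac_proj n) (A.act p (g b)) = s *v vac"
      using A.vac_proj_act[of "p * q"] by (simp add: A.act_mult)
  qed
  from bchoice[OF this] obtain N
    where N: "\<forall>b\<in>B. \<forall>n\<ge>N b. \<exists>s. A.act (A.vac_proj n) (A.act p (g b)) = s *v vac"
    by (rule exE)
  \<comment> \<open>One projection that works for all the finitely many coefficients.\<close>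
  define n where "n = Max (N ` B)"
  have "n \<ge> N b" if "b \<in> B" for b using that B(1) by (simp add: n_def)
  then have "\<forall>b\<in>B. \<exists>s. A.act (A.vac_proj n) (A.act p (g b)) = s *v vac"
    using N by blast
  from bchoice[OF this] obtain s where "\<forall>b\<in>B. A.act (A.vac_proj n) (A.act p (g b)) = s b *v vac"
    by (rule exE)
  then have s: "\<And>b. b \<in> B \<Longrightarrow> A.act (A.vac_proj n) (A.act p (g b)) = s b *v vac" by (rule bspec)
  \<comment> \<open>The coefficient at \<open>b0\<close> was moved to the vacuum, which the
    projection fixes.\<close>
  have s1: "s b0 = 1"
  proof -
    have "1 *v vac = s b0 *v vac" using s[OF b0] by (simp add: p A.vac_proj_vac)
    then show ?thesis using vac_nz by (simp del: scale_one)
  qed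
  have "0 = A.act (A.vac_proj n) (A.act p (\<Sum>b\<in>B. M (g b) (-1) b))"
    by (simp add: zero A.act_zero_right)
  also have "\<dots> = (\<Sum>b\<in>B. A.act (A.vac_proj n) (A.act p (M (g b) (-1) b)))"
    by (simp add: A.act_sum_right)
  also have "\<dots> = (\<Sum>b\<in>B. s b *v b)"
  proof (rule sum.cong[OF refl])
    fix b assume b: "b \<in> B"
    have bC: "b \<in> C" using b B(3) EB_C by (meson subsetD)
    have "A.act p (g b) \<in> EA" using g[OF b] by (auto simp flip: A.act_mult)
    then have "A.act (A.vac_proj n) (A.act p (M (g b) (-1) b)) = M (A.act (A.vac_proj n) (A.act p (g b))) (-1) b"
      using g b B(3) by (simp add: A_act_product subset_iff del: image_iff)
    moreover have "M (A.act (A.vac_proj n) (A.act p (g b))) (-1) b = s b *v b"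
      using bC by (simp add: s[OF b] M_linear M_vac)
    ultimately show "A.act (A.vac_proj n) (A.act p (M (g b) (-1) b)) = s b *v b" by simp
  qed
  finally have "(\<Sum>b\<in>B. s b *v b) = 0" ..
  then have "s b0 = 0" by (rule independentD[OF B(2,1) subset_refl _ b0])
  with s1 show False by simp
qed

end

section \<open>The tensor product\<close>

interpretation pm: vector_space pscale by (rule vector_space_pscale)

context vir_pair begin

context
  fixes U1 :: "('u, 'm) voa_scheme" and \<kappa>1 and U2 :: "('v, 'n) voa_scheme" and \<kappa>2
  assumes U1: "voa_copy scale M C vac om c EA a c1 U1 \<kappa>1"
    and U2: "voa_copy scale M C vac om c EB b c2 U2 \<kappa>2"
begin

interpretation U1: voa_copy scale M C vac om c EA a c1 U1 \<kappa>1 by (rule U1)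
interpretation U2: voa_copy scale M C vac om c EB b c2 U2 \<kappa>2 by (rule U2)

abbreviation tens :: "'a \<Rightarrow> 'a \<Rightarrow> 'u \<times> 'v \<Rightarrow>\<^sub>0 complex" where
  "tens u v \<equiv> Poly_Mapping.single (\<kappa>1 u, \<kappa>2 v) 1"

definition \<theta> :: "'u \<times> 'v \<Rightarrow> 'a" where
  "\<theta> = (\<lambda>(x, y). M (inv_into EA \<kappa>1 x) (-1) (inv_into EB \<kappa>2 y))"

definition \<Phi> :: "('u \<times> 'v \<Rightarrow>\<^sub>0 complex) \<Rightarrow> 'a" where "\<Phi> = lext \<theta>"

definition E0 :: "('u \<times> 'v \<Rightarrow>\<^sub>0 complex) set" where
  "E0 = {p. Poly_Mapping.keys p \<subseteq> carrier U1 \<times> carrier U2}"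

abbreviation K0 :: "('u \<times> 'v \<Rightarrow>\<^sub>0 complex) set" where "K0 \<equiv> tensor_kernel U1 U2"

lemma \<Phi>_linear: "\<Phi> (p + q) = \<Phi> p + \<Phi> q" "\<Phi> (p - q) = \<Phi> p - \<Phi> q" "\<Phi> 0 = 0"
  "\<Phi> (pscale s p) = s *v \<Phi> p" "\<Phi> (sum f A) = (\<Sum>i\<in>A. \<Phi> (f i))"
  by (simp_all add: \<Phi>_def lext_add lext_diff lext_zero lext_pscale lext_sum)

lemma \<theta>_eq: "u \<in> EA \<Longrightarrow> v \<in> EB \<Longrightarrow> \<theta> (\<kappa>1 u, \<kappa>2 v) = M u (-1) v"
  using U1.inj U2.inj by (simp add: \<theta>_def del: image_iff)

lemma \<Phi>_single: "u \<in> EA \<Longrightarrow> v \<in> EB \<Longrightarrow> \<Phi> (Poly_Mapping.single (\<kappa>1 u, \<kappa>2 v) t) = t *v M u (-1) v"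
  by (simp add: \<Phi>_def lext_single \<theta>_eq del: image_iff)

lemma K0_span: "K0 = pm.span (tensor_relations U1 U2)"
  by (simp add: tensor_kernel_def)

lemma subspace_K0: "pm.subspace K0" by (simp add: K0_span)

lemmas K0_closed = pm.subspace_0[OF subspace_K0] pm.subspace_add[OF subspace_K0] pm.subspace_diff[OF subspace_K0]
  pm.subspace_neg[OF subspace_K0] pm.subspace_scale[OF subspace_K0]

lemma K0_sum: "(\<And>i. i \<in> A \<Longrightarrow> f i \<in> K0) \<Longrightarrow> sum f A \<in> K0"
  by (rule pm.subspace_sum[OF subspace_K0])

lemma U1_cases: "x \<in> carrier U1 \<Longrightarrow> (\<And>u. u \<in> EA \<Longrightarrow> x = \<kappa>1 u \<Longrightarrow> thesis) \<Longrightarrow> thesis"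
  unfolding U1.carrier_U by (erule imageE) simp

lemma U2_cases: "y \<in> carrier U2 \<Longrightarrow> (\<And>v. v \<in> EB \<Longrightarrow> y = \<kappa>2 v \<Longrightarrow> thesis) \<Longrightarrow> thesis"
  unfolding U2.carrier_U by (erule imageE) simp

lemma carrier_cases:
  assumes "x \<in> carrier U1 \<times> carrier U2"
  obtains u v where "u \<in> EA" "v \<in> EB" "x = (\<kappa>1 u, \<kappa>2 v)"
  using assms by (elim SigmaE U1_cases U2_cases) (rule that, assumption+, simp)

lemma kappa_carrier: "u \<in> EA \<Longrightarrow> \<kappa>1 u \<in> carrier U1" "v \<in> EB \<Longrightarrow> \<kappa>2 v \<in> carrier U2"
  by (simp_all add: U1.carrier_U U2.carrier_U del: image_iff)

lemma E0_subspace: "pm.subspace E0"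
  unfolding pm.subspace_def E0_def
  by (auto simp: in_keys_iff lookup_pscale lookup_add subset_iff) (metis add_0 add.right_neutral)+

lemma single_E0: "u \<in> EA \<Longrightarrow> v \<in> EB \<Longrightarrow> Poly_Mapping.single (\<kappa>1 u, \<kappa>2 v) t \<in> E0"
  by (simp add: E0_def kappa_carrier del: image_iff)

lemma
  assumes "u \<in> EA" "v \<in> EB"
  shows K0_add_left: "u' \<in> EA \<Longrightarrow> tens (u + u') v - tens u v - tens u' v \<in> K0"
    and K0_add_right: "v' \<in> EB \<Longrightarrow> tens u (v + v') - tens u v - tens u v' \<in> K0"
    and K0_scale_left: "tens (s *v u) v - Poly_Mapping.single (\<kappa>1 u, \<kappa>2 v) s \<in> K0"
    and K0_scale_right: "tens u (s *v v) - Poly_Mapping.single (\<kappa>1 u, \<kappa>2 v) s \<in> K0"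
proof -
  note c = kappa_carrier(1)[OF assms(1)] kappa_carrier(2)[OF assms(2)]
  show "tens (u + u') v - tens u v - tens u' v \<in> K0" if "u' \<in> EA"
    unfolding K0_span tensor_relations_def U1.add_U[OF assms(1) that, symmetric]
    using c kappa_carrier(1)[OF that] by (intro pm.span_base UnI1) blast
  show "tens u (v + v') - tens u v - tens u v' \<in> K0" if "v' \<in> EB"
    unfolding K0_span tensor_relations_def U2.add_U[OF assms(2) that, symmetric]
    by (rule pm.span_base, rule UnI1, rule UnI1, rule UnI2) (use c kappa_carrier(2)[OF that] in blast)
  show "tens (s *v u) v - Poly_Mapping.single (\<kappa>1 u, \<kappa>2 v) s \<in> K0"
    unfolding K0_span tensor_relations_def U1.smult_U[OF assms(1), symmetric]
    by (rule pm.span_base, rule UnI1, rule UnI2) (use c in blast)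
  show "tens u (s *v v) - Poly_Mapping.single (\<kappa>1 u, \<kappa>2 v) s \<in> K0"
    unfolding K0_span tensor_relations_def U2.smult_U[OF assms(2), symmetric]
    by (rule pm.span_base, rule UnI2) (use c in blast)
qed

lemma K0_zero: "v \<in> EB \<Longrightarrow> tens 0 v \<in> K0"
  "u \<in> EA \<Longrightarrow> tens u 0 \<in> K0"
  using K0_scale_left[of 0 v 0] K0_scale_right[of u 0 0] U1.E_closed(1) U2.E_closed(1)
  by (simp_all del: image_iff)

text \<open>The easy inclusion: the defining relations of the tensor product are respected because
  \<open>M\<close> is bilinear.\<close>

lemma K0_sub: "K0 \<subseteq> {p \<in> E0. \<Phi> p = 0}"
proof -
  have sub: "pm.subspace {p \<in> E0. \<Phi> p = 0}"
    using E0_subspace unfolding pm.subspace_def by (auto simp: \<Phi>_linear)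
  note E0_closed = pm.subspace_diff[OF E0_subspace] single_E0
  have "p \<in> {p \<in> E0. \<Phi> p = 0}" if "p \<in> tensor_relations U1 U2" for p
    using that unfolding tensor_relations_def Un_iff mem_Collect_eq
  proof (elim disjE exE conjE)
    fix x x' y assume p: "p = Poly_Mapping.single (x \<oplus>\<^bsub>U1\<^esub> x', y) 1 - Poly_Mapping.single (x, y) 1
        - Poly_Mapping.single (x', y) 1" and x: "x \<in> carrier U1" "x' \<in> carrier U1" "y \<in> carrier U2"
    obtain u where "u \<in> EA" "x = \<kappa>1 u" using x(1) by (rule U1_cases)
    moreover obtain u' where "u' \<in> EA" "x' = \<kappa>1 u'" using x(2) by (rule U1_cases)
    moreover obtain v where "v \<in> EB" "y = \<kappa>2 v" using x(3) by (rule U2_cases)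
    ultimately show "p \<in> E0 \<and> \<Phi> p = 0"
      unfolding p by (simp add: U1.add_U U1.E_closed E0_closed \<Phi>_linear \<Phi>_single M_linear del: image_iff)
  next
    fix x y y' assume p: "p = Poly_Mapping.single (x, y \<oplus>\<^bsub>U2\<^esub> y') 1 - Poly_Mapping.single (x, y) 1
        - Poly_Mapping.single (x, y') 1" and x: "x \<in> carrier U1" "y \<in> carrier U2" "y' \<in> carrier U2"
    obtain u where "u \<in> EA" "x = \<kappa>1 u" using x(1) by (rule U1_cases)
    moreover obtain v where "v \<in> EB" "y = \<kappa>2 v" using x(2) by (rule U2_cases)
    moreover obtain v' where "v' \<in> EB" "y' = \<kappa>2 v'" using x(3) by (rule U2_cases)
    ultimately show "p \<in> E0 \<and> \<Phi> p = 0"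
      unfolding p by (simp add: U2.add_U U2.E_closed E0_closed \<Phi>_linear \<Phi>_single M_linear del: image_iff)
  next
    fix s x y assume p: "p = Poly_Mapping.single (s \<odot>\<^bsub>U1\<^esub> x, y) 1 - Poly_Mapping.single (x, y) s"
      and x: "x \<in> carrier U1" "y \<in> carrier U2"
    obtain u where "u \<in> EA" "x = \<kappa>1 u" using x(1) by (rule U1_cases)
    moreover obtain v where "v \<in> EB" "y = \<kappa>2 v" using x(2) by (rule U2_cases)
    ultimately show "p \<in> E0 \<and> \<Phi> p = 0"
      unfolding p by (simp add: U1.smult_U U1.E_closed E0_closed \<Phi>_linear \<Phi>_single M_linear del: image_iff)
  next
    fix s x y assume p: "p = Poly_Mapping.single (x, s \<odot>\<^bsub>U2\<^esub> y) 1 - Poly_Mapping.single (x, y) s"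
      and x: "x \<in> carrier U1" "y \<in> carrier U2"
    obtain u where "u \<in> EA" "x = \<kappa>1 u" using x(1) by (rule U1_cases)
    moreover obtain v where "v \<in> EB" "y = \<kappa>2 v" using x(2) by (rule U2_cases)
    ultimately show "p \<in> E0 \<and> \<Phi> p = 0"
      unfolding p by (simp add: U2.smult_U U2.E_closed E0_closed \<Phi>_linear \<Phi>_single M_linear del: image_iff)
  qed
  then show ?thesis unfolding K0_span using sub by (intro pm.span_minimal) blast
qed

text \<open>Expanding the second components in \<open>B\<close> and collecting the scalars in the
  first ones leaves a single first component for each element of \<open>B\<close>. In this form
  \<open>product_independent\<close> can be applied.\<close>

lemma K0_normal_form:
  assumes B: "finite B" "B \<subseteq> EB" and p: "p \<in> E0"
    and keys: "\<And>x y. (x, \<kappa>2 y) \<in> Poly_Mapping.keys p \<Longrightarrow> y \<in> EB \<Longrightarrow> y \<in> span B"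
  shows "\<exists>g. (\<forall>b\<in>B. g b \<in> EA) \<and> p - (\<Sum>b\<in>B. tens (g b) b) \<in> K0"
proof -
  define NF where "NF q \<longleftrightarrow> (\<exists>g. (\<forall>b\<in>B. g b \<in> EA) \<and>
      q - (\<Sum>b\<in>B. tens (g b) b) \<in> K0)" for q
  have NF_K0: "NF q" if "NF r" "q - r \<in> K0" for q r
  proof -
    from that obtain g where "\<forall>b\<in>B. g b \<in> EA" "r - (\<Sum>b\<in>B. tens (g b) b) \<in> K0"
      unfolding NF_def by blast
    moreover from K0_closed(2)[OF that(2) this(2)]
    have "q - (\<Sum>b\<in>B. tens (g b) b) \<in> K0" by simp
    ultimately show ?thesis unfolding NF_def by blast
  qed
  have NF_add: "NF (q + r)" if "NF q" "NF r" for q r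
  proof -
    from that obtain g h where g: "\<forall>b\<in>B. g b \<in> EA" "q - (\<Sum>b\<in>B. tens (g b) b) \<in> K0"
      and h: "\<forall>b\<in>B. h b \<in> EA" "r - (\<Sum>b\<in>B. tens (h b) b) \<in> K0"
      unfolding NF_def by blast
    have "(\<Sum>b\<in>B. tens (g b + h b) b - tens (g b) b - tens (h b) b) \<in> K0"
      using g h B(2) by (intro K0_sum K0_add_left) blast+
    from K0_closed(3)[OF K0_closed(2)[OF g(2) h(2)] this]
    have "q + r - (\<Sum>b\<in>B. tens (g b + h b) b) \<in> K0"
      by (simp add: sum_subtractf sum.distrib algebra_simps)
    moreover have "\<forall>b\<in>B. g b + h b \<in> EA" using g h U1.E_closed(2) by blast
    ultimately show ?thesis unfolding NF_def by (intro exI[of _ "\<lambda>b. g b + h b"]) simp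
  qed
  have NF_0: "NF q" if "q \<in> K0" for q
  proof -
    have "(\<Sum>b\<in>B. tens 0 b) \<in> K0"
      using B(2) by (intro K0_sum K0_zero) blast
    then show ?thesis unfolding NF_def using that U1.E_closed(1)
      by (intro exI[of _ "\<lambda>_. 0"]) (auto intro: K0_closed)
  qed
  have NF_base: "NF (tens u b)" if u: "u \<in> EA" and b: "b \<in> B" for u b
  proof -
    \<comment> \<open>All entries except the one at \<open>b\<close> are tensors with first factor
      0, which lie in \<open>K0\<close>.\<close>
    let ?g = "\<lambda>b'. if b' = b then u else 0"
    have rest: "(\<Sum>b'\<in>B - {b}. tens 0 b') \<in> K0"
      using B(2) by (intro K0_sum K0_zero) blast
    have eq: "(\<Sum>b'\<in>B. tens (?g b') b') = tens u b + (\<Sum>b'\<in>B - {b}. tens 0 b')"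
      using B(1) b by (subst sum.remove[of _ b]) (auto intro!: sum.cong)
    have "tens u b - (\<Sum>b'\<in>B. tens (?g b') b') \<in> K0"
      unfolding eq using K0_closed(4)[OF rest] by simp
    then show ?thesis unfolding NF_def using u U1.E_closed(1) by (intro exI[of _ ?g]) auto
  qed
  have NF_pure: "v \<in> EB \<and> NF (tens u v)" if u: "u \<in> EA" and v: "v \<in> span B" for u v
    using v
  proof (induction rule: span_induct_alt)
    case base
    show ?case using NF_0[OF K0_zero(2)[OF u]] U2.E_closed(1) by blast
  next
    case (step s b y)
    have bE: "b \<in> EB" using step B by blast
    have yE: "y \<in> EB" using step by blast
    have sE: "s *v b \<in> EB" by (rule U2.E_closed(3)[OF bE])
    have suE: "s *v u \<in> EA" by (rule U1.E_closed(3)[OF u])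
    have "NF (tens (s *v u) b)" by (rule NF_base[OF suE step(1)])
    \<comment> \<open>The scalar crosses from the second factor to the first, since \<open>B\<close>
      itself has to stay unscaled.\<close>
    moreover have "tens u (s *v b) - tens (s *v u) b \<in> K0"
      using K0_closed(3)[OF K0_scale_right[OF u bE, of s] K0_scale_left[OF u bE, of s]] by simp
    ultimately have "NF (tens u (s *v b))" by (rule NF_K0)
    from NF_add[OF this] step have "NF (tens u (s *v b) + tens u y)" by blast
    then have "NF (tens u (s *v b + y))"
      by (rule NF_K0) (use K0_add_right[OF u sE yE] in \<open>simp add: algebra_simps\<close>)
    then show ?case using U2.E_closed(2)[OF sE yE] by blast
  qed
  have "NF p"
  proof (rule poly_mapping_additive_induct[where p = p])
    fix x t assume x: "x \<in> Poly_Mapping.keys p"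
    then have "x \<in> carrier U1 \<times> carrier U2" using p by (auto simp: E0_def)
    then obtain u v where uv: "u \<in> EA" "v \<in> EB" "x = (\<kappa>1 u, \<kappa>2 v)" by (rule carrier_cases)
    have v: "v \<in> span B" using keys x uv by blast
    have "NF (tens (t *v u) v)" using NF_pure[OF U1.E_closed(3)[OF uv(1)] v] by blast
    then show "NF (Poly_Mapping.single x t)"
      by (rule NF_K0) (use K0_closed(4)[OF K0_scale_left[OF uv(1,2), of t]] in \<open>simp add: uv(3)\<close>)
  qed (use NF_0[OF K0_closed(1)] NF_add in auto)
  then show ?thesis unfolding NF_def .
qed

text \<open>Injectivity of a \<otimes> b \<mapsto> \<open>M a (-1) b\<close>. With \<open>B\<close>
  a maximal independent set of second components of \<open>p\<close>, a vanishing image forces all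
  first components in the normal form to be 0.\<close>

lemma K0_eq: "K0 = {p \<in> E0. \<Phi> p = 0}"
proof (rule equalityI[OF K0_sub], rule subsetI)
  fix p assume "p \<in> {p \<in> E0. \<Phi> p = 0}"
  then have p: "p \<in> E0" "\<Phi> p = 0" by auto
  define Y where "Y = {y \<in> EB. \<exists>x. (x, \<kappa>2 y) \<in> Poly_Mapping.keys p}"
  have "Y \<subseteq> inv_into EB \<kappa>2 ` snd ` Poly_Mapping.keys p"
  proof
    fix y assume "y \<in> Y"
    then obtain x where "y \<in> EB" "(x, \<kappa>2 y) \<in> Poly_Mapping.keys p" unfolding Y_def by blast
    then show "y \<in> inv_into EB \<kappa>2 ` snd ` Poly_Mapping.keys p"
      using U2.inj by (intro image_eqI[of _ _ "\<kappa>2 y"]) (force simp del: image_iff)+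
  qed
  then have "finite Y" by (rule finite_subset) simp
  obtain B where B: "B \<subseteq> Y" "independent B" "Y \<subseteq> span B"
    using maximal_independent_subset[of Y] by blast
  have fB: "finite B" using B(1) \<open>finite Y\<close> by (rule finite_subset)
  have BE: "B \<subseteq> EB" using B(1) by (auto simp: Y_def simp del: image_iff)
  obtain g where g: "\<forall>b\<in>B. g b \<in> EA" "p - (\<Sum>b\<in>B. tens (g b) b) \<in> K0"
    using K0_normal_form[OF fB BE p(1)] B(3) unfolding Y_def by blast
  have "\<Phi> (p - (\<Sum>b\<in>B. tens (g b) b)) = 0" using K0_sub g(2) by blast
  then have "(\<Sum>b\<in>B. \<Phi> (tens (g b) b)) = 0" using p(2) by (simp add: \<Phi>_linear)
  also have "(\<Sum>b\<in>B. \<Phi> (tens (g b) b)) = (\<Sum>b\<in>B. M (g b) (-1) b)"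
  proof (rule sum.cong[OF refl])
    fix b assume "b \<in> B"
    then have "g b \<in> EA" "b \<in> EB" using g(1) BE by blast+
    then show "\<Phi> (tens (g b) b) = M (g b) (-1) b" by (simp add: \<Phi>_single del: image_iff)
  qed
  finally have sum0: "(\<Sum>b\<in>B. M (g b) (-1) b) = 0" .
  have "g b = 0" if "b \<in> B" for b
    by (rule product_independent[OF fB B(2) BE _ sum0 that]) (use g(1) in blast)
  then have "(\<Sum>b\<in>B. tens (g b) b) = (\<Sum>b\<in>B. tens 0 b)"
    by simp
  also have "\<dots> \<in> K0" using BE by (intro K0_sum K0_zero) blast
  finally show "p \<in> K0" using K0_closed(2)[OF g(2)] by force
qed

definition tfib :: "'a \<Rightarrow> ('u \<times> 'v \<Rightarrow>\<^sub>0 complex) set" where "tfib v = {p \<in> E0. \<Phi> p = v}"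

lemma coset_K0: "p \<in> E0 \<Longrightarrow> coset K0 p = tfib (\<Phi> p)"
proof -
  assume p: "p \<in> E0"
  have "q \<in> coset K0 p" if "q \<in> tfib (\<Phi> p)" for q
    unfolding coset_def K0_eq
    by (intro CollectI exI[of _ "q - p"])
      (use that p pm.subspace_diff[OF E0_subspace] in \<open>simp add: \<Phi>_linear tfib_def\<close>)
  moreover have "coset K0 p \<subseteq> tfib (\<Phi> p)"
    using p pm.subspace_add[OF E0_subspace] by (auto simp: coset_def K0_eq \<Phi>_linear tfib_def)
  ultimately show ?thesis by blast
qed

lemma \<Phi>_image: "\<Phi> ` E0 = C"
proof
  have "\<Phi> p \<in> C" if "p \<in> E0" for p
    unfolding \<Phi>_def lext_def \<theta>_def
    by (intro subspace_sum[OF C_subspace] subspace_scale[OF C_subspace]) (auto simp: M_in)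
  then show "\<Phi> ` E0 \<subseteq> C" by blast
  have "subspace (\<Phi> ` E0)"
    unfolding subspace_def
  proof (intro conjI ballI allI)
    show "0 \<in> \<Phi> ` E0" using \<Phi>_linear(3) pm.subspace_0[OF E0_subspace] by (metis imageI)
    show "x + y \<in> \<Phi> ` E0" if "x \<in> \<Phi> ` E0" "y \<in> \<Phi> ` E0" for x y
      using that \<Phi>_linear(1) pm.subspace_add[OF E0_subspace] by (auto simp flip: \<Phi>_linear(1))
    show "s *v x \<in> \<Phi> ` E0" if "x \<in> \<Phi> ` E0" for s x
      using that pm.subspace_scale[OF E0_subspace] by (auto simp flip: \<Phi>_linear(4))
  qed
  moreover have "{M u (-1) v | u v. u \<in> EA \<and> v \<in> EB} \<subseteq> \<Phi> ` E0"
  proof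
    fix z assume "z \<in> {M u (-1) v | u v. u \<in> EA \<and> v \<in> EB}"
    then obtain u v where uv: "u \<in> EA" "v \<in> EB" "z = M u (-1) v" by blast
    then have "z = \<Phi> (tens u v)" by (simp add: \<Phi>_single del: image_iff)
    then show "z \<in> \<Phi> ` E0" using single_E0[OF uv(1,2)] by blast
  qed
  ultimately have "span {M u (-1) v | u v. u \<in> EA \<and> v \<in> EB} \<subseteq> \<Phi> ` E0" by (intro span_minimal)
  then show "C \<subseteq> \<Phi> ` E0" by (simp only: products_span)
qed

lemma tfib_nonempty: "v \<in> C \<Longrightarrow> \<exists>p. p \<in> tfib v"
  using \<Phi>_image by (auto simp: tfib_def)

lemma Union_tfib: "v \<in> C \<Longrightarrow> (\<And>p. p \<in> E0 \<Longrightarrow> \<Phi> p = v \<Longrightarrow> F p = Z) \<Longrightarrow> (\<Union>p\<in>tfib v. F p) = Z"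
  using tfib_nonempty by (fastforce simp: tfib_def)

lemma tensor_mode_pure_\<Phi>:
  assumes "u \<in> EA" "v \<in> EB" "u' \<in> EA" "v' \<in> EB"
  shows "tensor_mode_pure U1 U2 (\<kappa>1 u, \<kappa>2 v) n (\<kappa>1 u', \<kappa>2 v') \<in> E0"
    and "\<Phi> (tensor_mode_pure U1 U2 (\<kappa>1 u, \<kappa>2 v) n (\<kappa>1 u', \<kappa>2 v')) = M (M u (-1) v) n (M u' (-1) v')"
proof -
  have c: "M u i u' \<in> EA" "M v i v' \<in> EB" for i using assms U1.M_in_E U2.M_in_E by blast+
  have nz: "mode U1 (\<kappa>1 u) i (\<kappa>1 u') \<noteq> \<zero>\<^bsub>U1\<^esub> \<longleftrightarrow> M u i u' \<noteq> 0"
    "mode U2 (\<kappa>2 v) i (\<kappa>2 v') \<noteq> \<zero>\<^bsub>U2\<^esub> \<longleftrightarrow> M v i v' \<noteq> 0" for i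
    using U1.\<kappa>_eq[OF c(1) U1.E_closed(1), of i] U2.\<kappa>_eq[OF c(2) U2.E_closed(1), of i] assms
    by (simp_all add: U1.mode_U U2.mode_U U1.zero_U U2.zero_U del: image_iff)
  have eq: "tensor_mode_pure U1 U2 (\<kappa>1 u, \<kappa>2 v) n (\<kappa>1 u', \<kappa>2 v')
    = (\<Sum>i\<in>{i. M u i u' \<noteq> 0 \<and> M v (n - 1 - i) v' \<noteq> 0}.
         tens (M u i u') (M v (n - 1 - i) v'))"
    unfolding tensor_mode_pure_def fst_conv snd_conv nz using assms
    by (simp add: U1.mode_U U2.mode_U del: image_iff)
  show "tensor_mode_pure U1 U2 (\<kappa>1 u, \<kappa>2 v) n (\<kappa>1 u', \<kappa>2 v') \<in> E0"
    unfolding eq by (intro pm.subspace_sum[OF E0_subspace] single_E0 c)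
  show "\<Phi> (tensor_mode_pure U1 U2 (\<kappa>1 u, \<kappa>2 v) n (\<kappa>1 u', \<kappa>2 v')) = M (M u (-1) v) n (M u' (-1) v')"
    unfolding eq product_mode_sum(2)[OF assms(1,3,2,4)] \<Phi>_linear(5) \<Phi>_single[OF c] by simp
qed

lemma tensor_mode_\<Phi>:
  fixes n :: int
  assumes "p \<in> E0" "q \<in> E0"
  defines "r \<equiv> \<Sum>x\<in>Poly_Mapping.keys p. \<Sum>y\<in>Poly_Mapping.keys q.
       pscale (Poly_Mapping.lookup p x * Poly_Mapping.lookup q y) (tensor_mode_pure U1 U2 x n y)"
  shows "r \<in> E0" "\<Phi> r = M (\<Phi> p) n (\<Phi> q)"
proof -
  have pure: "tensor_mode_pure U1 U2 x n y \<in> E0 \<and> \<Phi> (tensor_mode_pure U1 U2 x n y) = M (\<theta> x) n (\<theta> y)"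
    if x: "x \<in> Poly_Mapping.keys p" and y: "y \<in> Poly_Mapping.keys q" for x y
  proof -
    obtain u v where uv: "u \<in> EA" "v \<in> EB" "x = (\<kappa>1 u, \<kappa>2 v)"
      using x assms(1) carrier_cases unfolding E0_def by blast
    obtain u' v' where uv': "u' \<in> EA" "v' \<in> EB" "y = (\<kappa>1 u', \<kappa>2 v')"
      using y assms(2) carrier_cases unfolding E0_def by blast
    show ?thesis
      unfolding uv(3) uv'(3) \<theta>_eq[OF uv(1,2)] \<theta>_eq[OF uv'(1,2)]
      using tensor_mode_pure_\<Phi>[OF uv(1,2) uv'(1,2)] by blast
  qed
  then show "r \<in> E0" unfolding r_def
    by (intro pm.subspace_sum[OF E0_subspace] pm.subspace_scale[OF E0_subspace]) blast
  have "\<Phi> r = (\<Sum>x\<in>Poly_Mapping.keys p. \<Sum>y\<in>Poly_Mapping.keys q.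
      (Poly_Mapping.lookup p x * Poly_Mapping.lookup q y) *v M (\<theta> x) n (\<theta> y))"
    unfolding r_def \<Phi>_linear using pure by (intro sum.cong refl) simp
  also have "\<dots> = M (\<Phi> p) n (\<Phi> q)"
    by (subst sum.swap)
      (simp add: \<Phi>_def lext_def M_sum_left M_sum_right M_scale_left M_scale_right scale_sum_right mult.commute)
  finally show "\<Phi> r = M (\<Phi> p) n (\<Phi> q)" .
qed

lemma tensor_voa_copy: "voa_copy_axioms scale M vac C om (tensor_voa U1 U2) tfib"
proof
  let ?T = "tensor_voa U1 U2"
  note defs = tensor_voa_def tensor_space_def quot_space_def module.defs voa.defs
  have inj: "v = w" if "v \<in> C" "w \<in> C" "tfib v = tfib w" for v w
    using that tfib_nonempty by (fastforce simp: tfib_def)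
  then show "inj_on tfib C" by (auto intro: inj_onI)
  have "carrier ?T = coset K0 ` E0" by (simp add: defs E0_def)
  also have "\<dots> = tfib ` \<Phi> ` E0" by (simp add: image_image coset_K0)
  finally show "carrier ?T = tfib ` C" by (simp add: \<Phi>_image)
  show "\<zero>\<^bsub>?T\<^esub> = tfib 0" by (simp add: defs K0_eq tfib_def)
  show "tfib v \<oplus>\<^bsub>?T\<^esub> tfib w = tfib (v + w)" if "v \<in> C" "w \<in> C" for v w
    using that by (simp add: defs)
      (intro Union_tfib, auto simp: coset_K0 \<Phi>_linear pm.subspace_add[OF E0_subspace])
  show "s \<odot>\<^bsub>?T\<^esub> tfib v = tfib (s *v v)" if "v \<in> C" for s v
    using that by (simp add: defs)
      (intro Union_tfib, auto simp: coset_K0 \<Phi>_linear pm.subspace_scale[OF E0_subspace])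
  show "mode ?T (tfib v) n (tfib w) = tfib (M v n w)" if "v \<in> C" "w \<in> C" for v n w
    using that by (simp add: defs tensor_mode_def)
      (intro Union_tfib, auto simp: coset_K0 tensor_mode_\<Phi>)
  have vacE: "vac \<in> EA" "vac \<in> EB" using U1.vac_in_E U2.vac_in_E .
  show "vacuum ?T = tfib vac"
    by (simp add: defs U1.vacuum_U U2.vacuum_U coset_K0 single_E0 vacE \<Phi>_single M_vac vac_in_C del: image_iff)
  \<comment> \<open>\<open>a\<close> \<otimes> \<open>vac\<close> + \<open>vac\<close> \<otimes>
    \<open>b\<close> is sent to \<open>a + b\<close>, which is \<open>om\<close>.\<close>
  show "conformal ?T = tfib om"
    by (simp add: defs U1.vacuum_U U2.vacuum_U U1.conformal_U U2.conformal_U coset_K0 single_E0 vacE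
        U1.om'_in U2.om'_in pm.subspace_add[OF E0_subspace] \<Phi>_linear \<Phi>_single M_vac M_create a_in_C b_in_C
        om_ab del: image_iff)
qed

end

end

section \<open>Embedding into a vector space\<close>

interpretation pmp: vector_space_pair pscale pscale by unfold_locales

context
  fixes V :: "(complex, 'a, 'm) module_scheme"
  assumes module_V: "Module.module complex_field V"
begin

interpretation V: Module.module complex_field V by (rule module_V)

text \<open>Keys outside the carrier are dropped, which makes the map linear on the whole type. It
  later serves as the projection through which the modes become total.\<close>

definition eval_formal :: "('a \<Rightarrow>\<^sub>0 complex) \<Rightarrow> 'a" where
  "eval_formal p = (\<Oplus>\<^bsub>V\<^esub>k\<in>Poly_Mapping.keys p \<inter> carrier V. Poly_Mapping.lookup p k \<odot>\<^bsub>V\<^esub> k)"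

lemma eval_formal_superset:
  assumes "finite S" "Poly_Mapping.keys p \<inter> carrier V \<subseteq> S" "S \<subseteq> carrier V"
  shows "eval_formal p = (\<Oplus>\<^bsub>V\<^esub>k\<in>S. Poly_Mapping.lookup p k \<odot>\<^bsub>V\<^esub> k)"
  unfolding eval_formal_def using assms
  by (intro V.add.finprod_mono_neutral_cong_left)
    (auto simp: in_keys_iff subset_iff intro!: V.smult_l_null[simplified])

lemma eval_formal_closed: "eval_formal p \<in> carrier V"
  unfolding eval_formal_def by (intro V.finsum_closed) auto

lemma eval_formal_add: "eval_formal (p + q) = eval_formal p \<oplus>\<^bsub>V\<^esub> eval_formal q"
proof -
  let ?S = "(Poly_Mapping.keys p \<union> Poly_Mapping.keys q) \<inter> carrier V"
  have "eval_formal (p + q) = (\<Oplus>\<^bsub>V\<^esub>k\<in>?S. Poly_Mapping.lookup (p + q) k \<odot>\<^bsub>V\<^esub> k)"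
    by (rule eval_formal_superset) (auto dest: subsetD[OF keys_add])
  also have "\<dots> = (\<Oplus>\<^bsub>V\<^esub>k\<in>?S. Poly_Mapping.lookup p k \<odot>\<^bsub>V\<^esub> k \<oplus>\<^bsub>V\<^esub> Poly_Mapping.lookup q k \<odot>\<^bsub>V\<^esub> k)"
    by (intro V.finsum_cong') (auto simp: lookup_add V.smult_l_distr[simplified])
  also have "\<dots> = (\<Oplus>\<^bsub>V\<^esub>k\<in>?S. Poly_Mapping.lookup p k \<odot>\<^bsub>V\<^esub> k) \<oplus>\<^bsub>V\<^esub> (\<Oplus>\<^bsub>V\<^esub>k\<in>?S. Poly_Mapping.lookup q k \<odot>\<^bsub>V\<^esub> k)"
    by (intro V.finsum_addf) auto
  also have "\<dots> = eval_formal p \<oplus>\<^bsub>V\<^esub> eval_formal q"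
    by (subst (1 2) eval_formal_superset[of ?S]) auto
  finally show ?thesis .
qed

lemma eval_formal_pscale: "eval_formal (pscale s p) = s \<odot>\<^bsub>V\<^esub> eval_formal p"
proof -
  let ?S = "Poly_Mapping.keys p \<inter> carrier V"
  have "eval_formal (pscale s p) = (\<Oplus>\<^bsub>V\<^esub>k\<in>?S. Poly_Mapping.lookup (pscale s p) k \<odot>\<^bsub>V\<^esub> k)"
    by (rule eval_formal_superset) (auto simp: in_keys_iff lookup_pscale)
  also have "\<dots> = (\<Oplus>\<^bsub>V\<^esub>k\<in>?S. s \<odot>\<^bsub>V\<^esub> (Poly_Mapping.lookup p k \<odot>\<^bsub>V\<^esub> k))"
    by (intro V.finsum_cong') (auto simp: lookup_pscale V.smult_assoc1[simplified])
  also have "\<dots> = s \<odot>\<^bsub>V\<^esub> eval_formal p"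
    unfolding eval_formal_def by (intro V.finsum_smult_ldistr[symmetric]) auto
  finally show ?thesis .
qed

lemma eval_formal_single: "v \<in> carrier V \<Longrightarrow> eval_formal (Poly_Mapping.single v 1) = v"
  using eval_formal_superset[of "{v}" "Poly_Mapping.single v 1"] V.smult_one[of v] by simp

text \<open>A linear section of \<open>eval_formal\<close> is obtained by killing its kernel and fixing a complement.\<close>

lemma linear_embedding:
  obtains \<iota> :: "'a \<Rightarrow> ('a \<Rightarrow>\<^sub>0 complex)"
  where "\<And>v w. v \<in> carrier V \<Longrightarrow> w \<in> carrier V \<Longrightarrow> \<iota> (v \<oplus>\<^bsub>V\<^esub> w) = \<iota> v + \<iota> w"
    "\<And>s v. v \<in> carrier V \<Longrightarrow> \<iota> (s \<odot>\<^bsub>V\<^esub> v) = pscale s (\<iota> v)"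
    "\<And>v. v \<in> carrier V \<Longrightarrow> eval_formal (\<iota> v) = v"
proof -
  let ?N = "{p. eval_formal p = \<zero>\<^bsub>V\<^esub>}"
  have eval_zero: "eval_formal 0 = \<zero>\<^bsub>V\<^esub>" by (simp add: eval_formal_def)
  have N: "pm.subspace ?N"
    unfolding pm.subspace_def using eval_zero V.smult_r_null
    by (auto simp: eval_formal_add eval_formal_pscale)
  obtain BN where BN: "BN \<subseteq> ?N" "pm.independent BN" "?N \<subseteq> pm.span BN"
    using pm.maximal_independent_subset[of ?N] by blast
  obtain B where B: "BN \<subseteq> B" "pm.independent B" "pm.span B = UNIV"
    using pm.maximal_independent_subset_extend[OF subset_UNIV BN(2)] by (metis top.extremum_uniqueI)
  obtain f where f: "Vector_Spaces.linear pscale pscale f" "\<forall>x\<in>B. f x = (if x \<in> BN then 0 else x)"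
    using pmp.linear_independent_extend[OF B(2), of "\<lambda>x. if x \<in> BN then 0 else x"] by blast
  interpret f: Vector_Spaces.linear pscale pscale f by (rule f(1))
  have fN: "f p = 0" if "p \<in> ?N" for p
  proof -
    have "p \<in> pm.span BN" using that BN by blast
    then show ?thesis
    proof (induction rule: pm.span_induct_alt)
      case base
      show ?case by (rule f.zero)
    next
      case (step s x y)
      then show ?case using f(2) B(1) by (auto simp: f.add f.scale)
    qed
  qed
  have neg: "eval_formal (p - q) = eval_formal p \<ominus>\<^bsub>V\<^esub> eval_formal q" for p q
  proof -
    have "eval_formal (p - q) \<oplus>\<^bsub>V\<^esub> eval_formal q = eval_formal p"
      using eval_formal_add[of "p - q" q] by simp
    then show ?thesis
      using eval_formal_closed by (metis V.add.inv_solve_right a_minus_def)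
  qed
  have fid: "p - f p \<in> ?N" for p
  proof -
    have "p \<in> pm.span B" by (simp add: B(3))
    then show ?thesis
    proof (induction rule: pm.span_induct_alt)
      case base
      show ?case by (simp add: f.zero eval_zero)
    next
      case (step s x y)
      then have "x - f x \<in> ?N" using f(2) BN(1) pm.subspace_0[OF N] by auto
      then have "pscale s (x - f x) + (y - f y) \<in> ?N"
        using step by (intro pm.subspace_add[OF N] pm.subspace_scale[OF N])
      then show ?case by (simp add: f.add f.scale pm.scale_right_diff_distrib algebra_simps)
    qed
  qed
  have ev_f: "eval_formal (f p) = eval_formal p" for p
    using eval_formal_add[of "p - f p" "f p"] fid[of p] by (simp add: eval_formal_closed)
  \<comment> \<open>\<open>Poly_Mapping.single v 1\<close> is not additive in \<open>v\<close>, but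
    its defects evaluate to zero; as \<open>f\<close> depends only on the evaluation, it removes
    them.\<close>
  have f_eq: "f p = f q" if "eval_formal p = eval_formal q" for p q
  proof -
    have "p - q \<in> ?N" using that eval_formal_closed by (simp add: neg a_minus_def V.r_neg)
    then have "f (p - q) = 0" by (rule fN)
    then show ?thesis by (simp add: f.diff)
  qed
  show thesis
  proof (rule that[of "\<lambda>v. f (Poly_Mapping.single v 1)"])
    show "f (Poly_Mapping.single (v \<oplus>\<^bsub>V\<^esub> w) 1) = f (Poly_Mapping.single v 1) + f (Poly_Mapping.single w 1)"
      if "v \<in> carrier V" "w \<in> carrier V" for v w
      unfolding f.add[symmetric] using that by (intro f_eq) (simp add: eval_formal_add eval_formal_single)
    show "f (Poly_Mapping.single (s \<odot>\<^bsub>V\<^esub> v) 1) = pscale s (f (Poly_Mapping.single v 1))"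
      if "v \<in> carrier V" for s v
      unfolding f.scale[symmetric] using that by (intro f_eq) (simp only: eval_formal_pscale eval_formal_single
          V.smult_closed complex_field_simps UNIV_I)
    show "eval_formal (f (Poly_Mapping.single v 1)) = v" if "v \<in> carrier V" for v
      using that by (simp add: ev_f eval_formal_single)
  qed
qed

end

section \<open>The embedded copy of V as a \<open>voa_model\<close>\<close>

locale embedded_voa = vertex_operator_algebra V c
  for V :: "('a, 'm) voa_scheme" and c +
  fixes \<iota> :: "'a \<Rightarrow> ('a \<Rightarrow>\<^sub>0 complex)" and \<rho> :: "('a \<Rightarrow>\<^sub>0 complex) \<Rightarrow> 'a"
  assumes \<iota>_add: "v \<in> carrier V \<Longrightarrow> w \<in> carrier V \<Longrightarrow> \<iota> (v \<oplus>\<^bsub>V\<^esub> w) = \<iota> v + \<iota> w"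
    and \<iota>_smult: "v \<in> carrier V \<Longrightarrow> \<iota> (s \<odot>\<^bsub>V\<^esub> v) = pscale s (\<iota> v)"
    and \<rho>_closed: "\<rho> t \<in> carrier V"
    and \<rho>_add: "\<rho> (t + t') = \<rho> t \<oplus>\<^bsub>V\<^esub> \<rho> t'"
    and \<rho>_scale: "\<rho> (pscale s t) = s \<odot>\<^bsub>V\<^esub> \<rho> t"
    and \<rho>_\<iota>: "v \<in> carrier V \<Longrightarrow> \<rho> (\<iota> v) = v"
begin

abbreviation "Cimg \<equiv> \<iota> ` carrier V"

definition Mi :: "('a \<Rightarrow>\<^sub>0 complex) \<Rightarrow> int \<Rightarrow> ('a \<Rightarrow>\<^sub>0 complex) \<Rightarrow> ('a \<Rightarrow>\<^sub>0 complex)" where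
  "Mi u n v = \<iota> (mode V (\<rho> u) n (\<rho> v))"

lemma Mi_\<iota>: "u \<in> carrier V \<Longrightarrow> v \<in> carrier V \<Longrightarrow> Mi (\<iota> u) n (\<iota> v) = \<iota> (mode V u n v)"
  by (simp add: Mi_def \<rho>_\<iota>)

lemma \<iota>_eq: "v \<in> carrier V \<Longrightarrow> w \<in> carrier V \<Longrightarrow> \<iota> v = \<iota> w \<longleftrightarrow> v = w"
  using \<rho>_\<iota> by metis

lemma \<iota>_zero: "\<iota> \<zero>\<^bsub>V\<^esub> = 0"
  using \<iota>_add[of "\<zero>\<^bsub>V\<^esub>" "\<zero>\<^bsub>V\<^esub>"] by simp

lemma \<iota>_minus: "v \<in> carrier V \<Longrightarrow> \<iota> (\<ominus>\<^bsub>V\<^esub> v) = - \<iota> v"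
  using \<iota>_add[of "\<ominus>\<^bsub>V\<^esub> v" v] by (simp add: \<iota>_zero l_neg eq_neg_iff_add_eq_0)

lemma \<iota>_diff: "v \<in> carrier V \<Longrightarrow> w \<in> carrier V \<Longrightarrow> \<iota> (v \<ominus>\<^bsub>V\<^esub> w) = \<iota> v - \<iota> w"
  by (simp add: a_minus_def \<iota>_add \<iota>_minus)

lemma \<iota>_finsum: "(\<And>i. i \<in> A \<Longrightarrow> f i \<in> carrier V) \<Longrightarrow> \<iota> (finsum V f A) = (\<Sum>i\<in>A. \<iota> (f i))"
proof (induction A rule: infinite_finite_induct)
  case (infinite A)
  then show ?case by (simp add: finsum_def finprod_def \<iota>_zero)
next
  case empty
  then show ?case by (simp add: \<iota>_zero)
next
  case (insert i A)
  then show ?case by (subst finsum_insert) (auto simp: \<iota>_add intro!: finsum_closed)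
qed

lemma fsum_eq:
  assumes "\<And>i. f i \<in> carrier V" "\<And>i. i \<ge> N \<Longrightarrow> f i = \<zero>\<^bsub>V\<^esub>"
  shows "\<iota> (fsum V f) = (\<Sum>i<N. \<iota> (f i))"
proof -
  have "fsum V f = gfinprod (add_monoid V) f {..<N}"
    using assms by (intro add.gfinprod_mono_neutral_cong_right) auto
  also have "\<dots> = finsum V f {..<N}"
    using assms(1) by (intro add.gfinprod_eq_finprod) auto
  finally show ?thesis using assms by (simp add: \<iota>_finsum)
qed

lemma smult_V_closed: "v \<in> carrier V \<Longrightarrow> s \<odot>\<^bsub>V\<^esub> v \<in> carrier V"
  by simp

lemma mode_zero: "u \<in> carrier V \<Longrightarrow> mode V u n \<zero>\<^bsub>V\<^esub> = \<zero>\<^bsub>V\<^esub>" "u \<in> carrier V \<Longrightarrow> mode V \<zero>\<^bsub>V\<^esub> n u = \<zero>\<^bsub>V\<^esub>"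
  using mode_smult_right[of u "\<zero>\<^bsub>V\<^esub>" n 0] mode_smult_left[of "\<zero>\<^bsub>V\<^esub>" u 0 n] smult_l_null[simplified]
  by (simp_all add: mode_closed)

lemma mode_eventually_zero:
  assumes "u \<in> carrier V" "v \<in> carrier V" shows "\<exists>N. \<forall>i\<ge>N. mode V u (n + int i) v = \<zero>\<^bsub>V\<^esub>"
proof -
  obtain N where "\<forall>k\<ge>N. mode V u k v = \<zero>\<^bsub>V\<^esub>" using truncation[OF assms] by blast
  then have "\<forall>i\<ge>nat (N - n). mode V u (n + int i) v = \<zero>\<^bsub>V\<^esub>" by auto
  then show ?thesis by blast
qed

lemma subspace_image: "vsubspace V S \<Longrightarrow> pm.subspace (\<iota> ` S)"
proof -
  assume S: "vsubspace V S"
  interpret S: submodule S complex_field V by (rule S)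
  have sub: "S \<subseteq> carrier V" using S.subset by simp
  show ?thesis unfolding pm.subspace_def
  proof (intro conjI ballI allI)
    show "0 \<in> \<iota> ` S" using S.one_closed \<iota>_zero by (force intro: image_eqI[of _ _ "\<zero>\<^bsub>V\<^esub>"])
    show "x + y \<in> \<iota> ` S" if x: "x \<in> \<iota> ` S" and y: "y \<in> \<iota> ` S" for x y
    proof -
      obtain v where v: "v \<in> S" "x = \<iota> v" using x by (rule imageE)
      obtain w where w: "w \<in> S" "y = \<iota> w" using y by (rule imageE)
      have "x + y = \<iota> (v \<oplus>\<^bsub>V\<^esub> w)" using v w sub by (simp add: \<iota>_add subset_iff)
      moreover have "v \<oplus>\<^bsub>V\<^esub> w \<in> S" using S.m_closed[OF v(1) w(1)] by simp
      ultimately show ?thesis by simp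
    qed
    show "pscale s x \<in> \<iota> ` S" if x: "x \<in> \<iota> ` S" for s x
    proof -
      obtain v where v: "v \<in> S" "x = \<iota> v" using x by (rule imageE)
      have "pscale s x = \<iota> (s \<odot>\<^bsub>V\<^esub> v)" using v sub by (simp add: \<iota>_smult subset_iff)
      moreover have "s \<odot>\<^bsub>V\<^esub> v \<in> S" using S.smult_closed[OF _ v(1), of s] by simp
      ultimately show ?thesis by simp
    qed
  qed
qed

lemma vsubspace_vimage: "pm.subspace J \<Longrightarrow> vsubspace V {x \<in> carrier V. \<iota> x \<in> J}"
  by (rule submoduleI)
    (auto simp: \<iota>_zero \<iota>_minus \<iota>_add \<iota>_smult pm.subspace_0 pm.subspace_neg pm.subspace_add pm.subspace_scale)

lemma vspace_pscale: "vspace pscale" by unfold_locales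

lemma voa_model: "voa_model pscale Mi Cimg (\<iota> (vacuum V)) (\<iota> (conformal V)) c"
proof (intro voa_model.intro vspace_pscale voa_model_axioms.intro)
  have carrier_sub: "vsubspace V (carrier V)"
    by (rule submoduleI) auto
  then show "pm.subspace Cimg" by (rule subspace_image)
  show "Mi u n v \<in> Cimg" for u n v by (simp add: Mi_def mode_closed \<rho>_closed)
  show "Mi (u + u') n v = Mi u n v + Mi u' n v" for u u' n v
    by (simp add: Mi_def \<rho>_add \<rho>_closed mode_add_left mode_closed \<iota>_add)
  show "Mi (pscale s u) n v = pscale s (Mi u n v)" for s u n v
    by (simp add: Mi_def \<rho>_scale \<rho>_closed mode_smult_left mode_closed \<iota>_smult)
  show "Mi u n (v + v') = Mi u n v + Mi u n v'" for u n v v'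
    by (simp add: Mi_def \<rho>_add \<rho>_closed mode_add_right mode_closed \<iota>_add)
  show "Mi u n (pscale s v) = pscale s (Mi u n v)" for s u n v
    by (simp add: Mi_def \<rho>_scale \<rho>_closed mode_smult_right mode_closed \<iota>_smult)
  show "\<exists>N. \<forall>n\<ge>N. Mi u n v = 0" for u v
  proof -
    obtain N where "\<forall>n\<ge>N. mode V (\<rho> u) n (\<rho> v) = \<zero>\<^bsub>V\<^esub>" using truncation \<rho>_closed by blast
    then have "\<forall>n\<ge>N. Mi u n v = 0" by (simp add: Mi_def \<iota>_zero)
    then show ?thesis by blast
  qed
  show "\<iota> (vacuum V) \<in> Cimg" "\<iota> (conformal V) \<in> Cimg" using vacuum_closed conformal_closed by auto
  show "Mi (\<iota> (vacuum V)) n v = (if n = -1 then v else 0)" if "v \<in> Cimg" for n v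
    using that vacuum_closed by (auto simp: Mi_\<iota> vacuum_mode \<iota>_zero)
  show "Mi v (-1) (\<iota> (vacuum V)) = v" if "v \<in> Cimg" for v
    using that vacuum_closed by (auto simp: Mi_\<iota> creation)
  show "Mi v n (\<iota> (vacuum V)) = 0" if "n \<ge> 0" for n v
    using that vacuum_closed by (simp add: Mi_def \<rho>_\<iota> creation \<rho>_closed \<iota>_zero)
  show "Mi (\<iota> (conformal V)) (m + 1) (Mi (\<iota> (conformal V)) (n + 1) v)
      - Mi (\<iota> (conformal V)) (n + 1) (Mi (\<iota> (conformal V)) (m + 1) v)
      = pscale (of_int (m - n)) (Mi (\<iota> (conformal V)) (m + n + 1) v)
        + pscale (if m + n = 0 then of_int (m ^ 3 - m) / 12 * c else 0) v" if v: "v \<in> Cimg" for m n v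
  proof -
    obtain x where x: "v = \<iota> x" "x \<in> carrier V" using v by (rule imageE)
    note cl = x(2) conformal_closed mode_closed[OF conformal_closed x(2)]
      mode_closed[OF conformal_closed mode_closed[OF conformal_closed x(2)]] smult_V_closed
    show ?thesis
      using arg_cong[OF virasoro[OF x(2), of m n], of \<iota>]
      unfolding x(1) by (simp only: Mi_\<iota> vir_op_def \<iota>_diff \<iota>_add \<iota>_smult cl)
  qed
  show "Mi (Mi (\<iota> (conformal V)) 0 u) n v = pscale (- of_int n) (Mi u (n - 1) v)" for u n v
    using arg_cong[OF translation[OF \<rho>_closed \<rho>_closed, of u n v], of \<iota>] conformal_closed
    by (simp only: Mi_def \<rho>_\<iota> mode_closed vir_op_def \<iota>_smult \<rho>_closed) simp
  fix m :: int and u l v n w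
  let ?u = "\<rho> u" and ?v = "\<rho> v" and ?w = "\<rho> w"
  note cl = \<rho>_closed mode_closed smult_V_closed minus_closed
  let ?f = "\<lambda>i. (of_int m gchoose i) \<odot>\<^bsub>V\<^esub> mode V (mode V ?u (l + int i) ?v) (m + n - int i) ?w"
  let ?g = "\<lambda>i. ((-1) ^ i * (of_int l gchoose i)) \<odot>\<^bsub>V\<^esub>
            (mode V ?u (m + l - int i) (mode V ?v (n + int i) ?w)
             \<ominus>\<^bsub>V\<^esub> ((-1) powi l) \<odot>\<^bsub>V\<^esub> mode V ?v (n + l - int i) (mode V ?u (m + int i) ?w))"
  \<comment> \<open>Beyond the larger of these three bounds every term of either sum is zero, so
    each \<open>fsum\<close> equals all longer partial sums.\<close>
  obtain N1 where N1: "\<forall>i\<ge>N1. mode V ?u (l + int i) ?v = \<zero>\<^bsub>V\<^esub>" using mode_eventually_zero \<rho>_closed by blast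
  obtain N2 where N2: "\<forall>i\<ge>N2. mode V ?v (n + int i) ?w = \<zero>\<^bsub>V\<^esub>" using mode_eventually_zero \<rho>_closed by blast
  obtain N3 where N3: "\<forall>i\<ge>N3. mode V ?u (m + int i) ?w = \<zero>\<^bsub>V\<^esub>" using mode_eventually_zero \<rho>_closed by blast
  have bor: "fsum V ?f = fsum V ?g" using borcherds[OF \<rho>_closed \<rho>_closed \<rho>_closed] .
  have "(\<Sum>i<K. pscale (of_int m gchoose i) (Mi (Mi u (l + int i) v) (m + n - int i) w))
      = (\<Sum>i<K. pscale ((-1) ^ i * (of_int l gchoose i))
          (Mi u (m + l - int i) (Mi v (n + int i) w)
           - pscale ((-1) powi l) (Mi v (n + l - int i) (Mi u (m + int i) w))))" if K: "K \<ge> max N1 (max N2 N3)" for K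
  proof -
    have r0: "s \<odot>\<^bsub>V\<^esub> \<zero>\<^bsub>V\<^esub> = \<zero>\<^bsub>V\<^esub>" for s using smult_r_null[of s] by simp
    have n0: "\<ominus>\<^bsub>V\<^esub> \<zero>\<^bsub>V\<^esub> = \<zero>\<^bsub>V\<^esub>" by (rule minus_equality) simp_all
    have "\<iota> (fsum V ?f) = (\<Sum>i<K. \<iota> (?f i))"
      using N1 K by (intro fsum_eq) (auto simp: cl mode_zero r0)
    moreover have "\<iota> (fsum V ?g) = (\<Sum>i<K. \<iota> (?g i))"
      using N2 N3 K by (intro fsum_eq) (auto simp: cl mode_zero r0 n0 a_minus_def)
    ultimately have "(\<Sum>i<K. \<iota> (?f i)) = (\<Sum>i<K. \<iota> (?g i))" using bor by simp
    then show ?thesis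
      by (simp add: Mi_def \<rho>_\<iota> cl \<iota>_smult \<iota>_diff)
  qed
  then show "\<exists>N. \<forall>K\<ge>N. (\<Sum>i<K. pscale (of_int m gchoose i) (Mi (Mi u (l + int i) v) (m + n - int i) w))
      = (\<Sum>i<K. pscale ((-1) ^ i * (of_int l gchoose i))
          (Mi u (m + l - int i) (Mi v (n + int i) w)
           - pscale ((-1) powi l) (Mi v (n + l - int i) (Mi u (m + int i) w))))"
    by blast
qed

sublocale T: voa_model pscale Mi Cimg "\<iota> (vacuum V)" "\<iota> (conformal V)" c
  by (rule voa_model)

lemma wt_eq: "T.wt n = \<iota> ` weight_space V n"
proof -
  have "Mi (\<iota> (conformal V)) 1 (\<iota> x) = pscale (of_int n) (\<iota> x) \<longleftrightarrow> vir_op V 0 x = of_int n \<odot>\<^bsub>V\<^esub> x"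
    if "x \<in> carrier V" for x
    using that conformal_closed
    by (simp add: Mi_\<iota> vir_op_def flip: \<iota>_smult) (rule \<iota>_eq, simp_all add: mode_closed)
  then show ?thesis by (auto simp: T.wt_def weight_space_def)
qed

lemma weight_space_sub: "weight_space V n \<subseteq> carrier V" by (auto simp: weight_space_def)

lemma basis_expansion:
  assumes "is_basis V S B" "S \<subseteq> carrier V" "v \<in> S"
  obtains f where "\<iota> v = (\<Sum>b\<in>B. pscale (f b) (\<iota> b))"
proof -
  obtain f where f: "v = (\<Oplus>\<^bsub>V\<^esub>b\<in>B. f b \<odot>\<^bsub>V\<^esub> b)"
    using assms(1,3) unfolding is_basis_def by blast
  have B: "B \<subseteq> carrier V" using assms unfolding is_basis_def by blast
  then have "\<iota> v = (\<Sum>b\<in>B. \<iota> (f b \<odot>\<^bsub>V\<^esub> b))" unfolding f by (intro \<iota>_finsum smult_V_closed) blast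
  also have "\<dots> = (\<Sum>b\<in>B. pscale (f b) (\<iota> b))" using B by (intro sum.cong refl \<iota>_smult) blast
  finally show thesis by (rule that)
qed

text \<open>\<open>is_basis\<close> expresses independence as uniqueness of coefficients, which is
  applied to the zero vector.\<close>

lemma basis_independent:
  assumes "is_basis V S B" "S \<subseteq> carrier V" "\<zero>\<^bsub>V\<^esub> \<in> S"
    and zero: "(\<Sum>b\<in>B. pscale (f b) (\<iota> b)) = 0" and b: "b \<in> B"
  shows "f b = 0"
proof -
  have B: "B \<subseteq> carrier V" using assms unfolding is_basis_def by blast
  have rep: "\<iota> (\<Oplus>\<^bsub>V\<^esub>b\<in>B. g b \<odot>\<^bsub>V\<^esub> b) = (\<Sum>b\<in>B. pscale (g b) (\<iota> b))" for g
  proof -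
    have "\<iota> (\<Oplus>\<^bsub>V\<^esub>b\<in>B. g b \<odot>\<^bsub>V\<^esub> b) = (\<Sum>b\<in>B. \<iota> (g b \<odot>\<^bsub>V\<^esub> b))"
      using B by (intro \<iota>_finsum smult_V_closed) blast
    also have "\<dots> = (\<Sum>b\<in>B. pscale (g b) (\<iota> b))" using B by (intro sum.cong refl \<iota>_smult) blast
    finally show ?thesis .
  qed
  have rep0: "\<zero>\<^bsub>V\<^esub> = (\<Oplus>\<^bsub>V\<^esub>b\<in>B. g b \<odot>\<^bsub>V\<^esub> b)" if "(\<Sum>b\<in>B. pscale (g b) (\<iota> b)) = 0" for g
    using rep[of g] that B \<iota>_zero by (subst \<iota>_eq[symmetric]) (auto intro!: finsum_closed)
  have "\<exists>!g. g \<in> B \<rightarrow>\<^sub>E UNIV \<and> \<zero>\<^bsub>V\<^esub> = (\<Oplus>\<^bsub>V\<^esub>b\<in>B. g b \<odot>\<^bsub>V\<^esub> b)"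
    using assms(1,3) unfolding is_basis_def by blast
  moreover have "restrict f B \<in> B \<rightarrow>\<^sub>E UNIV \<and> \<zero>\<^bsub>V\<^esub> = (\<Oplus>\<^bsub>V\<^esub>b\<in>B. restrict f B b \<odot>\<^bsub>V\<^esub> b)"
    using zero by (intro conjI rep0) (auto cong: sum.cong)
  moreover have "(\<lambda>b\<in>B. 0) \<in> B \<rightarrow>\<^sub>E UNIV \<and> \<zero>\<^bsub>V\<^esub> = (\<Oplus>\<^bsub>V\<^esub>b\<in>B. (\<lambda>b\<in>B. 0) b \<odot>\<^bsub>V\<^esub> b)"
    by (intro conjI rep0) (auto cong: sum.cong)
  ultimately have "restrict f B = (\<lambda>b\<in>B. 0)" by blast
  then have "restrict f B b = (\<lambda>b\<in>B. 0) b" by simp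
  then show ?thesis using b by simp
qed

lemma iso_copy:
  assumes "voa_copy_axioms pscale Mi (\<iota> (vacuum V)) Cimg (\<iota> (conformal V)) U \<kappa>"
  shows "voa_isomorphic V U"
proof -
  note A = assms[unfolded voa_copy_axioms_def]
  have C: "\<iota> v \<in> Cimg" if "v \<in> carrier V" for v using that by simp
  show ?thesis unfolding voa_isomorphic_def
  proof (intro exI[of _ "\<kappa> \<circ> \<iota>"] conjI ballI allI)
    have "bij_betw \<iota> (carrier V) Cimg" by (auto simp: bij_betw_def inj_on_def \<iota>_eq)
    moreover have "bij_betw \<kappa> Cimg (carrier U)" using A by (simp add: bij_betw_def)
    ultimately show "bij_betw (\<kappa> \<circ> \<iota>) (carrier V) (carrier U)" by (rule bij_betw_trans)
  qed (use A C vacuum_closed conformal_closed in \<open>auto simp: \<iota>_add \<iota>_smult Mi_\<iota>\<close>)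
qed

end

section \<open>Semisimplicity of the Griess algebra\<close>

context embedded_voa begin

lemma moonshine_model_embedded:
  assumes moon: "moonshine_type V c" and c: "c \<noteq> 0"
    and gen: "generated_by V (weight_space V 2)" and dim: "has_dim V (weight_space V 2) 2"
  shows "moonshine_model pscale Mi Cimg (\<iota> (vacuum V)) (\<iota> (conformal V)) c"
proof (unfold_locales)
  have simple: "simple_voa V c" using moon by (simp add: moonshine_type_def)
  show "\<iota> (vacuum V) \<noteq> 0"
  proof
    assume "\<iota> (vacuum V) = 0"
    then have 0: "vacuum V = \<zero>\<^bsub>V\<^esub>" using \<iota>_eq[OF vacuum_closed zero_closed] \<iota>_zero by simp
    have "v = \<zero>\<^bsub>V\<^esub>" if "v \<in> carrier V" for v
      using vacuum_mode[OF that, of "-1"] mode_zero(2)[OF that] 0 by simp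
    then have "carrier V = {\<zero>\<^bsub>V\<^esub>}" by auto
    then show False using simple by (simp add: simple_voa_def)
  qed
  show "c \<noteq> 0" by (rule c)
  fix J
  show "J = {0} \<or> J = Cimg"
    if J: "pm.subspace J" "J \<subseteq> Cimg" "\<And>u n v. u \<in> Cimg \<Longrightarrow> v \<in> J \<Longrightarrow> Mi u n v \<in> J"
  proof -
    let ?I = "{x \<in> carrier V. \<iota> x \<in> J}"
    have "mode V u n v \<in> ?I" if "u \<in> carrier V" "v \<in> ?I" for u n v
      using J(3)[of "\<iota> u" "\<iota> v" n] that by (simp add: Mi_\<iota> mode_closed)
    then have disj: "?I = {\<zero>\<^bsub>V\<^esub>} \<or> ?I = carrier V"
      using simple vsubspace_vimage[OF J(1)] unfolding simple_voa_def by blast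
    have J_eq: "J = \<iota> ` ?I" using J(2) by blast
    from disj show ?thesis
    proof
      assume "?I = {\<zero>\<^bsub>V\<^esub>}"
      then have "J = \<iota> ` {\<zero>\<^bsub>V\<^esub>}" using J_eq by (rule subst)
      then show ?thesis by (simp add: \<iota>_zero)
    next
      assume "?I = carrier V"
      then have "J = Cimg" using J_eq by (rule subst)
      then show ?thesis ..
    qed
  qed
next
  show "T.wt n = {0}" if "n < 0" for n
    using moon that by (simp add: wt_eq moonshine_type_def \<iota>_zero)
  have "T.wt 0 = \<iota> ` {s \<odot>\<^bsub>V\<^esub> vacuum V | s. True}"
    using moon by (simp add: wt_eq moonshine_type_def)
  then show "T.wt 0 = {pscale s (\<iota> (vacuum V)) | s. True}"
    using vacuum_closed by (auto simp flip: \<iota>_smult)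
  show "T.wt 1 = {0}"
    using moon by (simp add: wt_eq moonshine_type_def \<iota>_zero)
  show "\<exists>B. finite B \<and> T.wt n \<subseteq> pm.span B" for n
  proof -
    obtain B where B: "is_basis V (weight_space V n) B"
      using weight_space_finite_dim unfolding has_dim_def by blast
    have "\<iota> v \<in> pm.span (\<iota> ` B)" if v: "v \<in> weight_space V n" for v
    proof -
      obtain f where "\<iota> v = (\<Sum>b\<in>B. pscale (f b) (\<iota> b))"
        using B weight_space_sub v by (rule basis_expansion)
      also have "\<dots> \<in> pm.span (\<iota> ` B)"
        by (intro pm.span_sum pm.span_scale pm.span_base) blast
      finally show ?thesis .
    qed
    then have "T.wt n \<subseteq> pm.span (\<iota> ` B)" by (auto simp: wt_eq)
    moreover have "finite (\<iota> ` B)" using B by (simp add: is_basis_def)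
    ultimately show ?thesis by blast
  qed
  show "A = Cimg" if A: "T.subalg A" "T.wt 2 \<subseteq> A" for A
  proof -
    let ?A = "{x \<in> carrier V. \<iota> x \<in> A}"
    have "mode V u n v \<in> ?A" if "u \<in> ?A" "v \<in> ?A" for u n v
      using A that by (auto simp: T.subalg_def mode_closed simp flip: Mi_\<iota>)
    then have "vertex_subalgebra V ?A"
      unfolding vertex_subalgebra_def
      using A vsubspace_vimage vacuum_closed by (auto simp: T.subalg_def)
    moreover have "weight_space V 2 \<subseteq> ?A" using A(2) weight_space_sub by (auto simp: wt_eq)
    ultimately have "?A = carrier V" using gen unfolding generated_by_def by blast
    moreover have "A \<subseteq> Cimg" using A by (simp add: T.subalg_def)
    ultimately show ?thesis by blast
  qed
  show "\<exists>a b. T.wt 2 = {pscale s a + pscale t b | s t. True} \<and>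
      (\<forall>s t. pscale s a + pscale t b = 0 \<longrightarrow> s = 0 \<and> t = 0)"
  proof -
    obtain B where B: "is_basis V (weight_space V 2) B" "card B = 2" and S: "vsubspace V (weight_space V 2)"
      using dim unfolding has_dim_def by blast
    obtain b1 b2 where b: "B = {b1, b2}" "b1 \<noteq> b2" using B(2) by (auto simp: card_2_iff)
    have bS: "b1 \<in> weight_space V 2" "b2 \<in> weight_space V 2" using B(1) b by (auto simp: is_basis_def)
    interpret S: submodule "weight_space V 2" complex_field V by (rule S)
    have zero: "\<zero>\<^bsub>V\<^esub> \<in> weight_space V 2" using S.one_closed by simp
    have sub: "pm.subspace (T.wt 2)" by (rule T.subspace_wt)
    have b': "\<iota> b1 \<in> T.wt 2" "\<iota> b2 \<in> T.wt 2" using bS by (auto simp: wt_eq)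
    show ?thesis
    proof (rule exI[of _ "\<iota> b1"], rule exI[of _ "\<iota> b2"], intro conjI equalityI subsetI allI impI)
      fix x assume "x \<in> T.wt 2"
      then obtain v where v: "v \<in> weight_space V 2" "x = \<iota> v" by (auto simp: wt_eq)
      obtain f where "\<iota> v = (\<Sum>b\<in>B. pscale (f b) (\<iota> b))"
        using B(1) weight_space_sub v(1) by (rule basis_expansion)
      then show "x \<in> {pscale s (\<iota> b1) + pscale t (\<iota> b2) | s t. True}" using b v by auto
    next
      fix x assume "x \<in> {pscale s (\<iota> b1) + pscale t (\<iota> b2) | s t. True}"
      then show "x \<in> T.wt 2" using b' by (auto intro!: pm.subspace_add[OF sub] pm.subspace_scale[OF sub])
    next
      fix s t assume st: "pscale s (\<iota> b1) + pscale t (\<iota> b2) = 0"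
      have "(\<Sum>b\<in>B. pscale (if b = b1 then s else t) (\<iota> b)) = 0" using st b by simp
      from basis_independent[OF B(1) weight_space_sub zero this] b
      show "s = 0" "t = 0" by force+
    qed
  qed
qed

lemma left_ideal_image:
  assumes "algebra_left_ideal V (weight_space V 2) (griess_product V) I"
  shows "pm.subspace (\<iota> ` I)" "\<iota> ` I \<subseteq> T.wt 2" "x \<in> T.wt 2 \<Longrightarrow> y \<in> \<iota> ` I \<Longrightarrow> Mi x 1 y \<in> \<iota> ` I"
proof -
  have I: "vsubspace V I" "I \<subseteq> weight_space V 2"
    "\<And>a x. a \<in> weight_space V 2 \<Longrightarrow> x \<in> I \<Longrightarrow> mode V a 1 x \<in> I"
    using assms by (auto simp: algebra_left_ideal_def griess_product_def)
  show "pm.subspace (\<iota> ` I)" by (rule subspace_image[OF I(1)])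
  show "\<iota> ` I \<subseteq> T.wt 2" using I(2) by (auto simp: wt_eq)
  show "Mi x 1 y \<in> \<iota> ` I" if x: "x \<in> T.wt 2" and y: "y \<in> \<iota> ` I"
  proof -
    obtain a where a: "a \<in> weight_space V 2" "x = \<iota> a" using x by (auto simp: wt_eq)
    obtain z where z: "z \<in> I" "y = \<iota> z" using y by blast
    have "Mi x 1 y = \<iota> (mode V a 1 z)"
      using a z I(2) weight_space_sub by (auto intro!: Mi_\<iota>)
    then show ?thesis using I(3)[OF a(1) z(1)] by blast
  qed
qed

lemma left_ideal_vimage:
  assumes "pm.subspace J" "J \<subseteq> T.wt 2" "\<And>x y. x \<in> T.wt 2 \<Longrightarrow> y \<in> J \<Longrightarrow> Mi x 1 y \<in> J"
  shows "algebra_left_ideal V (weight_space V 2) (griess_product V) {x \<in> carrier V. \<iota> x \<in> J}"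
    and "\<iota> ` {x \<in> carrier V. \<iota> x \<in> J} = J"
proof -
  have sub: "x \<in> weight_space V 2" if "x \<in> carrier V" "\<iota> x \<in> J" for x
  proof -
    have "\<iota> x \<in> \<iota> ` weight_space V 2" using that assms(2) by (auto simp: wt_eq)
    then obtain z where "z \<in> weight_space V 2" "\<iota> x = \<iota> z" by blast
    then show ?thesis using that(1) \<iota>_eq weight_space_sub by blast
  qed
  have "mode V a 1 x \<in> carrier V \<and> \<iota> (mode V a 1 x) \<in> J"
    if "a \<in> weight_space V 2" "x \<in> carrier V" "\<iota> x \<in> J" for a x
    using that assms(3)[of "\<iota> a" "\<iota> x"] weight_space_sub by (auto simp: wt_eq Mi_\<iota> mode_closed subset_iff)
  then show "algebra_left_ideal V (weight_space V 2) (griess_product V) {x \<in> carrier V. \<iota> x \<in> J}"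
    unfolding algebra_left_ideal_def griess_product_def using sub vsubspace_vimage[OF assms(1)] by auto
  have "J \<subseteq> Cimg" using assms(2) by (auto simp: T.wt_def)
  then show "\<iota> ` {x \<in> carrier V. \<iota> x \<in> J} = J" by blast
qed

lemma set_add_image:
  assumes "I \<subseteq> carrier V" "J \<subseteq> carrier V"
  shows "\<iota> ` (I <+>\<^bsub>V\<^esub> J) = {x + y | x y. x \<in> \<iota> ` I \<and> y \<in> \<iota> ` J}"
proof -
  have "\<iota> ` (I <+>\<^bsub>V\<^esub> J) = (\<Union>h\<in>I. \<Union>k\<in>J. {\<iota> (h \<oplus>\<^bsub>V\<^esub> k)})"
    by (auto simp: set_add_def')
  also have "\<dots> = (\<Union>h\<in>I. \<Union>k\<in>J. {\<iota> h + \<iota> k})"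
    using assms by (intro SUP_cong refl) (simp add: \<iota>_add subset_iff)
  also have "\<dots> = {x + y | x y. x \<in> \<iota> ` I \<and> y \<in> \<iota> ` J}" by blast
  finally show ?thesis .
qed

lemma inj_image_eq: "A \<subseteq> carrier V \<Longrightarrow> B \<subseteq> carrier V \<Longrightarrow> \<iota> ` A = \<iota> ` B \<Longrightarrow> A = B"
  by (rule inj_on_image_eq_iff[THEN iffD1, of \<iota> "carrier V"]) (auto simp: inj_on_def \<iota>_eq)

text \<open>The injective linear map \<open>\<iota>\<close> matches ideals with ideals and preserves
  intersections and sums, so complements correspond.\<close>

lemma semisimple_iff:
  "semisimple_algebra V (weight_space V 2) (griess_product V) \<longleftrightarrow>
    (\<forall>I. pm.subspace I \<and> I \<subseteq> T.wt 2 \<and> (\<forall>x\<in>T.wt 2. \<forall>y\<in>I. Mi x 1 y \<in> I) \<longrightarrow>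
      (\<exists>J. pm.subspace J \<and> J \<subseteq> T.wt 2 \<and> (\<forall>x\<in>T.wt 2. \<forall>y\<in>J. Mi x 1 y \<in> J) \<and>
        I \<inter> J = {0} \<and> {x + y | x y. x \<in> I \<and> y \<in> J} = T.wt 2))"
    (is "?L \<longleftrightarrow> (\<forall>I. ?id I \<longrightarrow> (\<exists>J. ?compl I J))")
proof -
  let ?ideal = "algebra_left_ideal V (weight_space V 2) (griess_product V)"
  have sub: "I \<subseteq> carrier V" if "?ideal I" for I
    using that weight_space_sub by (auto simp: algebra_left_ideal_def)
  have int: "I \<inter> J = {\<zero>\<^bsub>V\<^esub>} \<longleftrightarrow> \<iota> ` I \<inter> \<iota> ` J = {0}" if "I \<subseteq> carrier V" "J \<subseteq> carrier V" for I J
  proof -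
    have "\<iota> ` I \<inter> \<iota> ` J = \<iota> ` (I \<inter> J)"
      using that by (intro inj_on_image_Int[symmetric, of _ "carrier V"]) (auto simp: inj_on_def \<iota>_eq)
    moreover have "\<iota> ` (I \<inter> J) = \<iota> ` {\<zero>\<^bsub>V\<^esub>} \<longleftrightarrow> I \<inter> J = {\<zero>\<^bsub>V\<^esub>}"
      using that by (intro inj_on_image_eq_iff[of \<iota> "carrier V"]) (auto simp: inj_on_def \<iota>_eq)
    ultimately show ?thesis by (simp add: \<iota>_zero)
  qed
  have add: "I <+>\<^bsub>V\<^esub> J = weight_space V 2 \<longleftrightarrow> {x + y | x y. x \<in> \<iota> ` I \<and> y \<in> \<iota> ` J} = T.wt 2"
    if "I \<subseteq> carrier V" "J \<subseteq> carrier V" for I J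
  proof -
    have "I <+>\<^bsub>V\<^esub> J \<subseteq> carrier V" using that by (auto simp: set_add_def')
    then show ?thesis
      using inj_image_eq[of "I <+>\<^bsub>V\<^esub> J" "weight_space V 2"] weight_space_sub
      unfolding set_add_image[OF that, symmetric] wt_eq by blast
  qed
  show ?thesis
  proof
    assume L: ?L
    show "\<forall>I. ?id I \<longrightarrow> (\<exists>J. ?compl I J)"
    proof (intro allI impI)
      fix I assume I: "?id I"
      let ?I = "{x \<in> carrier V. \<iota> x \<in> I}"
      have I': "?ideal ?I" "\<iota> ` ?I = I" using I left_ideal_vimage[of I] by auto
      obtain J where J: "?ideal J" "?I \<inter> J = {\<zero>\<^bsub>V\<^esub>}" "?I <+>\<^bsub>V\<^esub> J = weight_space V 2"
        using L I'(1) unfolding semisimple_algebra_def by blast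
      have "I \<inter> \<iota> ` J = {0}" using int[OF sub[OF I'(1)] sub[OF J(1)]] J(2) I'(2) by simp
      moreover have "{x + y | x y. x \<in> I \<and> y \<in> \<iota> ` J} = T.wt 2"
        using add[OF sub[OF I'(1)] sub[OF J(1)]] J(3) I'(2) by simp
      ultimately show "\<exists>J. ?compl I J"
        using left_ideal_image[OF J(1)] by (intro exI[of _ "\<iota> ` J"]) blast
    qed
  next
    assume R: "\<forall>I. ?id I \<longrightarrow> (\<exists>J. ?compl I J)"
    show ?L
      unfolding semisimple_algebra_def
    proof (intro allI impI)
      fix I assume I: "?ideal I"
      then have "?id (\<iota> ` I)" using left_ideal_image[OF I] by blast
      then have "\<exists>J. ?compl (\<iota> ` I) J" by (rule mp[OF spec[OF R]])
      then obtain J where J: "?compl (\<iota> ` I) J" by (rule exE)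
      let ?J = "{x \<in> carrier V. \<iota> x \<in> J}"
      have J': "?ideal ?J" "\<iota> ` ?J = J" using J left_ideal_vimage[of J] by auto
      have "I \<inter> ?J = {\<zero>\<^bsub>V\<^esub>}" using int[OF sub[OF I] sub[OF J'(1)]] J J'(2) by simp
      moreover have "I <+>\<^bsub>V\<^esub> ?J = weight_space V 2"
        using add[OF sub[OF I] sub[OF J'(1)]] J J'(2) by simp
      ultimately show "\<exists>J. ?ideal J \<and> I \<inter> J = {\<zero>\<^bsub>V\<^esub>} \<and> I <+>\<^bsub>V\<^esub> J = weight_space V 2"
        using J'(1) by blast
    qed
  qed
qed

end

section \<open>Ideals of the two possible algebras\<close>

context moonshine_model begin

text \<open>The line spanned by \<open>y\<close> has no complement. An ideal \<open>J\<close>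
  complementing it would contain \<open>om - s *v y\<close> for some s, and multiplying this by
  \<open>y\<close> gives \<open>2 *v y\<close>, a nonzero vector of the intersection.\<close>

lemma nilpotent_not_semisimple:
  assumes y: "y \<in> wt 2" "y \<noteq> 0" "M y 1 y = 0" and sp: "wt 2 = {s *v om + t *v y | s t. True}"
  shows "\<exists>I. subspace I \<and> I \<subseteq> wt 2 \<and> (\<forall>x\<in>wt 2. \<forall>z\<in>I. M x 1 z \<in> I) \<and>
    \<not> (\<exists>J. subspace J \<and> J \<subseteq> wt 2 \<and> (\<forall>x\<in>wt 2. \<forall>z\<in>J. M x 1 z \<in> J) \<and>
        I \<inter> J = {0} \<and> {x + z | x z. x \<in> I \<and> z \<in> J} = wt 2)"
proof (intro exI conjI ballI notI)
  let ?I = "span {y}"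
  have I: "?I = {s *v y | s. True}" by (auto simp: span_singleton)
  show "subspace ?I" by simp
  show "?I \<subseteq> wt 2" using y(1) subspace_wt by (intro span_minimal) auto
  show "M x 1 z \<in> ?I" if x: "x \<in> wt 2" and z: "z \<in> ?I" for x z
  proof -
    obtain s where "z = s *v y" using z I by blast
    moreover obtain p q where "x = p *v om + q *v y" using x sp by blast
    ultimately have "M x 1 z = (s * (p * 2)) *v y" using y by (simp add: M_linear om_product)
    then show ?thesis using I by blast
  qed
  assume "\<exists>J. subspace J \<and> J \<subseteq> wt 2 \<and> (\<forall>x\<in>wt 2. \<forall>z\<in>J. M x 1 z \<in> J) \<and>
        ?I \<inter> J = {0} \<and> {x + z | x z. x \<in> ?I \<and> z \<in> J} = wt 2"
  then obtain J where J: "J \<subseteq> wt 2" "\<forall>x\<in>wt 2. \<forall>z\<in>J. M x 1 z \<in> J" "?I \<inter> J = {0}"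
    "{x + z | x z. x \<in> ?I \<and> z \<in> J} = wt 2" by blast
  have "om \<in> {x + z | x z. x \<in> ?I \<and> z \<in> J}" using J(4) om_wt by blast
  then obtain u j where "om = u + j" "u \<in> ?I" "j \<in> J" by blast
  moreover obtain s where "u = s *v y" using \<open>u \<in> ?I\<close> I by blast
  ultimately have j: "om = s *v y + j" "j \<in> J" by simp_all
  have "M y 1 om = M y 1 j" unfolding j(1) by (simp add: M_linear y)
  then have "M y 1 j = 2 *v y" using y by (simp add: om_product)
  then have "2 *v y \<in> J" using J(2) y(1) j(2) by metis
  moreover have "2 *v y \<in> ?I" using I by blast
  ultimately have "2 *v y = 0" using J(3) by blast
  with y(2) show False by simp
qed

text \<open>Multiplication by \<open>a\<close> or \<open>b\<close> isolates a coordinate, so an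
  ideal contains \<open>a\<close> as soon as one of its elements has a nonzero
  \<open>a\<close>-coordinate, and likewise \<open>b\<close>. Every ideal is thus spanned by a
  subset of \<open>{a, b}\<close>.\<close>

lemma idempotents_semisimple:
  assumes ab: "a \<in> wt 2" "b \<in> wt 2" "M a 1 a = 2 *v a" "M b 1 b = 2 *v b" "M a 1 b = 0" "M b 1 a = 0"
    and sp: "wt 2 = {s *v a + t *v b | s t. True}"
    and I: "subspace I" "I \<subseteq> wt 2" "\<forall>x\<in>wt 2. \<forall>y\<in>I. M x 1 y \<in> I"
  shows "\<exists>J. subspace J \<and> J \<subseteq> wt 2 \<and> (\<forall>x\<in>wt 2. \<forall>z\<in>J. M x 1 z \<in> J) \<and>
        I \<inter> J = {0} \<and> {x + z | x z. x \<in> I \<and> z \<in> J} = wt 2"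
proof -
  have prod: "M (s *v a + t *v b) 1 (s' *v a + t' *v b) = (2 * s * s') *v a + (2 * t * t') *v b" for s t s' t'
    by (simp add: M_linear ab scale_right_distrib algebra_simps)
  have comp: "s = 0 \<or> a \<in> I" "t = 0 \<or> b \<in> I" if st: "s *v a + t *v b \<in> I" for s t
  proof -
    have "M a 1 (s *v a + t *v b) \<in> I" "M b 1 (s *v a + t *v b) \<in> I" using I(3) ab st by blast+
    then have "(2 * s) *v a \<in> I" "(2 * t) *v b \<in> I" by (simp_all add: M_linear ab mult.commute)
    then have "(1 / (2 * s)) *v (2 * s) *v a \<in> I" "(1 / (2 * t)) *v (2 * t) *v b \<in> I"
      by (blast intro: subspace_scale[OF I(1)])+
    then show "s = 0 \<or> a \<in> I" "t = 0 \<or> b \<in> I" by (cases "s = 0", simp_all) (cases "t = 0", simp_all)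
  qed
  \<comment> \<open>The span of those among \<open>a\<close> and \<open>b\<close> that are not in
    \<open>I\<close>.\<close>
  let ?J = "{s *v a + t *v b | s t. (a \<in> I \<longrightarrow> s = 0) \<and> (b \<in> I \<longrightarrow> t = 0)}"
  show ?thesis
  proof (intro exI[of _ ?J] conjI ballI)
    show "subspace ?J"
      unfolding subspace_def
    proof (intro conjI ballI allI)
      have "0 *v a + 0 *v b \<in> ?J" by blast
      then show "0 \<in> ?J" by simp
      show "x + y \<in> ?J" if x: "x \<in> ?J" and y: "y \<in> ?J" for x y
      proof -
        obtain s t where s: "x = s *v a + t *v b" "a \<in> I \<longrightarrow> s = 0" "b \<in> I \<longrightarrow> t = 0" using x by blast
        obtain s' t' where s': "y = s' *v a + t' *v b" "a \<in> I \<longrightarrow> s' = 0" "b \<in> I \<longrightarrow> t' = 0" using y by blast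
        have "x + y = (s + s') *v a + (t + t') *v b" using s(1) s'(1) by (simp add: scale_left_distrib)
        then show ?thesis using s s' by (intro CollectI exI[of _ "s + s'"] exI[of _ "t + t'"]) auto
      qed
      show "r *v x \<in> ?J" if x: "x \<in> ?J" for r x
      proof -
        obtain s t where s: "x = s *v a + t *v b" "a \<in> I \<longrightarrow> s = 0" "b \<in> I \<longrightarrow> t = 0" using x by blast
        then show ?thesis by (intro CollectI exI[of _ "r * s"] exI[of _ "r * t"]) (auto simp: scale_right_distrib)
      qed
    qed
    show "?J \<subseteq> wt 2" unfolding sp by blast
    show "M x 1 z \<in> ?J" if x: "x \<in> wt 2" and z: "z \<in> ?J" for x z
    proof -
      obtain s t where s: "x = s *v a + t *v b" using x sp by blast
      obtain s' t' where s': "z = s' *v a + t' *v b" "a \<in> I \<longrightarrow> s' = 0" "b \<in> I \<longrightarrow> t' = 0" using z by blast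
      show ?thesis unfolding s s'(1) prod
        using s' by (intro CollectI exI[of _ "2 * s * s'"] exI[of _ "2 * t * t'"]) auto
    qed
    show "I \<inter> ?J = {0}"
    proof (intro equalityI subsetI)
      fix x assume x: "x \<in> I \<inter> ?J"
      then obtain s t where s: "x = s *v a + t *v b" "a \<in> I \<longrightarrow> s = 0" "b \<in> I \<longrightarrow> t = 0" by blast
      then have "s = 0" "t = 0" using comp[of s t] x by auto
      then show "x \<in> {0}" using s by simp
    next
      fix x assume "x \<in> {0 :: 'a}"
      then have x: "x = 0 *v a + 0 *v b" by simp
      then have "x \<in> ?J" by blast
      then show "x \<in> I \<inter> ?J" using subspace_0[OF I(1)] \<open>x \<in> {0}\<close> by simp
    qed
    show "{x + z | x z. x \<in> I \<and> z \<in> ?J} = wt 2"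
    proof (intro equalityI subsetI)
      fix x assume "x \<in> {x + z | x z. x \<in> I \<and> z \<in> ?J}"
      then obtain u z where u: "x = u + z" "u \<in> I" "z \<in> ?J" by blast
      moreover have "?J \<subseteq> wt 2" unfolding sp by blast
      ultimately have "u \<in> wt 2" "z \<in> wt 2" using I(2) by blast+
      then show "x \<in> wt 2" unfolding u(1) by (rule subspace_add[OF subspace_wt])
    next
      fix x assume "x \<in> wt 2"
      then obtain s t where x: "x = s *v a + t *v b" using sp by blast
      let ?s = "if a \<in> I then s else 0" and ?t = "if b \<in> I then t else 0"
      have "?s *v a + ?t *v b \<in> I"
        by (intro subspace_add[OF I(1)]) (auto intro: subspace_scale[OF I(1)] subspace_0[OF I(1)])
      moreover have "(s - ?s) *v a + (t - ?t) *v b \<in> ?J"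
        by (intro CollectI exI[of _ "s - ?s"] exI[of _ "t - ?t"]) auto
      moreover have "x = (?s *v a + ?t *v b) + ((s - ?s) *v a + (t - ?t) *v b)"
        unfolding x by (simp add: scale_left_diff_distrib)
      ultimately show "x \<in> {x + z | x z. x \<in> I \<and> z \<in> ?J}" by blast
    qed
  qed
qed

end

theorem theorem3p1:
  fixes V :: "'a voa" and c :: complex
  assumes "moonshine_type V c"
    and "c \<noteq> 0"
    and "generated_by V (weight_space V 2)"
    and "has_dim V (weight_space V 2) 2"
  shows "(semisimple_algebra V (weight_space V 2) (griess_product V) \<longrightarrow>
            (\<exists>c1 c2 U1 U2. c1 \<noteq> 0 \<and> c2 \<noteq> 0 \<and> c1 + c2 = c \<and>
               is_Vir_voa c1 U1 \<and> is_Vir_voa c2 U2 \<and> voa_isomorphic V (tensor_voa U1 U2)))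
       \<and> (\<not> semisimple_algebra V (weight_space V 2) (griess_product V) \<longrightarrow>
            (\<exists>U. is_W22_voa c U \<and> voa_isomorphic V U))"
proof -
  have V: "vertex_operator_algebra V c"
    using assms(1) by (simp add: moonshine_type_def simple_voa_def)
  then have mod: "Module.module complex_field V" by (rule vertex_operator_algebra.axioms)
  obtain \<iota> :: "'a \<Rightarrow> ('a \<Rightarrow>\<^sub>0 complex)" where \<iota>:
    "\<And>v w. v \<in> carrier V \<Longrightarrow> w \<in> carrier V \<Longrightarrow> \<iota> (v \<oplus>\<^bsub>V\<^esub> w) = \<iota> v + \<iota> w"
    "\<And>s v. v \<in> carrier V \<Longrightarrow> \<iota> (s \<odot>\<^bsub>V\<^esub> v) = pscale s (\<iota> v)"
    "\<And>v. v \<in> carrier V \<Longrightarrow> eval_formal V (\<iota> v) = v"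
    using linear_embedding[OF mod] by metis
  interpret embedded_voa V c \<iota> "eval_formal V"
    by (intro embedded_voa.intro V embedded_voa_axioms.intro)
      (simp_all add: \<iota> eval_formal_closed[OF mod] eval_formal_add[OF mod] eval_formal_pscale[OF mod])
  interpret M: moonshine_model pscale Mi Cimg "\<iota> (vacuum V)" "\<iota> (conformal V)" c
    by (rule moonshine_model_embedded[OF assms])
  show ?thesis
  \<comment> \<open>Each outcome of the dichotomy decides semisimplicity, so only one of the two
    implications has content in each case.\<close>
  proof (cases rule: M.dichotomy)
    case (nilpotent y)
    have "\<not> semisimple_algebra V (weight_space V 2) (griess_product V)"
      using M.nilpotent_not_semisimple[OF nilpotent(1-3,6)] unfolding semisimple_iff by blast
    moreover obtain U \<kappa> where U: "is_W22_voa c U"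
      "voa_copy pscale Mi Cimg (\<iota> (vacuum V)) (\<iota> (conformal V)) c Cimg (\<iota> (conformal V)) c U \<kappa>"
      using M.nilpotent_case[OF nilpotent(1,3-6)] by blast
    moreover have "voa_isomorphic V U"
      by (rule iso_copy[OF voa_copy.axioms(2)[OF U(2)]])
    ultimately show ?thesis by blast
  next
    case (idempotents a b c1 c2)
    have "semisimple_algebra V (weight_space V 2) (griess_product V)"
      unfolding semisimple_iff
      using M.idempotents_semisimple[OF idempotents(1-6,14)] by blast
    moreover
    interpret P: vir_pair pscale Mi Cimg "\<iota> (vacuum V)" "\<iota> (conformal V)" c a b c1 c2
      by unfold_locales (use idempotents in auto)
    interpret Q: vir_pair pscale Mi Cimg "\<iota> (vacuum V)" "\<iota> (conformal V)" c b a c2 c1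
      by (rule P.swap)
    obtain U1 \<kappa>1 where U1: "is_Vir_voa c1 U1"
      "voa_copy pscale Mi Cimg (\<iota> (vacuum V)) (\<iota> (conformal V)) c P.EA a c1 U1 \<kappa>1"
      using P.Vir_voa_A by blast
    obtain U2 \<kappa>2 where U2: "is_Vir_voa c2 U2"
      "voa_copy pscale Mi Cimg (\<iota> (vacuum V)) (\<iota> (conformal V)) c P.EB b c2 U2 \<kappa>2"
      using Q.Vir_voa_A by blast
    have "voa_isomorphic V (tensor_voa U1 U2)"
      by (rule iso_copy[OF P.tensor_voa_copy[OF U1(2) U2(2)]])
    ultimately show ?thesis using idempotents(10-12) U1(1) U2(1) by blast
  qed
qed

end
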